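(* The following implications hold. (A) Let $H$ be a constraint graph and consider the statements: (i) $H$ has a safe symbol; (i') $\mathrm{Hom}(\mathcal{G},H)$ is single-site fillable for every board $\mathcal{G}$; (ii) $H$ is chordal/tree decomposable; (iii) $\mathrm{Hom}(\mathcal{G},H)$ has the unique maximal configuration property for every board $\mathcal{G}$; (iv) $\mathrm{Hom}(\mathcal{G},H)$ satisfies topological strong spatial mixing (TSSM) for every board $\mathcal{G}$; (v) $\mathrm{Hom}(\mathcal{G},H)$ is strongly irreducible for every board $\mathcal{G}$; (vi) $H$ is dismantlable. Then (i) $\iff$ (i') $\implies$ (ii) $\implies$ (iii) $\implies$ (iv) $\implies$ (v) $\iff$ (vi). (B) Let $H$ be a constraint graph and $\mathcal{G}$ a fixed board. If $\mathrm{Hom}(\mathcal{G},H)$ has the unique maximal configuration property, then it satisfies TSSM; and if $\mathrm{Hom}(\mathcal{G},H)$ satisfies TSSM, then it is strongly irreducible. (C) Let $H$ be a constraint graph and $\mathcal{G}$ a fixed board of bounded degree. Consider: (S) for all $\gamma>0$ there exists a Gibbs $(\mathcal{G},H,\Phi)$-specification that satisfies exponential strong spatial mixing with decay rate $\gamma$; (W) for all $\gamma>0$ there exists a Gibbs $(\mathcal{G},H,\Phi)$-specification that satisfies exponential weak spatial mixing with decay rate $\gamma$. If $\mathrm{Hom}(\mathcal{G},H)$ has the unique maximal configuration property, then (S) holds; (S) implies (W); and if $H$ is dismantlable, then (W) holds.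
   Context: Graphs are undirected; $u\sim v$ denotes adjacency, $N(v)=\{u:u\sim v\}$ (so $v\in N(v)$ iff $v$ has a loop). A board is a countable, simple (loopless), connected, locally finite graph $\mathcal{G}=(\mathcal{V},\mathcal{E})$ with at least two vertices; it has bounded degree if $\sup_x|N(x)|<\infty$. A constraint graph is a finite graph $H=(V,E)$, loops allowed. $\mathrm{Hom}(\mathcal{G},H)$ is the set of graph homomorphisms $\omega:\mathcal{V}\to V$ (points). $\mathrm{dist}$ is graph distance in $\mathcal{G}$, $\mathrm{dist}(A,B)=\min_{x\in A,y\in B}\mathrm{dist}(x,y)$, $\mathrm{dist}(\cdot,\emptyset)=\infty$ (with $e^{-\gamma\infty}=0$), $\partial A=\{x:\mathrm{dist}(x,A)=1\}$, $\mathrm{N}_n(A)=\{x:\mathrm{dist}(x,A)\le n\}$, $\Sigma_B(\alpha_1,\alpha_2)=\{x\in B:\alpha_1(x)\ne\alpha_2(x)\}$. For $A\subseteq\mathcal{V}$, $\alpha\in V^A$ is globally admissible if $\alpha=\omega|_A$ for some point $\omega$; $\mathcal{L}_A$ is the set of these and $[\alpha]=\{\omega\in\mathrm{Hom}(\mathcal{G},H):\omega|_A=\alpha\}$. Concatenations such as $\alpha\beta$ denote the common extension of configurations on disjoint sets. Safe symbol: a vertex $s\in V$ with $\{s,v\}\in E$ for every $v\in V$ (including $v=s$). Single-site fillable (SSF): for every $x\in\mathcal{V}$ and $B\subseteq\partial\{x\}$, any homomorphism $\mathcal{G}[B]\to H$ extends to a homomorphism $\mathcal{G}[B\cup\{x\}]\to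 H$ (induced subgraphs). Strongly irreducible: there is $g\in\mathbb{N}$ such that for all nonempty disjoint finite $A,B\subseteq\mathcal{V}$ with $\mathrm{dist}(A,B)\ge g$ and all globally admissible $\alpha\in V^A$, $\beta\in V^B$, $\alpha\beta$ is globally admissible. TSSM: there is $g\in\mathbb{N}$ such that for all (disjoint) finite $A,B,S\subseteq\mathcal{V}$ with $\mathrm{dist}(A,B)\ge g$ and all $\alpha\in V^A,\beta\in V^B,\sigma\in V^S$, if $\alpha\sigma$ and $\sigma\beta$ are globally admissible then $\alpha\sigma\beta$ is globally admissible. Unique maximal configuration (UMC) property: for some $g\in\mathbb{N}$ there is a linear order $\prec$ on $V$ such that, writing $\omega\preccurlyeq\omega'$ if for every $x$ either $\omega(x)\prec\omega'(x)$ or $\omega(x)=\omega'(x)$, for every finite $A\subseteq\mathcal{V}$: (M1) for every $\alpha\in\mathcal{L}_A$ there is a unique point $\omega_\alpha\in[\alpha]$ with $\omega\preccurlyeq\omega_\alpha$ for every point $\omega\in[\alpha]$; (M2) for any two $\alpha_1,\alpha_2\in\mathcal{L}_A$, $\Sigma_{\mathcal{V}}(\omega_{\alpha_1},\omega_{\alpha_2})\subseteq\mathrm{N}_g(\Sigma_A(\alpha_1,\alpha_2))$. Dismantlable: if $u,v\in V$ satisfy $N(u)\subseteq N(v)$, a fold is a homomorphism from $H$ to the induced subgraph $H[V\setminus\{u\}]$ sending $u$ to $v$ and fixing all other vertices (so $v\ne u$). $H$ is dismantlable if there is a sequence of folds (possibly empty) reducing $H$ to a graph with a single vertex (with or without a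 loop). Chordal/tree decomposable: $H[A]$ denotes the subgraph induced by $A\subseteq V$, and $E[A_1:A_2]$ the set of edges with one end in $A_1$ and the other in $A_2$, for disjoint $A_1,A_2\subseteq V$. A finite simple graph is chordal if all cycles of four or more vertices have a chord, i.e. an edge that is not part of the cycle but connects two vertices of the cycle. A finite graph is loop-chordal if every vertex has a loop and the simple graph obtained by deleting all loops is chordal. A tree is a connected graph with no cycles (a loop counts as a cycle). $H$ is chordal/tree decomposable if one can write $V=C\sqcup T\sqcup J$ (where $T$ and $J$ may be empty) such that: (1) $H[C]$ is a nonempty loop-chordal graph; (2) $T=T_1\sqcup\cdots\sqcup T_m$ and, for every $1\le j\le m$, $H[T_j]$ is a tree such that there exist unique vertices $r_j\in T_j$ and $c^j\in C$ such that $\{r_j,c^j\}\in E$; (3) $J=J_1\sqcup\cdots\sqcup J_n$ and, for every $1\le k\le n$, $H[J_k]$ is a connected graph such that there exists a unique vertex $c^k\in C$ such that $\{u,c^k\}\in E$ for every $u\in J_k$; (4) $E[T:J]=E[T_{j_1}:T_{j_2}]=E[J_{k_1}:J_{k_2}]=\emptyset$ for every $j_1\ne j_2$ and $k_1\neq k_2$. Gibbs specification: a nearest-neighbour interaction for $H$ is a function $\Phi:V\cup E\to(-\infty,0]$; write $\Phi(u,v)=\Phi(\{u,v\})$. For finite $A\subseteq\mathcal{V}$, a point $\omega$ and $\alpha\in V^A$ such that $\alpha\,\omega|_{A^c}\in\mathrm{Hom}(\mathcal{G},H)$, let $$E^\Phi_{A,\omega}(\alpha)=\sum_{x\in A}\Big(\Phi(\alpha(x))+\tfrac12\sum_{y\in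 A:\,y\sim x}\Phi(\alpha(x),\alpha(y))+\sum_{y\in\partial A:\,y\sim x}\Phi(\alpha(x),\omega(y))\Big).$$ Let $\pi^\omega_A$ be the probability measure on $\mathcal{L}_A$ with $\pi^\omega_A(\alpha)$ proportional to $e^{-E^\Phi_{A,\omega}(\alpha)}$ if $\alpha\,\omega|_{A^c}\in\mathrm{Hom}(\mathcal{G},H)$, and $0$ otherwise; $\pi^\omega_A(\beta)=\sum_{\alpha\in\mathcal{L}_A:\alpha|_B=\beta}\pi^\omega_A(\alpha)$ for $\beta\in V^B$, $B\subseteq A$. The Gibbs $(\mathcal{G},H,\Phi)$-specification is $\pi=\{\pi^\omega_A\}$ over finite $A$ and points $\omega$. It satisfies exponential strong spatial mixing (resp. exponential weak spatial mixing) with decay rate $\gamma>0$ if there is $K>0$ such that for all finite $A\subseteq\mathcal{V}$, $B\subseteq A$, $\beta\in V^B$ and points $\omega_1,\omega_2$, $|\pi^{\omega_1}_A(\beta)-\pi^{\omega_2}_A(\beta)|\le|B|Ke^{-\gamma d}$ with $d=\mathrm{dist}(B,\Sigma_{\partial A}(\omega_1,\omega_2))$ (resp. $d=\mathrm{dist}(B,\partial A)$).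
   Formalization: In (ii), H is also required to be connected (two isolated looped vertices refute (ii)⇒(iii) as printed); c^k is read as the only neighbour in C of each u∈J_k; H is nonempty; in (A), boards have natural numbers as vertices (every board is isomorphic to one). *)

theory Defs
  imports
    Complex_Main
    "HOL-Library.FuncSet"
    "HOL-Library.Extended_Nat"
    "HOL-Library.Countable_Set"
    "HOL-Library.Disjoint_Sets"
begin

section \<open>Undirected graphs, loops allowed\<close>

text \<open>An edge is the unordered pair \<open>{u, v}\<close>; a loop at \<open>v\<close> is the singleton \<open>{v}\<close>.\<close>

record 'a ugraph =
  verts :: "'a set"
  edges :: "'a set set"

definition ugraph :: "'a ugraph \<Rightarrow> bool" where
  "ugraph G \<longleftrightarrow> (\<forall>e\<in>edges G. \<exists>u\<in>verts G. \<exists>v\<in>verts G. e = {u, v})"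

definition adj :: "'a ugraph \<Rightarrow> 'a \<Rightarrow> 'a \<Rightarrow> bool" where
  "adj G u v \<longleftrightarrow> {u, v} \<in> edges G"

definition nbhd :: "'a ugraph \<Rightarrow> 'a \<Rightarrow> 'a set" where
  "nbhd G v = {u. adj G u v}"

definition loopless :: "'a ugraph \<Rightarrow> bool" where
  "loopless G \<longleftrightarrow> (\<forall>v\<in>verts G. \<not> adj G v v)"

definition induced :: "'a ugraph \<Rightarrow> 'a set \<Rightarrow> 'a ugraph" where
  "induced G A = \<lparr>verts = verts G \<inter> A, edges = {e \<in> edges G. e \<subseteq> A}\<rparr>"

definition edges_between :: "'a ugraph \<Rightarrow> 'a set \<Rightarrow> 'a set \<Rightarrow> 'a set set" where
  "edges_between G A B = {e \<in> edges G. \<exists>u\<in>A. \<exists>v\<in>B. e = {u, v}}"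

definition walks :: "'a ugraph \<Rightarrow> 'a \<Rightarrow> 'a \<Rightarrow> 'a list set" where
  "walks G x y = {p. p \<noteq> [] \<and> set p \<subseteq> verts G \<and> successively (adj G) p \<and> hd p = x \<and> last p = y}"

definition connected_graph :: "'a ugraph \<Rightarrow> bool" where
  "connected_graph G \<longleftrightarrow> verts G \<noteq> {} \<and> (\<forall>x\<in>verts G. \<forall>y\<in>verts G. walks G x y \<noteq> {})"

definition vdist :: "'a ugraph \<Rightarrow> 'a \<Rightarrow> 'a \<Rightarrow> enat" where
  "vdist G x y = (INF p\<in>walks G x y. enat (length p - 1))"

text \<open>On \<^typ>\<open>enat\<close> a nonempty infimum is attained, and the infimum over the empty set is \<open>\<infinity>\<close>.\<close>

definition sdist :: "'a ugraph \<Rightarrow> 'a set \<Rightarrow> 'a set \<Rightarrow> enat" where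
  "sdist G A B = (INF x\<in>A. INF y\<in>B. vdist G x y)"

definition boundary :: "'a ugraph \<Rightarrow> 'a set \<Rightarrow> 'a set" where
  "boundary G A = {x \<in> verts G. sdist G {x} A = 1}"

definition nbhd_n :: "'a ugraph \<Rightarrow> nat \<Rightarrow> 'a set \<Rightarrow> 'a set" where
  "nbhd_n G n A = {x \<in> verts G. sdist G {x} A \<le> enat n}"

definition board :: "'a ugraph \<Rightarrow> bool" where
  "board G \<longleftrightarrow> ugraph G \<and> countable (verts G) \<and> loopless G \<and> connected_graph G
     \<and> (\<forall>x\<in>verts G. finite (nbhd G x)) \<and> (\<exists>x\<in>verts G. \<exists>y\<in>verts G. x \<noteq> y)"

definition bounded_degree :: "'a ugraph \<Rightarrow> bool" where
  "bounded_degree G \<longleftrightarrow> (\<exists>d::nat. \<forall>x\<in>verts G. finite (nbhd G x) \<and> card (nbhd G x) \<le> d)"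

definition constraint_graph :: "'a ugraph \<Rightarrow> bool" where
  "constraint_graph H \<longleftrightarrow> ugraph H \<and> finite (verts H) \<and> verts H \<noteq> {}"


section \<open>Homomorphism spaces\<close>

text \<open>
  A configuration in \<open>V\<^sup>A\<close> is a function in \<open>A \<rightarrow>\<^sub>E verts H\<close>, so that
  it carries no information outside \<open>A\<close> and equality of configurations is equality of functions.
\<close>

definition homs :: "'x ugraph \<Rightarrow> 'v ugraph \<Rightarrow> ('x \<Rightarrow> 'v) set" where
  "homs G H = {\<omega> \<in> verts G \<rightarrow>\<^sub>E verts H. \<forall>x\<in>verts G. \<forall>y\<in>verts G. adj G x y \<longrightarrow> adj H (\<omega> x) (\<omega> y)}"

definition language :: "'x ugraph \<Rightarrow> 'v ugraph \<Rightarrow> 'x set \<Rightarrow> ('x \<Rightarrow> 'v) set" where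
  "language G H A = (\<lambda>\<omega>. restrict \<omega> A) ` homs G H"

definition cylinder :: "'x ugraph \<Rightarrow> 'v ugraph \<Rightarrow> 'x set \<Rightarrow> ('x \<Rightarrow> 'v) \<Rightarrow> ('x \<Rightarrow> 'v) set" where
  "cylinder G H A \<alpha> = {\<omega> \<in> homs G H. restrict \<omega> A = \<alpha>}"

text \<open>
  \<open>glue A \<alpha> \<beta>\<close> is \<open>\<alpha>\<close> on \<open>A\<close> and \<open>\<beta>\<close> elsewhere; for \<open>\<alpha>\<close> on \<open>A\<close> and \<open>\<beta>\<close> on \<open>B\<close> it is the
  concatenation \<open>\<alpha>\<beta>\<close> on \<open>A \<union> B\<close>, and for a point \<open>\<omega>\<close> it is \<open>\<alpha>\<close> followed by the restriction of
  \<open>\<omega>\<close> to the complement of \<open>A\<close>.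
\<close>

definition glue :: "'x set \<Rightarrow> ('x \<Rightarrow> 'v) \<Rightarrow> ('x \<Rightarrow> 'v) \<Rightarrow> 'x \<Rightarrow> 'v" where
  "glue A \<alpha> \<beta> = override_on \<beta> \<alpha> A"

definition disagreement :: "'x set \<Rightarrow> ('x \<Rightarrow> 'v) \<Rightarrow> ('x \<Rightarrow> 'v) \<Rightarrow> 'x set" where
  "disagreement B \<alpha>1 \<alpha>2 = {x \<in> B. \<alpha>1 x \<noteq> \<alpha>2 x}"

definition single_site_fillable :: "'x ugraph \<Rightarrow> 'v ugraph \<Rightarrow> bool" where
  "single_site_fillable G H \<longleftrightarrow>
     (\<forall>x\<in>verts G. \<forall>B. B \<subseteq> boundary G {x} \<longrightarrow>
        (\<forall>f\<in>homs (induced G B) H. \<exists>f'\<in>homs (induced G (B \<union> {x})) H. restrict f' B = f))"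

definition strongly_irreducible :: "'x ugraph \<Rightarrow> 'v ugraph \<Rightarrow> bool" where
  "strongly_irreducible G H \<longleftrightarrow>
     (\<exists>g::nat. \<forall>A B. A \<subseteq> verts G \<longrightarrow> B \<subseteq> verts G \<longrightarrow> finite A \<longrightarrow> finite B \<longrightarrow>
        A \<noteq> {} \<longrightarrow> B \<noteq> {} \<longrightarrow> A \<inter> B = {} \<longrightarrow> sdist G A B \<ge> enat g \<longrightarrow>
        (\<forall>\<alpha>\<in>language G H A. \<forall>\<beta>\<in>language G H B. glue A \<alpha> \<beta> \<in> language G H (A \<union> B)))"

definition TSSM :: "'x ugraph \<Rightarrow> 'v ugraph \<Rightarrow> bool" where
  "TSSM G H \<longleftrightarrow>
     (\<exists>g::nat. \<forall>A B S. A \<subseteq> verts G \<longrightarrow> B \<subseteq> verts G \<longrightarrow> S \<subseteq> verts G \<longrightarrow>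
        finite A \<longrightarrow> finite B \<longrightarrow> finite S \<longrightarrow>
        A \<inter> B = {} \<longrightarrow> A \<inter> S = {} \<longrightarrow> B \<inter> S = {} \<longrightarrow> sdist G A B \<ge> enat g \<longrightarrow>
        (\<forall>\<alpha>\<in>A \<rightarrow>\<^sub>E verts H. \<forall>\<beta>\<in>B \<rightarrow>\<^sub>E verts H. \<forall>\<sigma>\<in>S \<rightarrow>\<^sub>E verts H.
           glue A \<alpha> \<sigma> \<in> language G H (A \<union> S) \<longrightarrow>
           glue S \<sigma> \<beta> \<in> language G H (S \<union> B) \<longrightarrow>
           glue A \<alpha> (glue S \<sigma> \<beta>) \<in> language G H (A \<union> S \<union> B)))"

definition config_le :: "'x ugraph \<Rightarrow> 'v rel \<Rightarrow> ('x \<Rightarrow> 'v) \<Rightarrow> ('x \<Rightarrow> 'v) \<Rightarrow> bool" where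
  "config_le G r \<omega> \<omega>' \<longleftrightarrow> (\<forall>x\<in>verts G. (\<omega> x, \<omega>' x) \<in> r \<or> \<omega> x = \<omega>' x)"

definition maximal_point ::
    "'x ugraph \<Rightarrow> 'v ugraph \<Rightarrow> 'v rel \<Rightarrow> 'x set \<Rightarrow> ('x \<Rightarrow> 'v) \<Rightarrow> ('x \<Rightarrow> 'v) \<Rightarrow> bool" where
  "maximal_point G H r A \<alpha> \<omega> \<longleftrightarrow>
     \<omega> \<in> cylinder G H A \<alpha> \<and> (\<forall>\<omega>'\<in>cylinder G H A \<alpha>. config_le G r \<omega>' \<omega>)"

definition UMC :: "'x ugraph \<Rightarrow> 'v ugraph \<Rightarrow> bool" where
  "UMC G H \<longleftrightarrow>
     (\<exists>(g::nat) r. strict_linear_order_on (verts H) r \<and>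
        (\<forall>A. A \<subseteq> verts G \<longrightarrow> finite A \<longrightarrow>
           (\<forall>\<alpha>\<in>language G H A. \<exists>!\<omega>. maximal_point G H r A \<alpha> \<omega>) \<and>
           (\<forall>\<alpha>1\<in>language G H A. \<forall>\<alpha>2\<in>language G H A. \<forall>\<omega>1 \<omega>2.
              maximal_point G H r A \<alpha>1 \<omega>1 \<longrightarrow> maximal_point G H r A \<alpha>2 \<omega>2 \<longrightarrow>
              disagreement (verts G) \<omega>1 \<omega>2 \<subseteq> nbhd_n G g (disagreement A \<alpha>1 \<alpha>2))))"


section \<open>Properties of constraint graphs\<close>

definition safe_symbol :: "'v ugraph \<Rightarrow> 'v \<Rightarrow> bool" where
  "safe_symbol H s \<longleftrightarrow> s \<in> verts H \<and> (\<forall>v\<in>verts H. {s, v} \<in> edges H)"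

definition is_fold :: "'v ugraph \<Rightarrow> 'v \<Rightarrow> 'v \<Rightarrow> ('v \<Rightarrow> 'v) \<Rightarrow> bool" where
  "is_fold H u v f \<longleftrightarrow> u \<in> verts H \<and> v \<in> verts H \<and> nbhd H u \<subseteq> nbhd H v \<and>
     f \<in> homs H (induced H (verts H - {u})) \<and> f u = v \<and> (\<forall>w\<in>verts H - {u}. f w = w)"

inductive dismantlable :: "'v ugraph \<Rightarrow> bool" where
  single: "verts H = {v} \<Longrightarrow> dismantlable H"
| fold: "is_fold H u v f \<Longrightarrow> dismantlable (induced H (verts H - {u})) \<Longrightarrow> dismantlable H"

definition cycle_edges :: "'a list \<Rightarrow> 'a set set" where
  "cycle_edges xs = {{xs ! i, xs ! (Suc i mod length xs)} | i. i < length xs}"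

text \<open>Cycles in the simple sense: at least three vertices. Loops are treated separately.\<close>

definition is_cycle :: "'a ugraph \<Rightarrow> 'a list \<Rightarrow> bool" where
  "is_cycle G xs \<longleftrightarrow> length xs \<ge> 3 \<and> distinct xs \<and> set xs \<subseteq> verts G \<and> cycle_edges xs \<subseteq> edges G"

definition chordal :: "'a ugraph \<Rightarrow> bool" where
  "chordal G \<longleftrightarrow> finite (verts G) \<and> loopless G \<and>
     (\<forall>xs. is_cycle G xs \<longrightarrow> length xs \<ge> 4 \<longrightarrow>
        (\<exists>u\<in>set xs. \<exists>v\<in>set xs. {u, v} \<in> edges G \<and> {u, v} \<notin> cycle_edges xs))"

definition loop_chordal :: "'a ugraph \<Rightarrow> bool" where
  "loop_chordal G \<longleftrightarrow> (\<forall>v\<in>verts G. adj G v v) \<and>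
     chordal \<lparr>verts = verts G, edges = edges G - {{v} | v. v \<in> verts G}\<rparr>"

definition is_tree :: "'a ugraph \<Rightarrow> bool" where
  "is_tree G \<longleftrightarrow> connected_graph G \<and> loopless G \<and> (\<forall>xs. \<not> is_cycle G xs)"

text \<open>
  \<open>\<T>\<close> and \<open>\<J>\<close> are the families \<open>T\<^sub>1, \<dots>, T\<^sub>m\<close> and \<open>J\<^sub>1, \<dots>, J\<^sub>n\<close> of nonempty parts.
  In the condition on the trees, the pair \<open>(r\<^sub>j, c\<^sup>j)\<close> is unique, i.e. exactly one edge
  joins \<open>T\<^sub>j\<close> to \<open>C\<close>.

  In the condition on the members \<open>J\<^sub>k\<close>, ``a unique \<open>c\<^sup>k \<in> C\<close> with \<open>{u, c\<^sup>k} \<in> E\<close> for every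
  \<open>u \<in> J\<^sub>k\<close>'' means that for every \<open>u \<in> J\<^sub>k\<close> the vertex \<open>c\<^sup>k\<close> is the only neighbour of \<open>u\<close> in \<open>C\<close>.
  Uniqueness only among the vertices adjacent to all of \<open>J\<^sub>k\<close> would not suffice for the unique
  maximal configuration property: let all of \<open>b, c, d, u, w\<close> have loops, with further edges
  \<open>bc, cd, uw, bu, bw, du\<close>. With \<open>C = {b, c, d}\<close> and \<open>J = {u, w}\<close>, only \<open>b\<close> is adjacent to both
  \<open>u\<close> and \<open>w\<close>, but folding \<open>w\<close> into \<open>b\<close> leaves a 4-cycle with loops, which admits no fold.
\<close>

definition chordal_tree_decomposable :: "'v ugraph \<Rightarrow> bool" where
  "chordal_tree_decomposable H \<longleftrightarrow>
     (\<exists>C T J \<T> \<J>.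
        verts H = C \<union> T \<union> J \<and> C \<inter> T = {} \<and> C \<inter> J = {} \<and> T \<inter> J = {} \<and>
        C \<noteq> {} \<and> loop_chordal (induced H C) \<and>
        partition_on T \<T> \<and>
        (\<forall>Tj\<in>\<T>. is_tree (induced H Tj) \<and>
           (\<exists>!(r, c). r \<in> Tj \<and> c \<in> C \<and> {r, c} \<in> edges H)) \<and>
        partition_on J \<J> \<and>
        (\<forall>Jk\<in>\<J>. connected_graph (induced H Jk) \<and>
           (\<exists>c\<in>C. \<forall>u\<in>Jk. \<forall>c'\<in>C. {u, c'} \<in> edges H \<longleftrightarrow> c' = c)) \<and>
        edges_between H T J = {} \<and>
        (\<forall>T1\<in>\<T>. \<forall>T2\<in>\<T>. T1 \<noteq> T2 \<longrightarrow> edges_between H T1 T2 = {}) \<and>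
        (\<forall>J1\<in>\<J>. \<forall>J2\<in>\<J>. J1 \<noteq> J2 \<longrightarrow> edges_between H J1 J2 = {}))"


section \<open>Gibbs specifications\<close>

text \<open>
  An interaction is a function on the disjoint union of vertices and edges:
  \<open>\<Phi> (Inl v)\<close> is \<open>\<Phi>(v)\<close> and \<open>\<Phi> (Inr {u, v})\<close> is \<open>\<Phi>(u, v)\<close>.
\<close>

definition interaction :: "'v ugraph \<Rightarrow> ('v + 'v set \<Rightarrow> real) \<Rightarrow> bool" where
  "interaction H \<Phi> \<longleftrightarrow> (\<forall>p \<in> verts H <+> edges H. \<Phi> p \<le> 0)"

definition energy ::
    "'x ugraph \<Rightarrow> ('v + 'v set \<Rightarrow> real) \<Rightarrow> 'x set \<Rightarrow> ('x \<Rightarrow> 'v) \<Rightarrow> ('x \<Rightarrow> 'v) \<Rightarrow> real" where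
  "energy G \<Phi> A \<omega> \<alpha> =
     (\<Sum>x\<in>A. \<Phi> (Inl (\<alpha> x))
        + 1/2 * (\<Sum>y\<in>{y \<in> A. adj G y x}. \<Phi> (Inr {\<alpha> x, \<alpha> y}))
        + (\<Sum>y\<in>{y \<in> boundary G A. adj G y x}. \<Phi> (Inr {\<alpha> x, \<omega> y})))"

definition compatible :: "'x ugraph \<Rightarrow> 'v ugraph \<Rightarrow> 'x set \<Rightarrow> ('x \<Rightarrow> 'v) \<Rightarrow> ('x \<Rightarrow> 'v) set" where
  "compatible G H A \<omega> = {\<alpha> \<in> language G H A. glue A \<alpha> \<omega> \<in> homs G H}"

definition gibbs ::
    "'x ugraph \<Rightarrow> 'v ugraph \<Rightarrow> ('v + 'v set \<Rightarrow> real) \<Rightarrow> 'x set \<Rightarrow> ('x \<Rightarrow> 'v) \<Rightarrow> ('x \<Rightarrow> 'v) \<Rightarrow> real" where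
  "gibbs G H \<Phi> A \<omega> \<alpha> =
     (if \<alpha> \<in> compatible G H A \<omega>
      then exp (- energy G \<Phi> A \<omega> \<alpha>) / (\<Sum>\<alpha>'\<in>compatible G H A \<omega>. exp (- energy G \<Phi> A \<omega> \<alpha>'))
      else 0)"

definition marginal ::
    "'x ugraph \<Rightarrow> 'v ugraph \<Rightarrow> ('x set \<Rightarrow> ('x \<Rightarrow> 'v) \<Rightarrow> ('x \<Rightarrow> 'v) \<Rightarrow> real) \<Rightarrow>
     'x set \<Rightarrow> ('x \<Rightarrow> 'v) \<Rightarrow> 'x set \<Rightarrow> ('x \<Rightarrow> 'v) \<Rightarrow> real" where
  "marginal G H \<pi> A \<omega> B \<beta> = (\<Sum>\<alpha>\<in>{\<alpha> \<in> language G H A. restrict \<alpha> B = \<beta>}. \<pi> A \<omega> \<alpha>)"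

definition exp_decay :: "real \<Rightarrow> enat \<Rightarrow> real" where
  "exp_decay \<gamma> d = (case d of enat n \<Rightarrow> exp (- \<gamma> * real n) | \<infinity> \<Rightarrow> 0)"

definition exp_SSM ::
    "'x ugraph \<Rightarrow> 'v ugraph \<Rightarrow> ('x set \<Rightarrow> ('x \<Rightarrow> 'v) \<Rightarrow> ('x \<Rightarrow> 'v) \<Rightarrow> real) \<Rightarrow> real \<Rightarrow> bool" where
  "exp_SSM G H \<pi> \<gamma> \<longleftrightarrow>
     (\<exists>K>0. \<forall>A B. A \<subseteq> verts G \<longrightarrow> finite A \<longrightarrow> B \<subseteq> A \<longrightarrow>
        (\<forall>\<beta>\<in>B \<rightarrow>\<^sub>E verts H. \<forall>\<omega>1\<in>homs G H. \<forall>\<omega>2\<in>homs G H.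
           \<bar>marginal G H \<pi> A \<omega>1 B \<beta> - marginal G H \<pi> A \<omega>2 B \<beta>\<bar>
             \<le> real (card B) * K * exp_decay \<gamma> (sdist G B (disagreement (boundary G A) \<omega>1 \<omega>2))))"

definition exp_WSM ::
    "'x ugraph \<Rightarrow> 'v ugraph \<Rightarrow> ('x set \<Rightarrow> ('x \<Rightarrow> 'v) \<Rightarrow> ('x \<Rightarrow> 'v) \<Rightarrow> real) \<Rightarrow> real \<Rightarrow> bool" where
  "exp_WSM G H \<pi> \<gamma> \<longleftrightarrow>
     (\<exists>K>0. \<forall>A B. A \<subseteq> verts G \<longrightarrow> finite A \<longrightarrow> B \<subseteq> A \<longrightarrow>
        (\<forall>\<beta>\<in>B \<rightarrow>\<^sub>E verts H. \<forall>\<omega>1\<in>homs G H. \<forall>\<omega>2\<in>homs G H.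
           \<bar>marginal G H \<pi> A \<omega>1 B \<beta> - marginal G H \<pi> A \<omega>2 B \<beta>\<bar>
             \<le> real (card B) * K * exp_decay \<gamma> (sdist G B (boundary G A))))"

definition exists_SSM :: "'x ugraph \<Rightarrow> 'v ugraph \<Rightarrow> bool" where
  "exists_SSM G H \<longleftrightarrow> (\<forall>\<gamma>>0. \<exists>\<Phi>. interaction H \<Phi> \<and> exp_SSM G H (gibbs G H \<Phi>) \<gamma>)"

definition exists_WSM :: "'x ugraph \<Rightarrow> 'v ugraph \<Rightarrow> bool" where
  "exists_WSM G H \<longleftrightarrow> (\<forall>\<gamma>>0. \<exists>\<Phi>. interaction H \<Phi> \<and> exp_WSM G H (gibbs G H \<Phi>) \<gamma>)"

text \<open>
  ``For every board'' cannot quantify over vertex types inside a formula; a board is countable,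
  hence isomorphic to one whose vertices are natural numbers, and all the properties
  concerned are invariant under isomorphism.
\<close>

definition every_board :: "(nat ugraph \<Rightarrow> bool) \<Rightarrow> bool" where
  "every_board P \<longleftrightarrow> (\<forall>G. board G \<longrightarrow> P G)"

end

theory Submission imports Defs
begin

text \<open>
  The implications between the properties of \<open>H\<close> are all about folding, that is, replacing a vertex
  \<open>u\<close> by a vertex \<open>t\<close> with \<open>N(u) \<subseteq> N(t)\<close>.

  A star whose leaves carry all the vertices of \<open>H\<close> can be filled at its centre only with a safe
  symbol. A safe symbol \<open>s\<close> gives a chordal/tree decomposition with \<open>C = {s}\<close>, the sets \<open>J\<^sub>k\<close> being
  the components of \<open>H - s\<close>.

  From a decomposition one gets maximal points by eliminating the vertices of \<open>H\<close> one by one: those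
  of \<open>J\<close>, then leaves of the trees, then simplicial vertices of the chordal part. Instead of a
  configuration on a finite set one prescribes a list of admissible values at every site. When \<open>u\<close>
  is eliminated, a site whose list is \<open>{u}\<close> keeps that value for good, after the lists of its
  neighbours have been cut down to \<open>N(u)\<close>; at all other sites \<open>u\<close> can be exchanged for another
  element of the list that dominates it. Making \<open>u\<close> the least vertex, a maximal point of the smaller
  problem becomes a maximal point of the original one. As one elimination looks at the neighbours
  of a site only, the value of the maximal point at \<open>x\<close> depends on lists within distance \<open>|V|\<close> of
  \<open>x\<close> (\<open>eliminable_imp_list_max\<close>). The exchange is possible because few kinds of lists occur: the
  full one, singletons, and lists whose chordal part is a clique (\<open>decomposition_eliminable\<close>).

  If maximal points exist, the one over \<open>\<alpha>\<sigma>\<close> and the one over \<open>\<sigma>\<beta>\<close> differ from the one over \<open>\<sigma>\<close> only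
  near \<open>A\<close> and near \<open>B\<close>, so that the three can be patched together; this is TSSM, of which strong
  irreducibility is the case \<open>S = {}\<close>.

  If \<open>H\<close> is dismantlable, performing more and more folds while moving away from \<open>A\<close> deforms any point
  into a constant one within a bounded distance, and so connects any two configurations on distant
  sets. Conversely, strong irreducibility passes from \<open>H\<close> to its folds, and fails for a graph with at
  least two vertices that admits no fold: on the board made of layers of copies of \<open>V\<close>, with
  \<open>(v, n) \<sim> (w, n + 1)\<close> iff \<open>v \<sim> w\<close>, a point that is the projection on layer \<open>0\<close> is the projection
  on all layers (\<open>stiff_not_strongly_irreducible\<close>).

  For the Gibbs specifications, let a vertex of rank \<open>k\<close> have weight \<open>e\<^sup>c\<^sup>k\<close> with \<open>c\<close> large and give
  the edges no energy. Ranks come from the order on \<open>V\<close> or from the time at which a vertex is folded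
  away. Under either hypothesis there is a reference point \<open>\<theta>\<close> such that every configuration can be
  changed, in a bounded neighbourhood of a set \<open>Q\<close> of sites, to one that is nowhere lower in rank
  and strictly higher wherever on \<open>Q\<close> it differed from \<open>\<theta>\<close>; in the case of folds, \<open>Q\<close> has to keep
  away from the boundary. By a Peierls argument, the probability
  to differ from \<open>\<theta>\<close> on all of \<open>Q\<close> is at most \<open>\<epsilon>\<close> to the power \<open>|Q|\<close> (\<open>peierls_bound\<close>). Now draw
  independent configurations for the two boundary conditions. Unless a path of sites at which one
  of them differs from its reference point leads from \<open>B\<close> to where the boundary conditions are felt,
  the two configurations can be swapped on the component of such sites around \<open>B\<close>, so the
  contributions to the two marginals cancel; counting paths bounds the probability of the
  exceptional event (\<open>disagreement_percolation\<close>).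
\<close>

section \<open>Distances and homomorphisms\<close>

lemma adj_commute: "adj G x y \<longleftrightarrow> adj G y x"
  by (simp add: adj_def insert_commute)

lemma adj_sym: "adj G x y \<Longrightarrow> adj G y x"
  by (simp add: adj_commute)

lemma adj_in_verts:
  assumes "ugraph G" "adj G x y"
  shows "x \<in> verts G" "y \<in> verts G"
proof -
  obtain u v where "u \<in> verts G" "v \<in> verts G" "{x, y} = {u, v}"
    using assms by (force simp: ugraph_def adj_def)
  then show "x \<in> verts G" "y \<in> verts G" by (auto simp: doubleton_eq_iff)
qed

text \<open>
  Bounds \<open>dist(x, y) \<le> n\<close> are all that is needed about distances; in this form they can be handled by
  induction on \<open>n\<close>, without computing with infima over walks.
\<close>

definition near :: "'a ugraph \<Rightarrow> nat \<Rightarrow> 'a \<Rightarrow> 'a \<Rightarrow> bool" where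
  "near G n x y \<longleftrightarrow> (\<exists>p\<in>walks G x y. length p \<le> Suc n)"

lemma enat_le_iff_less_Suc: "(d::enat) \<le> enat n \<longleftrightarrow> d < enat (Suc n)"
  by (cases d) auto

lemma INF_le_enat_iff: "(INF x\<in>A. f x) \<le> enat n \<longleftrightarrow> (\<exists>x\<in>A. f x \<le> enat n)"
  by (simp add: enat_le_iff_less_Suc INF_less_iff)

lemma vdist_le_iff: "vdist G x y \<le> enat n \<longleftrightarrow> near G n x y"
  unfolding vdist_def INF_le_enat_iff near_def by (intro bex_cong) auto

lemma sdist_le_iff: "sdist G A B \<le> enat n \<longleftrightarrow> (\<exists>x\<in>A. \<exists>y\<in>B. near G n x y)"
  unfolding sdist_def INF_le_enat_iff vdist_le_iff by simp

lemma near_0: "near G 0 x y \<longleftrightarrow> x = y \<and> x \<in> verts G"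
proof
  assume "near G 0 x y"
  then obtain p where "p \<in> walks G x y" "length p \<le> 1" by (auto simp: near_def)
  then show "x = y \<and> x \<in> verts G"
    by (cases p) (auto simp: walks_def)
next
  assume "x = y \<and> x \<in> verts G"
  then have "[x] \<in> walks G x y" by (auto simp: walks_def)
  then show "near G 0 x y" unfolding near_def by force
qed

lemma near_Suc:
  "near G (Suc n) x z \<longleftrightarrow> near G n x z \<or> (\<exists>y. x \<in> verts G \<and> adj G x y \<and> near G n y z)"
proof
  assume "near G (Suc n) x z"
  then obtain p where p: "p \<in> walks G x z" "length p \<le> Suc (Suc n)" by (auto simp: near_def)
  show "near G n x z \<or> (\<exists>y. x \<in> verts G \<and> adj G x y \<and> near G n y z)"
  proof (cases "length p \<le> Suc n")
    case True then show ?thesis using p by (auto simp: near_def)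
  next
    case False
    then obtain a b q where pq: "p = a # b # q"
      using p by (metis (no_types, lifting) Suc_le_length_iff length_Suc_conv not_less_eq_eq order_antisym)
    then have "b # q \<in> walks G b z" using p by (auto simp: walks_def)
    then have "near G n b z" using p pq unfolding near_def by (intro bexI[of _ "b # q"]) auto
    then show ?thesis using p pq by (auto simp: walks_def)
  qed
next
  assume "near G n x z \<or> (\<exists>y. x \<in> verts G \<and> adj G x y \<and> near G n y z)"
  then show "near G (Suc n) x z"
  proof
    assume "near G n x z" then show ?thesis unfolding near_def by force
  next
    assume "\<exists>y. x \<in> verts G \<and> adj G x y \<and> near G n y z"
    then obtain y p where "x \<in> verts G" "adj G x y" "p \<in> walks G y z" "length p \<le> Suc n"
      by (auto simp: near_def)
    then have "x # p \<in> walks G x z" "length (x # p) \<le> Suc (Suc n)"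
      by (auto simp: walks_def successively_Cons)
    then show ?thesis unfolding near_def by blast
  qed
qed

lemma near_refl: "x \<in> verts G \<Longrightarrow> near G n x x"
  by (induction n) (auto simp: near_0 near_Suc)

lemma near_mono: "near G m x y \<Longrightarrow> m \<le> n \<Longrightarrow> near G n x y"
  unfolding near_def by force

lemma near_in_verts: "near G n x y \<Longrightarrow> x \<in> verts G \<and> y \<in> verts G"
  by (auto simp: near_def walks_def)

lemma near_trans: "near G m x y \<Longrightarrow> near G n y z \<Longrightarrow> near G (m + n) x z"
proof (induction m arbitrary: x)
  case 0 then show ?case by (simp add: near_0)
next
  case (Suc m)
  then show ?case by (auto simp: near_Suc)
qed

lemma near_sym: "near G n x y \<Longrightarrow> near G n y x"
proof -
  assume "near G n x y"
  then obtain p where p: "p \<in> walks G x y" "length p \<le> Suc n" by (auto simp: near_def)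
  have "successively (adj G) (rev p)"
    using p by (auto simp: walks_def adj_commute)
  then have "rev p \<in> walks G y x" using p by (auto simp: walks_def hd_rev last_rev)
  then show ?thesis unfolding near_def using p by (intro bexI[of _ "rev p"]) auto
qed

lemma near_1:
  assumes "ugraph G" "adj G x y"
  shows "near G 1 x y"
  using assms adj_in_verts[OF assms] by (auto simp: near_Suc near_0)

lemma near_step: "ugraph G \<Longrightarrow> adj G x y \<Longrightarrow> near G n y z \<Longrightarrow> near G (Suc n) x z"
  using adj_in_verts by (fastforce simp: near_Suc)

lemma mem_nbhd_n_iff: "x \<in> nbhd_n G n A \<longleftrightarrow> (\<exists>y\<in>A. near G n x y)"
  unfolding nbhd_n_def sdist_le_iff using near_in_verts by fastforce

lemma sdist_ge_iff: "enat n \<le> sdist G A B \<longleftrightarrow> (\<forall>m<n. \<forall>x\<in>A. \<forall>y\<in>B. \<not> near G m x y)"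
proof (cases n)
  case 0 then show ?thesis by (simp add: zero_enat_def[symmetric])
next
  case (Suc k)
  have "enat n \<le> sdist G A B \<longleftrightarrow> \<not> sdist G A B \<le> enat k"
    by (simp add: Suc enat_le_iff_less_Suc not_less)
  then show ?thesis using Suc near_mono[of G _ _ _ k]
    by (fastforce simp: sdist_le_iff less_Suc_eq_le)
qed

lemma mem_boundary_iff:
  assumes "ugraph G" "A \<subseteq> verts G"
  shows "x \<in> boundary G A \<longleftrightarrow> x \<notin> A \<and> (\<exists>y\<in>A. adj G x y)"
proof -
  have "sdist G {x} A = 1 \<longleftrightarrow> sdist G {x} A \<le> enat 1 \<and> \<not> sdist G {x} A \<le> enat 0"
    by (cases "sdist G {x} A") (auto simp: one_enat_def)
  then show ?thesis
    using assms adj_in_verts[OF assms(1)]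
    unfolding boundary_def sdist_le_iff One_nat_def
    by (auto simp: near_Suc near_0)
qed

lemma finite_ball:
  assumes "\<forall>x\<in>verts G. finite (nbhd G x)"
  shows "finite {y. near G n x y}"
proof (induction n arbitrary: x)
  case 0 then show ?case by (rule finite_subset[of _ "{x}"]) (auto simp: near_0)
next
  case (Suc n)
  have "{y. near G (Suc n) x y} \<subseteq> {y. near G n x y} \<union> (\<Union>z\<in>{z\<in>nbhd G x. x \<in> verts G}. {y. near G n z y})"
    by (auto simp: near_Suc nbhd_def adj_commute)
  moreover have "finite {z\<in>nbhd G x. x \<in> verts G}" using assms by auto
  ultimately show ?case using Suc by (meson finite_UN_I finite_UnI finite_subset)
qed

text \<open>
  The constant is \<open>d + 1\<close> rather than \<open>d\<close> since a ball of radius \<open>n + 1\<close> is covered by the balls of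
  radius \<open>n\<close> around its centre and around the neighbours of its centre.
\<close>

lemma card_ball_le:
  assumes "\<forall>x\<in>verts G. finite (nbhd G x) \<and> card (nbhd G x) \<le> d"
  shows "card {y. near G n x y} \<le> (d + 1) ^ n"
proof (induction n arbitrary: x)
  case 0
  have "card {y. near G 0 x y} \<le> card {x}" by (rule card_mono) (auto simp: near_0)
  then show ?case by simp
next
  case (Suc n)
  let ?N = "{z\<in>nbhd G x. x \<in> verts G}"
  have N: "finite ?N" "card ?N \<le> d" using assms by (cases "x \<in> verts G"; auto)+
  have sub: "{y. near G (Suc n) x y} \<subseteq> {y. near G n x y} \<union> (\<Union>z\<in>?N. {y. near G n z y})"
    by (auto simp: near_Suc nbhd_def adj_commute)
  have fb: "finite {y. near G n z y}" for z using assms by (intro finite_ball) auto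
  have "card {y. near G (Suc n) x y} \<le> card ({y. near G n x y} \<union> (\<Union>z\<in>?N. {y. near G n z y}))"
    by (rule card_mono[OF _ sub]) (use N fb in auto)
  also have "\<dots> \<le> card {y. near G n x y} + card (\<Union>z\<in>?N. {y. near G n z y})"
    by (rule card_Un_le)
  also have "card (\<Union>z\<in>?N. {y. near G n z y}) \<le> (\<Sum>z\<in>?N. card {y. near G n z y})"
    by (rule card_UN_le[OF N(1)])
  also have "\<dots> \<le> (\<Sum>z\<in>?N. (d+1)^n)" by (rule sum_mono) (rule Suc)
  also have "\<dots> \<le> d * (d+1)^n" using N by simp
  finally show ?case using Suc[of x] by simp
qed

lemma homsD:
  assumes "\<omega> \<in> homs G H"
  shows "x \<in> verts G \<Longrightarrow> \<omega> x \<in> verts H"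
    and "x \<in> verts G \<Longrightarrow> y \<in> verts G \<Longrightarrow> adj G x y \<Longrightarrow> adj H (\<omega> x) (\<omega> y)"
    and "\<omega> \<in> extensional (verts G)"
  using assms by (auto simp: homs_def PiE_def)

lemma homsI:
  assumes "\<And>x. x \<in> verts G \<Longrightarrow> \<omega> x \<in> verts H"
    and "\<And>x y. x \<in> verts G \<Longrightarrow> y \<in> verts G \<Longrightarrow> adj G x y \<Longrightarrow> adj H (\<omega> x) (\<omega> y)"
    and "\<omega> \<in> extensional (verts G)"
  shows "\<omega> \<in> homs G H"
  using assms by (auto simp: homs_def PiE_def)

lemma homs_restrictI:
  assumes "\<And>x. x \<in> verts G \<Longrightarrow> f x \<in> verts H"
    and "\<And>x y. x \<in> verts G \<Longrightarrow> y \<in> verts G \<Longrightarrow> adj G x y \<Longrightarrow> adj H (f x) (f y)"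
  shows "restrict f (verts G) \<in> homs G H"
  using assms by (intro homsI) auto

lemma languageI: "\<omega> \<in> homs G H \<Longrightarrow> (\<And>x. x \<in> A \<Longrightarrow> \<omega> x = \<alpha> x) \<Longrightarrow> \<alpha> \<in> extensional A
   \<Longrightarrow> \<alpha> \<in> language G H A"
  unfolding language_def
  by (rule image_eqI[of _ _ \<omega>]) (auto simp: extensional_def fun_eq_iff)

lemma languageE:
  assumes "\<alpha> \<in> language G H A"
  obtains \<omega> where "\<omega> \<in> homs G H" "\<And>x. x \<in> A \<Longrightarrow> \<omega> x = \<alpha> x" "\<alpha> \<in> extensional A"
  using assms unfolding language_def by auto

lemma board_ugraph: "board G \<Longrightarrow> ugraph G" by (simp add: board_def)

section \<open>Paths in vertex sets\<close>

definition linked :: "'v ugraph \<Rightarrow> 'v set \<Rightarrow> 'v \<Rightarrow> 'v \<Rightarrow> bool" where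
  "linked H X = (\<lambda>x y. adj H x y \<and> x \<in> X \<and> y \<in> X)\<^sup>*\<^sup>*"

definition path_in :: "'v ugraph \<Rightarrow> 'v set \<Rightarrow> 'v \<Rightarrow> 'v \<Rightarrow> 'v list \<Rightarrow> bool" where
  "path_in H X a b p \<longleftrightarrow> p \<noteq> [] \<and> set p \<subseteq> X \<and> successively (adj H) p \<and> hd p = a \<and> last p = b"

lemma linked_imp_path_in:
  assumes "linked H X a b" "a \<in> X"
  shows "\<exists>p. path_in H X a b p"
  using assms unfolding linked_def
proof (induction rule: converse_rtranclp_induct)
  case base
  then show ?case by (intro exI[of _ "[b]"]) (auto simp: path_in_def)
next
  case (step y z)
  then obtain p where "path_in H X z b p" by auto
  then have "path_in H X y b (y # p)" using step by (auto simp: path_in_def successively_Cons)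
  then show ?case by blast
qed

lemma path_in_imp_linked:
  assumes "path_in H X a b p"
  shows "linked H X a b"
  using assms
proof (induction p arbitrary: a)
  case Nil then show ?case by (simp add: path_in_def)
next
  case (Cons x p)
  show ?case
  proof (cases p)
    case Nil then show ?thesis using Cons.prems by (auto simp: path_in_def linked_def)
  next
    case (Cons y q)
    then have "path_in H X y b p" "adj H a y" "a \<in> X" "y \<in> X"
      using Cons.prems by (auto simp: path_in_def)
    then show ?thesis using Cons.IH[of y] unfolding linked_def
      by (metis (mono_tags, lifting) converse_rtranclp_into_rtranclp)
  qed
qed

lemma path_in_splice:
  assumes p: "path_in H X a b p" and ij: "i < length p" "j < length p"
    and e: "adj H (p ! i) (p ! j)"
  shows "path_in H X a b (take (Suc i) p @ drop j p)"
proof -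
  have s: "successively (adj H) (take (Suc i) p)" "successively (adj H) (drop j p)"
    using p successively_append_iff[of "adj H" "take (Suc i) p" "drop (Suc i) p"]
      successively_append_iff[of "adj H" "take j p" "drop j p"]
    by (auto simp: path_in_def)
  have "last (take (Suc i) p) = p ! i" using ij by (simp add: take_Suc_conv_app_nth)
  moreover have "hd (drop j p) = p ! j" using ij by (simp add: hd_drop_conv_nth)
  ultimately have "successively (adj H) (take (Suc i) p @ drop j p)"
    using s e by (auto simp: successively_append_iff)
  moreover have "set (take (Suc i) p @ drop j p) \<subseteq> X"
    using p set_take_subset[of "Suc i" p] set_drop_subset[of j p] by (auto simp: path_in_def)
  moreover have "hd (take (Suc i) p @ drop j p) = a" using p ij by (cases p) (auto simp: path_in_def)
  moreover have "last (take (Suc i) p @ drop j p) = b" using p ij by (simp add: path_in_def)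
  ultimately show ?thesis using ij by (auto simp: path_in_def)
qed

lemma path_in_truncate:
  assumes p: "path_in H X a b p" and i: "i < length p"
  shows "path_in H X a (p ! i) (take (Suc i) p)"
proof -
  have "successively (adj H) (take (Suc i) p)"
    using p successively_append_iff[of "adj H" "take (Suc i) p" "drop (Suc i) p"]
    by (auto simp: path_in_def)
  moreover have "last (take (Suc i) p) = p ! i" using i by (simp add: take_Suc_conv_app_nth)
  moreover have "hd (take (Suc i) p) = a" using p i by (cases p) (auto simp: path_in_def)
  moreover have "set (take (Suc i) p) \<subseteq> X"
    using p set_take_subset[of "Suc i" p] by (auto simp: path_in_def)
  ultimately show ?thesis using p i by (auto simp: path_in_def)
qed

lemma path_in_nth_adj: "path_in H X a b p \<Longrightarrow> Suc i < length p \<Longrightarrow> adj H (p ! i) (p ! Suc i)"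
  by (auto simp: path_in_def successively_conv_nth)

text \<open>
  A shortest path has neither repetitions nor chords, because either would allow a shortcut.
\<close>

lemma linked_imp_induced_path:
  assumes "linked H X a b" "a \<in> X"
  obtains p where "path_in H X a b p" "distinct p"
    "\<And>i j. Suc i < j \<Longrightarrow> j < length p \<Longrightarrow> \<not> adj H (p ! i) (p ! j)"
proof -
  obtain p where p: "path_in H X a b p" and min: "\<And>q. path_in H X a b q \<Longrightarrow> length p \<le> length q"
    using ex_has_least_nat[of "path_in H X a b" _ length] linked_imp_path_in[OF assms] by metis
  have "\<not> adj H (p ! i) (p ! j)" if "Suc i < j" "j < length p" for i j
    using min[OF path_in_splice[OF p, of i j]] that by auto
  moreover have "p ! i \<noteq> p ! j" if ij: "i < j" "j < length p" for i j
  proof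
    assume e: "p ! i = p ! j"
    show False
    proof (cases "Suc j < length p")
      case True
      then have "adj H (p ! i) (p ! Suc j)" using path_in_nth_adj[OF p True] e by simp
      then show False using min[OF path_in_splice[OF p, of i "Suc j"]] True ij by simp
    next
      case False
      then have "p ! j = last p" using ij by (metis Suc_lessI diff_Suc_1 last_conv_nth list.size(3) not_less_zero)
      then have "p ! i = b" using e p by (auto simp: path_in_def)
      then show False using min[of "take (Suc i) p"] path_in_truncate[OF p, of i] ij by auto
    qed
  qed
  then have "distinct p" unfolding distinct_conv_nth by (metis linorder_neqE_nat)
  ultimately show thesis using that p by blast
qed

lemma linked_sym: "linked H X a b \<Longrightarrow> linked H X b a"
  unfolding linked_def
proof (induction rule: rtranclp_induct)
  case (step y z)
  then show ?case by (metis (mono_tags, lifting) adj_commute converse_rtranclp_into_rtranclp)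
qed simp

lemma linked_mono: "linked H X a b \<Longrightarrow> X \<subseteq> Y \<Longrightarrow> linked H Y a b"
  unfolding linked_def by (erule rtranclp_mono[THEN predicate2D, rotated]) auto

lemma linked_adj: "adj H a b \<Longrightarrow> a \<in> X \<Longrightarrow> b \<in> X \<Longrightarrow> linked H X a b"
  by (auto simp: linked_def)

lemma linked_trans: "linked H X a b \<Longrightarrow> linked H X b c \<Longrightarrow> linked H X a c"
  unfolding linked_def by simp

lemma linked_closed:
  assumes "linked H X a b" "a \<in> Y" "\<And>x y. x \<in> Y \<Longrightarrow> x \<in> X \<Longrightarrow> y \<in> X \<Longrightarrow> adj H x y \<Longrightarrow> y \<in> Y"
  shows "b \<in> Y"
  using assms(1,2) unfolding linked_def
  by (induction rule: rtranclp_induct) (use assms(3) in auto)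

text \<open>
  Folding maps walks to walks, so it preserves connectedness.
\<close>

lemma linked_fold:
  assumes "linked H W a b" "a \<noteq> u" "b \<noteq> u"
    and t: "t \<in> W" "t \<noteq> u" "\<And>w. w \<in> W \<Longrightarrow> adj H u w \<Longrightarrow> adj H t w"
  shows "linked H (W - {u}) a b"
proof -
  let ?f = "\<lambda>x. if x = u then t else x"
  have "linked H (W - {u}) (?f a) (?f b)"
    using assms(1) unfolding linked_def
  proof (induction rule: rtranclp_induct)
    case (step x y)
    have "adj H (?f x) (?f y)"
      using step(2) t adj_commute[of H u] adj_commute[of H t] by (cases "x = u"; cases "y = u") metis+
    moreover have "?f x \<in> W - {u}" "?f y \<in> W - {u}" using step(2) t by auto
    ultimately show ?case using step(3) by (blast intro: rtranclp.rtrancl_into_rtrancl)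
  qed simp
  then show ?thesis using assms by simp
qed

lemma connected_graph_linked:
  assumes "connected_graph G" "a \<in> verts G" "b \<in> verts G"
  shows "linked G (verts G) a b"
proof -
  obtain p where "p \<in> walks G a b" using assms by (auto simp: connected_graph_def)
  then have "path_in G (verts G) a b p" by (auto simp: walks_def path_in_def)
  then show ?thesis by (rule path_in_imp_linked)
qed

section \<open>Safe symbols\<close>

text \<open>
  The new site simply receives the safe symbol.
\<close>

lemma safe_symbol_imp_SSF:
  fixes G :: "'x ugraph"
  assumes s: "safe_symbol H s" and G: "board G"
  shows "single_site_fillable G H"
  unfolding single_site_fillable_def
proof (intro ballI allI impI)
  fix x B f
  assume x: "x \<in> verts G" and B: "B \<subseteq> boundary G {x}" and f: "f \<in> homs (induced G B) H"
  have xB: "x \<notin> B" using B mem_boundary_iff[of G "{x}" x] x board_ugraph[OF G] by auto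
  have BV: "B \<subseteq> verts G" using B by (auto simp: boundary_def)
  have nl: "\<not> adj G x x" using G x by (auto simp: board_def loopless_def)
  have s1: "s \<in> verts H" "\<And>v. v \<in> verts H \<Longrightarrow> adj H s v \<and> adj H v s"
    using s by (auto simp: safe_symbol_def adj_def insert_commute)
  have ad: "adj (induced G Y) a b \<longleftrightarrow> adj G a b \<and> a \<in> Y \<and> b \<in> Y" for Y a b
    by (auto simp: adj_def induced_def)
  have vs: "verts (induced G B) = B" "verts (induced G (B \<union> {x})) = B \<union> {x}"
    using BV x by (auto simp: induced_def)
  have vs': "verts (induced G (insert x B)) = insert x B" using vs(2) by simp
  have "f(x := s) \<in> homs (induced G (B \<union> {x})) H"
  proof (rule homsI)
    show "f(x := s) \<in> extensional (verts (induced G (B \<union> {x})))"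
      using homsD(3)[OF f] by (auto simp: vs vs' extensional_def)
  next
    fix a assume "a \<in> verts (induced G (B \<union> {x}))"
    then show "(f(x := s)) a \<in> verts H" using homsD(1)[OF f] s1 unfolding vs by auto
  next
    fix a b assume "a \<in> verts (induced G (B \<union> {x}))" "b \<in> verts (induced G (B \<union> {x}))"
       "adj (induced G (B \<union> {x})) a b"
    then show "adj H ((f(x := s)) a) ((f(x := s)) b)"
      using homsD(1,2)[OF f] s1 nl by (auto simp: vs ad)
  qed
  moreover have "restrict (f(x := s)) B = f"
    using homsD(3)[OF f] xB by (auto simp: vs extensional_def restrict_def fun_eq_iff)
  ultimately show "\<exists>f'\<in>homs (induced G (B \<union> {x})) H. restrict f' B = f" by blast
qed

definition star_board :: "nat \<Rightarrow> nat ugraph" where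
  "star_board n = \<lparr>verts = {..n}, edges = {{0, i} | i. i \<in> {1..n}}\<rparr>"

lemma adj_star: "adj (star_board n) x y \<longleftrightarrow> (x = 0 \<and> y \<in> {1..n}) \<or> (y = 0 \<and> x \<in> {1..n})"
  by (auto simp: adj_def star_board_def doubleton_eq_iff)

lemma verts_star: "verts (star_board n) = {..n}"
  by (simp add: star_board_def)

lemma board_star:
  assumes "n \<ge> 1"
  shows "board (star_board n)"
proof -
  have "walks (star_board n) x y \<noteq> {}" if "x \<le> n" "y \<le> n" for x y
  proof -
    have "(if x = 0 then [] else [x]) @ [0] @ (if y = 0 then [] else [y]) \<in> walks (star_board n) x y"
      using that by (auto simp: walks_def verts_star adj_star successively_Cons)
    then show ?thesis by blast
  qed
  moreover have "ugraph (star_board n)" by (fastforce simp: ugraph_def star_board_def)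
  moreover have "finite (nbhd (star_board n) x)" for x
    by (rule finite_subset[of _ "{..n}"]) (auto simp: nbhd_def adj_star)
  moreover have "loopless (star_board n)" by (auto simp: loopless_def adj_star)
  moreover have "\<exists>x\<in>verts (star_board n). \<exists>y\<in>verts (star_board n). x \<noteq> y"
    using assms by (intro bexI[of _ 0] bexI[of _ n]) (auto simp: verts_star)
  ultimately show ?thesis by (auto simp: board_def connected_graph_def verts_star)
qed

text \<open>
  Put every vertex of \<open>H\<close> on a leaf of a star. The leaves span no edges, so this is a homomorphism, and
  a value at the centre is adjacent to all vertices of \<open>H\<close>, itself included.
\<close>

lemma SSF_imp_safe_symbol:
  assumes H: "constraint_graph H" and ssf: "every_board (\<lambda>G. single_site_fillable G H)"
  shows "\<exists>s. safe_symbol H s"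
proof -
  have fin: "finite (verts H)" and ne: "verts H \<noteq> {}" using H by (auto simp: constraint_graph_def)
  define n where "n = card (verts H)"
  have n1: "n \<ge> 1" using fin ne by (simp add: n_def Suc_le_eq card_gt_0_iff)
  obtain h where h: "bij_betw h {1..n} (verts H)"
    using fin ex_bij_betw_nat_finite_1 n_def by blast
  let ?G = "star_board n"
  have bd: "boundary ?G {0} = {1..n}"
  proof -
    have "x \<in> boundary ?G {0} \<longleftrightarrow> x \<in> {1..n}" for x
      using mem_boundary_iff[of ?G "{0}" x] board_ugraph[OF board_star[OF n1]]
      by (auto simp: verts_star adj_star)
    then show ?thesis by blast
  qed
  let ?f = "restrict h {1..n}"
  have v: "verts (induced ?G {1..n}) = {1..n}" by (auto simp: induced_def verts_star)
  have "?f \<in> homs (induced ?G {1..n}) H"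
  proof (rule homsI)
    fix x assume "x \<in> verts (induced ?G {1..n})"
    then have "x \<in> {1..n}" using v by blast
    then show "?f x \<in> verts H" using h bij_betwE by fastforce
  next
    fix x y assume "adj (induced ?G {1..n}) x y"
    then have "adj ?G x y" "x \<in> {1..n}" "y \<in> {1..n}" by (auto simp: adj_def induced_def)
    then show "adj H (?f x) (?f y)" by (auto simp: adj_star)
  next
    show "?f \<in> extensional (verts (induced ?G {1..n}))" unfolding v by simp
  qed
  moreover have "single_site_fillable ?G H" using ssf board_star[OF n1] by (auto simp: every_board_def)
  ultimately obtain f' where f': "f' \<in> homs (induced ?G ({1..n} \<union> {0})) H" "restrict f' {1..n} = ?f"
    unfolding single_site_fillable_def using bd by (metis (no_types, lifting) atMost_iff order_refl verts_star zero_le)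
  have v': "verts (induced ?G ({1..n} \<union> {0})) = {..n}" by (auto simp: induced_def verts_star)
  have "adj H (f' 0) v" if v: "v \<in> verts H" for v
  proof -
    obtain i where i: "i \<in> {1..n}" "h i = v"     proof -
      have "v \<in> h ` {1..n}" using h v by (simp add: bij_betw_def)
      then show thesis using that by blast
    qed
    then have "f' i = v" using f'(2) by (metis restrict_apply')
    moreover have "adj (induced ?G ({1..n} \<union> {0})) 0 i"
      using i by (auto simp: adj_def induced_def star_board_def)
    ultimately show ?thesis using homsD(2)[OF f'(1), of 0 i] i v' by auto
  qed
  moreover have "f' 0 \<in> verts H" using homsD(1)[OF f'(1)] v' by auto
  ultimately show ?thesis by (auto simp: safe_symbol_def adj_def)
qed

lemma safe_symbol_imp_connected:
  assumes "safe_symbol H s"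
  shows "connected_graph H"
proof -
  have s: "s \<in> verts H" "\<And>v. v \<in> verts H \<Longrightarrow> adj H s v" using assms by (auto simp: safe_symbol_def adj_def)
  have "[x, s, y] \<in> walks H x y" if "x \<in> verts H" "y \<in> verts H" for x y
    using that s adj_sym[OF s(2)] by (auto simp: walks_def)
  then show ?thesis using s unfolding connected_graph_def by blast
qed

text \<open>
  Take \<open>C = {s}\<close> and let the sets \<open>J\<^sub>k\<close> be the connected components of the remaining graph; the safe
  symbol is adjacent to all of their vertices.
\<close>

lemma safe_symbol_imp_decomposable:
  assumes ss: "safe_symbol H s"
  shows "chordal_tree_decomposable H"
proof -
  have s: "s \<in> verts H" "\<And>v. v \<in> verts H \<Longrightarrow> adj H s v" using ss by (auto simp: safe_symbol_def adj_def)
  define J where "J = verts H - {s}"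
  define r where "r = {(a, b). a \<in> J \<and> b \<in> J \<and> linked H J a b}"
  have eq: "equiv J r"
  proof (rule equivI)
    show "refl_on J r" by (auto simp: refl_on_def r_def linked_def)
    show "sym r" using linked_sym by (auto simp: sym_def r_def)
    show "trans r" by (auto simp: trans_def r_def intro: linked_trans)
    show "r \<subseteq> J \<times> J" by (auto simp: r_def)
  qed
  have p: "partition_on J (J // r)"
    using partition_on_quotient[OF eq] .
  have conn: "connected_graph (induced H K)" if K: "K \<in> J // r" for K
  proof -
    obtain x where x: "x \<in> J" "K = r `` {x}" using K by (auto simp: quotient_def)
    have KJ: "K \<subseteq> J" and xK: "x \<in> K" using x by (auto simp: r_def linked_def)
    have vK: "verts (induced H K) = K" using KJ by (auto simp: induced_def J_def)
    have lx: "linked H K x y" if y: "y \<in> K" for y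
    proof -
      obtain p where p: "path_in H J x y p"
        using y x linked_imp_path_in[of H J x y] by (auto simp: r_def)
      have "set p \<subseteq> K"
      proof
        fix z assume "z \<in> set p"
        then obtain i where i: "i < length p" "z = p ! i" by (metis in_set_conv_nth)
        then have "linked H J x z" using path_in_imp_linked[OF path_in_truncate[OF p i(1)]] by simp
        moreover have "z \<in> J" using p i by (auto simp: path_in_def)
        ultimately show "z \<in> K" using x by (auto simp: r_def)
      qed
      then have "path_in H K x y p" using p by (simp add: path_in_def)
      then show ?thesis by (rule path_in_imp_linked)
    qed
    have "walks (induced H K) a b \<noteq> {}" if ab: "a \<in> K" "b \<in> K" for a b
    proof -
      have "linked H K a b" using linked_trans[OF linked_sym[OF lx[OF ab(1)]] lx[OF ab(2)]] .
      then obtain p where p: "path_in H K a b p" using linked_imp_path_in ab by metis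
      have "successively (adj (induced H K)) p"
      proof (rule successively_mono[of "adj H"])
        show "successively (adj H) p" using p by (simp add: path_in_def)
        show "adj (induced H K) a b" if "a \<in> set p" "b \<in> set p" "adj H a b" for a b
          using that p by (auto simp: path_in_def adj_def induced_def)
      qed
      then have "p \<in> walks (induced H K) a b" using p vK by (auto simp: walks_def path_in_def)
      then show ?thesis by blast
    qed
    then show ?thesis using vK xK by (auto simp: connected_graph_def)
  qed
  have lc: "loop_chordal (induced H {s})"
    unfolding loop_chordal_def chordal_def
  proof (intro conjI)
    let ?G = "\<lparr>verts = verts (induced H {s}), edges = edges (induced H {s}) - {{v} |v. v \<in> verts (induced H {s})}\<rparr>"
    show "\<forall>v\<in>verts (induced H {s}). adj (induced H {s}) v v"
      using s s(2)[OF s(1)] by (auto simp: induced_def adj_def)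
    show "finite (verts ?G)" by (simp add: induced_def)
    show "loopless ?G" by (auto simp: loopless_def adj_def induced_def)
    show "\<forall>xs. is_cycle ?G xs \<longrightarrow> 4 \<le> length xs \<longrightarrow>
         (\<exists>u\<in>set xs. \<exists>v\<in>set xs. {u, v} \<in> edges ?G \<and> {u, v} \<notin> cycle_edges xs)"
    proof (intro allI impI)
      fix xs assume xs: "is_cycle ?G xs" "4 \<le> length xs"
      then have "set xs \<subseteq> {s}" "distinct xs" by (auto simp: is_cycle_def induced_def)
      then have "length xs \<le> card {s}" by (metis card_mono distinct_card finite.emptyI finite.insertI)
      then show "\<exists>u\<in>set xs. \<exists>v\<in>set xs. {u, v} \<in> edges ?G \<and> {u, v} \<notin> cycle_edges xs" using xs(2) by simp
    qed
  qed
  have cs: "\<exists>c\<in>{s}. \<forall>u\<in>K. \<forall>c'\<in>{s}. {u, c'} \<in> edges H \<longleftrightarrow> c' = c" if "K \<in> J // r" for K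
  proof -
    have "K \<subseteq> J" using that eq by (metis in_quotient_imp_subset)
    then have "{u, s} \<in> edges H" if "u \<in> K" for u
      using that s(2)[of u] adj_sym[of H s u] by (auto simp: J_def adj_def)
    then show ?thesis by simp
  qed
  have ee: "edges_between H J1 J2 = {}" if "J1 \<in> J // r" "J2 \<in> J // r" "J1 \<noteq> J2" for J1 J2
  proof (rule ccontr)
    assume "edges_between H J1 J2 \<noteq> {}"
    then obtain u v where uv: "u \<in> J1" "v \<in> J2" "adj H u v" by (auto simp: edges_between_def adj_def)
    have "u \<in> J" "v \<in> J" using uv that eq by (metis in_quotient_imp_subset subsetD)+
    then have "(u, v) \<in> r" using linked_adj[OF uv(3), of J] by (auto simp: r_def)
    then show False using quotient_eqI[OF eq that(1,2) uv(1,2)] that(3) by blast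
  qed
  show ?thesis unfolding chordal_tree_decomposable_def
  proof (intro exI conjI)
    show "verts H = {s} \<union> {} \<union> J" using s by (auto simp: J_def)
    show "partition_on {} {}" by (simp add: partition_on_empty)
    show "partition_on J (J // r)" by (rule p)
    show "\<forall>Jk\<in>J // r. connected_graph (induced H Jk) \<and> (\<exists>c\<in>{s}. \<forall>u\<in>Jk. \<forall>c'\<in>{s}. ({u, c'} \<in> edges H) = (c' = c))"
      using conn cs by blast
    show "\<forall>J1\<in>J // r. \<forall>J2\<in>J // r. J1 \<noteq> J2 \<longrightarrow> edges_between H J1 J2 = {}" using ee by blast
  qed (use lc in \<open>auto simp: J_def edges_between_def\<close>)
qed

section \<open>Maximal points by elimination of vertices\<close>

definition list_homs :: "'x ugraph \<Rightarrow> 'v ugraph \<Rightarrow> ('x \<Rightarrow> 'v set) \<Rightarrow> ('x \<Rightarrow> 'v) set" where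
  "list_homs G H L = {\<omega> \<in> homs G H. \<forall>x\<in>verts G. \<omega> x \<in> L x}"

definition list_max :: "'x ugraph \<Rightarrow> 'v ugraph \<Rightarrow> 'v rel \<Rightarrow> ('x \<Rightarrow> 'v set) \<Rightarrow> ('x \<Rightarrow> 'v) \<Rightarrow> bool" where
  "list_max G H r L \<omega> \<longleftrightarrow> \<omega> \<in> list_homs G H L \<and> (\<forall>\<omega>'\<in>list_homs G H L. config_le G r \<omega>' \<omega>)"

text \<open>
  The family \<open>\<F>\<close> collects the lists that may occur while \<open>W\<close> is the set of remaining vertices. A vertex
  \<open>u\<close> may be eliminated if every such list other than \<open>{u}\<close> that contains \<open>u\<close> offers a substitute \<open>t\<close>
  dominating \<open>u\<close>. The substitute may depend on the list, which is what distinguishes this from a mere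
  dismantling of the graph. Cutting a list down to \<open>N(u)\<close> has to lead into the family \<open>\<F>'\<close> of the next
  stage.
\<close>

inductive eliminable :: "'v ugraph \<Rightarrow> 'v set \<Rightarrow> 'v set set \<Rightarrow> bool" for H where
  last: "\<F> \<subseteq> Pow {s} \<Longrightarrow> eliminable H {s} \<F>"
| step: "\<F> \<subseteq> Pow W \<Longrightarrow> W \<in> \<F> \<Longrightarrow> u \<in> W \<Longrightarrow> W \<noteq> {u} \<Longrightarrow>
    (\<And>L. L \<in> \<F> \<Longrightarrow> u \<in> L \<Longrightarrow> L \<noteq> {u} \<Longrightarrow> \<exists>t\<in>L - {u}. \<forall>w\<in>W. adj H u w \<longrightarrow> adj H t w) \<Longrightarrow>
    W - {u} \<in> \<F>' \<Longrightarrow>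
    (\<And>L. L \<in> \<F> \<Longrightarrow> L \<noteq> {u} \<Longrightarrow> L - {u} \<in> \<F>' \<and> L \<inter> nbhd H u - {u} \<in> \<F>') \<Longrightarrow>
    eliminable H (W - {u}) \<F>' \<Longrightarrow> eliminable H W \<F>"

text \<open>
  A site that is forced to be \<open>u\<close> imposes \<open>N(u)\<close> on its neighbours and is then released, its value
  being restored afterwards.
\<close>

definition reduce_lists :: "'x ugraph \<Rightarrow> 'v ugraph \<Rightarrow> 'v set \<Rightarrow> 'v \<Rightarrow> ('x \<Rightarrow> 'v set) \<Rightarrow> 'x \<Rightarrow> 'v set" where
  "reduce_lists G H W u L x =
     (if L x = {u} then W - {u}
      else if \<exists>y\<in>verts G. adj G x y \<and> L y = {u} then L x \<inter> nbhd H u - {u}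
      else L x - {u})"

text \<open>
  Substituting dominating vertices for \<open>u\<close> at all sites at once yields a homomorphism, even where
  adjacent sites both carry \<open>u\<close>: then \<open>u\<close> has a loop, so \<open>u \<in> N(u) \<subseteq> N(t)\<close>, that is
  \<open>t \<in> N(u) \<subseteq> N(t')\<close> for any two substitutes. The same remark shows that a substitute chosen next to
  a site forced to be \<open>u\<close> lies in the reduced list.
\<close>

lemma reduce_listsI:
  fixes H :: "'v ugraph" and G :: "'x ugraph"
  assumes \<F>: "\<F> \<subseteq> Pow W" and W: "W \<in> \<F>" "u \<in> W" "W \<noteq> {u}"
    and fold: "\<And>L. L \<in> \<F> \<Longrightarrow> u \<in> L \<Longrightarrow> L \<noteq> {u} \<Longrightarrow> \<exists>t\<in>L - {u}. \<forall>w\<in>W. adj H u w \<longrightarrow> adj H t w"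
    and H: "W \<subseteq> verts H"
    and L: "\<And>x. x \<in> verts G \<Longrightarrow> L x \<in> \<F>"
    and \<omega>: "\<omega> \<in> list_homs G H L"
  shows "\<exists>\<omega>'\<in>list_homs G H (reduce_lists G H W u L). \<forall>x\<in>verts G. \<omega> x \<noteq> u \<longrightarrow> \<omega>' x = \<omega> x"
proof -
  have \<omega>H: "\<omega> \<in> homs G H" and \<omega>L: "\<And>x. x \<in> verts G \<Longrightarrow> \<omega> x \<in> L x"
    using \<omega> by (auto simp: list_homs_def)
  have \<omega>W: "\<omega> x \<in> W" if "x \<in> verts G" for x using \<omega>L[OF that] L[OF that] \<F> by auto
  let ?R = "reduce_lists G H W u L"
  have "\<exists>t\<in>(if L x = {u} then W else L x) - {u}. \<forall>w\<in>W. adj H u w \<longrightarrow> adj H t w"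
    if "x \<in> verts G" "\<omega> x = u" for x
    using fold[OF L[OF that(1)]] fold[OF W] \<omega>L[OF that(1)] that(2) by auto
  then obtain t where t: "\<And>x. x \<in> verts G \<Longrightarrow> \<omega> x = u \<Longrightarrow> t x \<in> (if L x = {u} then W else L x) - {u}"
     "\<And>x w. x \<in> verts G \<Longrightarrow> \<omega> x = u \<Longrightarrow> w \<in> W \<Longrightarrow> adj H u w \<Longrightarrow> adj H (t x) w"
    by metis
  define \<omega>' where "\<omega>' = restrict (\<lambda>x. if \<omega> x = u then t x else \<omega> x) (verts G)"
  have tW: "t x \<in> W" if "x \<in> verts G" "\<omega> x = u" for x
    using t(1)[OF that] L[OF that(1)] \<F> by (auto split: if_splits)
  have hom: "\<omega>' \<in> homs G H" unfolding \<omega>'_def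
  proof (rule homs_restrictI)
    fix x assume x: "x \<in> verts G"
    show "(if \<omega> x = u then t x else \<omega> x) \<in> verts H"
      using tW[OF x] H homsD(1)[OF \<omega>H x] by auto
  next
    fix x y assume xy: "x \<in> verts G" "y \<in> verts G" "adj G x y"
    have a: "adj H (\<omega> x) (\<omega> y)" using homsD(2)[OF \<omega>H xy] .
    show "adj H (if \<omega> x = u then t x else \<omega> x) (if \<omega> y = u then t y else \<omega> y)"
    proof (cases "\<omega> x = u"; cases "\<omega> y = u")
      assume u: "\<omega> x = u" "\<omega> y = u"
      then have "adj H u u" using a by simp
      then have "adj H u (t x)" using t(2)[OF xy(1) u(1) W(2)] adj_commute by metis
      then have "adj H (t y) (t x)" using t(2)[OF xy(2) u(2) tW[OF xy(1) u(1)]] by simp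
      then show ?thesis using u adj_commute by metis
    next
      assume u: "\<omega> x = u" "\<omega> y \<noteq> u"
      then show ?thesis using t(2)[OF xy(1) u(1) \<omega>W[OF xy(2)]] a by simp
    next
      assume u: "\<omega> x \<noteq> u" "\<omega> y = u"
      then show ?thesis using t(2)[OF xy(2) u(2) \<omega>W[OF xy(1)]] a adj_commute by metis
    qed (use a in simp)
  qed
  have "\<omega>' x \<in> ?R x" if x: "x \<in> verts G" for x
  proof -
    have e: "\<omega>' x = (if \<omega> x = u then t x else \<omega> x)" using x by (simp add: \<omega>'_def)
    have m: "\<omega>' x \<in> (if L x = {u} then W else L x) - {u}"
    proof (cases "\<omega> x = u")
      case True then show ?thesis using t(1)[OF x True] e by simp
    next
      case False
      then have "L x \<noteq> {u}" using \<omega>L[OF x] by blast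
      then show ?thesis using False \<omega>L[OF x] e by simp
    qed
    have n: "\<omega>' x \<in> nbhd H u" if y: "y \<in> verts G" "adj G x y" "L y = {u}" for y
    proof -
      have yu: "\<omega> y = u" using \<omega>L[OF y(1)] y(3) by auto
      have ax: "adj H (\<omega> x) u" using homsD(2)[OF \<omega>H x y(1,2)] yu by simp
      show ?thesis
      proof (cases "\<omega> x = u")
        case True
        then have "adj H (t x) u" using t(2)[OF x True W(2)] ax by simp
        then show ?thesis using True e by (simp add: nbhd_def)
      next
        case False then show ?thesis using ax e by (simp add: nbhd_def)
      qed
    qed
    show ?thesis
    proof (cases "L x = {u}")
      case True then show ?thesis using m by (simp add: reduce_lists_def)
    next
      case False
      then have m': "\<omega>' x \<in> L x - {u}" using m by simp
      show ?thesis
      proof (cases "\<exists>y\<in>verts G. adj G x y \<and> L y = {u}")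
        case True
        then have "\<omega>' x \<in> nbhd H u" using n by blast
        then show ?thesis unfolding reduce_lists_def if_not_P[OF False] if_P[OF True] using m' by blast
      next
        case nT: False
        then show ?thesis unfolding reduce_lists_def if_not_P[OF False] if_not_P[OF nT] using m' by blast
      qed
    qed
  qed
  then have "\<omega>' \<in> list_homs G H ?R" using hom by (auto simp: list_homs_def)
  moreover have "\<forall>x\<in>verts G. \<omega> x \<noteq> u \<longrightarrow> \<omega>' x = \<omega> x" by (auto simp: \<omega>'_def)
  ultimately show ?thesis by blast
qed

text \<open>
  Restoring \<open>u\<close> is compatible with the edges by the choice of the reduced lists, except between two
  sites that are both forced to be \<open>u\<close>. This is what the point \<open>\<omega>\<close> is for: it shows that such sites
  are adjacent only if \<open>u\<close> has a loop.
\<close>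

lemma override_reduce_lists:
  fixes H :: "'v ugraph" and G :: "'x ugraph"
  assumes u: "u \<in> verts H" and \<omega>: "\<omega> \<in> list_homs G H L"
    and \<omega>': "\<omega>' \<in> list_homs G H (reduce_lists G H W u L)"
  shows "restrict (\<lambda>x. if L x = {u} then u else \<omega>' x) (verts G) \<in> list_homs G H L"
proof -
  have \<omega>H: "\<omega> \<in> homs G H" and \<omega>L: "\<And>x. x \<in> verts G \<Longrightarrow> \<omega> x \<in> L x"
    using \<omega> by (auto simp: list_homs_def)
  have \<omega>'H: "\<omega>' \<in> homs G H" and \<omega>'L: "\<And>x. x \<in> verts G \<Longrightarrow> \<omega>' x \<in> reduce_lists G H W u L x"
    using \<omega>' by (auto simp: list_homs_def)
  have nb: "adj H u (\<omega>' x)" if "x \<in> verts G" "y \<in> verts G" "adj G x y" "L y = {u}" "L x \<noteq> {u}" for x y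
  proof -
    have "\<exists>y\<in>verts G. adj G x y \<and> L y = {u}" using that by blast
    then have "\<omega>' x \<in> L x \<inter> nbhd H u - {u}"
      using \<omega>'L[OF that(1)] that(5) by (simp add: reduce_lists_def)
    then show ?thesis by (simp add: nbhd_def adj_commute)
  qed
  have "restrict (\<lambda>x. if L x = {u} then u else \<omega>' x) (verts G) \<in> homs G H"
  proof (rule homs_restrictI)
    fix x assume "x \<in> verts G"
    then show "(if L x = {u} then u else \<omega>' x) \<in> verts H" using u homsD(1)[OF \<omega>'H] by auto
  next
    fix x y assume xy: "x \<in> verts G" "y \<in> verts G" "adj G x y"
    have c: "adj G y x" using xy adj_commute by metis
    have "adj H (\<omega> x) (\<omega> y)" using homsD(2)[OF \<omega>H xy] .
    moreover have "L x = {u} \<Longrightarrow> \<omega> x = u" "L y = {u} \<Longrightarrow> \<omega> y = u" using \<omega>L xy by auto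
    ultimately show "adj H (if L x = {u} then u else \<omega>' x) (if L y = {u} then u else \<omega>' y)"
      using nb[OF xy] nb[OF xy(2,1) c] homsD(2)[OF \<omega>'H xy] adj_commute[of H _ u]
      by (cases "L x = {u}"; cases "L y = {u}") metis+
  qed
  moreover have "(if L x = {u} then u else \<omega>' x) \<in> L x" if "x \<in> verts G" for x
    using \<omega>'L[OF that] by (auto simp: reduce_lists_def split: if_splits)
  ultimately show ?thesis by (auto simp: list_homs_def)
qed

lemma reduce_lists_local:
  assumes "x \<in> verts G" "ugraph G" "reduce_lists G H W u L1 x \<noteq> reduce_lists G H W u L2 x"
  shows "\<exists>y. near G 1 x y \<and> L1 y \<noteq> L2 y"
proof (rule ccontr)
  assume neg: "\<not> ?thesis"
  have "L1 x = L2 x" using neg near_refl[OF assms(1)] by blast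
  moreover have "L1 y = L2 y" if "adj G x y" for y using neg near_1[OF assms(2) that] by blast
  ultimately have "reduce_lists G H W u L1 x = reduce_lists G H W u L2 x"
    by (simp add: reduce_lists_def cong: conj_cong)
  then show False using assms by simp
qed

text \<open>
  Induction along the elimination, the eliminated vertex being put below all others. A point for the
  original lists lies below one for the reduced lists, apart from the sites forced to be \<open>u\<close>, where no
  other value is possible; so the maximum survives when \<open>u\<close> is restored. Each step contributes \<open>1\<close> to
  the range of dependence.
\<close>

lemma eliminable_imp_list_max:
  fixes H :: "'v ugraph" and G :: "'x ugraph"
  assumes G: "ugraph G" and e: "eliminable H W \<F>" and W: "W \<subseteq> verts H" and fin: "finite W"
  shows "\<exists>r. r \<subseteq> W \<times> W \<and> strict_linear_order_on W r \<and>
     (\<forall>L. (\<forall>x\<in>verts G. L x \<in> \<F>) \<and> list_homs G H L \<noteq> {} \<longrightarrow> (\<exists>\<omega>. list_max G H r L \<omega>)) \<and>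
     (\<forall>L1 L2 \<omega>1 \<omega>2 x. (\<forall>x\<in>verts G. L1 x \<in> \<F>) \<and> (\<forall>x\<in>verts G. L2 x \<in> \<F>) \<and>
        list_max G H r L1 \<omega>1 \<and> list_max G H r L2 \<omega>2 \<and> x \<in> verts G \<and> \<omega>1 x \<noteq> \<omega>2 x \<longrightarrow>
        (\<exists>y. near G (card W) x y \<and> L1 y \<noteq> L2 y))"
  using e W fin
proof (induction rule: eliminable.induct)
  case (last \<F> s)
  have one: "\<omega> x = s" if "\<forall>x\<in>verts G. L x \<in> \<F>" "\<omega> \<in> list_homs G H L" "x \<in> verts G" for \<omega> L x
    using that last by (force simp: list_homs_def)
  show ?case
  proof (intro exI[of _ "{}"] conjI allI impI)
    show "strict_linear_order_on {s} {}"
      by (auto simp: strict_linear_order_on_def irrefl_def total_on_def)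
  next
    fix L assume L: "(\<forall>x\<in>verts G. L x \<in> \<F>) \<and> list_homs G H L \<noteq> {}"
    then obtain \<omega> where \<omega>: "\<omega> \<in> list_homs G H L" by blast
    have "list_max G H {} L \<omega>" unfolding list_max_def config_le_def
      using \<omega> one[of L] L by metis
    then show "\<exists>\<omega>. list_max G H {} L \<omega>" by blast
  next
    fix L1 L2 \<omega>1 \<omega>2 x
    assume "(\<forall>x\<in>verts G. L1 x \<in> \<F>) \<and> (\<forall>x\<in>verts G. L2 x \<in> \<F>) \<and>
        list_max G H {} L1 \<omega>1 \<and> list_max G H {} L2 \<omega>2 \<and> x \<in> verts G \<and> \<omega>1 x \<noteq> \<omega>2 x"
    then have False using one[of L1 \<omega>1 x] one[of L2 \<omega>2 x] by (auto simp: list_max_def)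
    then show "\<exists>y. near G (card {s}) x y \<and> L1 y \<noteq> L2 y" ..
  qed simp
next
  case (step \<F> W u \<F>')
  let ?W = "W - {u}"
  let ?R = "reduce_lists G H W u"
  have uH: "u \<in> verts H" using step by auto
  have sub: "?W \<subseteq> verts H" "finite ?W" using step.prems by auto
  obtain r where r: "r \<subseteq> ?W \<times> ?W" "strict_linear_order_on ?W r"
    and ex: "\<forall>L. (\<forall>x\<in>verts G. L x \<in> \<F>') \<and> list_homs G H L \<noteq> {} \<longrightarrow> (\<exists>\<omega>. list_max G H r L \<omega>)"
    and loc: "\<forall>L1 L2 \<omega>1 \<omega>2 x. (\<forall>x\<in>verts G. L1 x \<in> \<F>') \<and> (\<forall>x\<in>verts G. L2 x \<in> \<F>') \<and>
        list_max G H r L1 \<omega>1 \<and> list_max G H r L2 \<omega>2 \<and> x \<in> verts G \<and> \<omega>1 x \<noteq> \<omega>2 x \<longrightarrow>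
        (\<exists>y. near G (card ?W) x y \<and> L1 y \<noteq> L2 y)"
    using step.IH[OF sub] by (elim exE conjE) (rule that)
  define r' where "r' = r \<union> {u} \<times> ?W"
  have slo: "strict_linear_order_on W r'"
  proof -
    have "trans r'" using r by (auto simp: strict_linear_order_on_def r'_def trans_def)
    moreover have "irrefl r'" using r by (auto simp: strict_linear_order_on_def r'_def irrefl_def)
    moreover have "total_on W r'" using r by (auto simp: strict_linear_order_on_def r'_def total_on_def)
    ultimately show ?thesis by (simp add: strict_linear_order_on_def)
  qed
  have RF: "\<forall>x\<in>verts G. ?R L x \<in> \<F>'" if "\<forall>x\<in>verts G. L x \<in> \<F>" for L
    using that step.hyps by (auto simp: reduce_lists_def)
  have LW: "L x \<subseteq> W" if "\<forall>x\<in>verts G. L x \<in> \<F>" "x \<in> verts G" for L x using that step.hyps by auto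
  have antisym: "\<omega>1 x = \<omega>2 x" if "list_max G H r' L \<omega>1" "list_max G H r' L \<omega>2" "x \<in> verts G" for L \<omega>1 \<omega>2 x
    using that slo unfolding list_max_def config_le_def strict_linear_order_on_def irrefl_def trans_def by metis
  have mx: "list_max G H r' L (restrict (\<lambda>x. if L x = {u} then u else \<omega>m x) (verts G))"
    if L: "\<forall>x\<in>verts G. L x \<in> \<F>" and ne: "list_homs G H L \<noteq> {}" and m: "list_max G H r (?R L) \<omega>m" for L \<omega>m
    unfolding list_max_def
  proof (intro conjI ballI)
    obtain \<omega> where "\<omega> \<in> list_homs G H L" using ne by blast
    then show "restrict (\<lambda>x. if L x = {u} then u else \<omega>m x) (verts G) \<in> list_homs G H L"
      using override_reduce_lists[OF uH] m by (auto simp: list_max_def)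
  next
    fix \<omega> assume \<omega>: "\<omega> \<in> list_homs G H L"
    obtain \<omega>' where \<omega>': "\<omega>' \<in> list_homs G H (?R L)" "\<And>x. x \<in> verts G \<Longrightarrow> \<omega> x \<noteq> u \<Longrightarrow> \<omega>' x = \<omega> x"
      using reduce_listsI[OF step.hyps(1-5) step.prems(1) _ \<omega>] L by blast
    have "(\<omega> x, if L x = {u} then u else \<omega>m x) \<in> r' \<or> \<omega> x = (if L x = {u} then u else \<omega>m x)"
      if x: "x \<in> verts G" for x
    proof -
      have le: "(\<omega>' x, \<omega>m x) \<in> r \<or> \<omega>' x = \<omega>m x" using m \<omega>'(1) x by (auto simp: list_max_def config_le_def)
      have "\<omega>m x \<in> ?R L x" using m x by (auto simp: list_max_def list_homs_def)
      then have "\<omega>m x \<in> ?W" using LW[OF L x] by (auto simp: reduce_lists_def split: if_splits)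
      moreover have "\<omega> x \<in> L x" using \<omega> x by (auto simp: list_homs_def)
      ultimately show ?thesis using le \<omega>'(2)[OF x] by (cases "\<omega> x = u") (auto simp: r'_def)
    qed
    then show "config_le G r' \<omega> (restrict (\<lambda>x. if L x = {u} then u else \<omega>m x) (verts G))"
      by (auto simp: config_le_def)
  qed
  have exR: "\<exists>\<omega>m. list_max G H r (?R L) \<omega>m" if L: "\<forall>x\<in>verts G. L x \<in> \<F>" and ne: "list_homs G H L \<noteq> {}" for L
  proof -
    obtain \<omega> where \<omega>: "\<omega> \<in> list_homs G H L" using ne by blast
    have "list_homs G H (?R L) \<noteq> {}"
      using reduce_listsI[OF step.hyps(1-5) step.prems(1) _ \<omega>] L by blast
    then show ?thesis using ex RF[OF L] by blast
  qed
  have cW: "card W = Suc (card ?W)" using step by (metis card.remove)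
  show ?case
  proof (intro exI[of _ r'] conjI allI impI)
    show "r' \<subseteq> W \<times> W" using r step.hyps by (auto simp: r'_def)
    show "strict_linear_order_on W r'" by (rule slo)
  next
    fix L assume L: "(\<forall>x\<in>verts G. L x \<in> \<F>) \<and> list_homs G H L \<noteq> {}"
    then show "\<exists>\<omega>. list_max G H r' L \<omega>" using mx exR by blast
  next
    fix L1 L2 \<omega>1 \<omega>2 x
    assume A: "(\<forall>x\<in>verts G. L1 x \<in> \<F>) \<and> (\<forall>x\<in>verts G. L2 x \<in> \<F>) \<and>
        list_max G H r' L1 \<omega>1 \<and> list_max G H r' L2 \<omega>2 \<and> x \<in> verts G \<and> \<omega>1 x \<noteq> \<omega>2 x"
    then have L1: "\<forall>x\<in>verts G. L1 x \<in> \<F>" and L2: "\<forall>x\<in>verts G. L2 x \<in> \<F>" and x: "x \<in> verts G" by auto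
    have ne: "list_homs G H L1 \<noteq> {}" "list_homs G H L2 \<noteq> {}" using A by (auto simp: list_max_def)
    obtain m1 where m1: "list_max G H r (?R L1) m1" using exR[OF L1 ne(1)] by blast
    obtain m2 where m2: "list_max G H r (?R L2) m2" using exR[OF L2 ne(2)] by blast
    have e1: "\<omega>1 x = (if L1 x = {u} then u else m1 x)"
      using antisym[OF _ mx[OF L1 ne(1) m1] x, of \<omega>1] A x by simp
    have e2: "\<omega>2 x = (if L2 x = {u} then u else m2 x)"
      using antisym[OF _ mx[OF L2 ne(2) m2] x, of \<omega>2] A x by simp
    show "\<exists>y. near G (card W) x y \<and> L1 y \<noteq> L2 y"
    proof (cases "L1 x = L2 x")
      case False then show ?thesis using near_refl[OF x] by blast
    next
      case True
      then have "m1 x \<noteq> m2 x" using A e1 e2 by (auto split: if_splits)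
      then obtain y where y: "near G (card ?W) x y" "?R L1 y \<noteq> ?R L2 y"
        using loc[rule_format, of "?R L1" "?R L2" m1 m2 x] RF[OF L1] RF[OF L2] m1 m2 x by blast
      obtain z where "near G 1 y z" "L1 z \<noteq> L2 z"
        using reduce_lists_local[OF _ G y(2)] near_in_verts[OF y(1)] by blast
      then show ?thesis using near_trans[OF y(1)] cW by fastforce
    qed
  qed
qed

lemma strict_linear_order_onD:
  assumes "strict_linear_order_on W r"
  shows "trans r" "irrefl r" "total_on W r"
  using assms by (auto simp: strict_linear_order_on_def)

lemma config_le_antisym:
  assumes "trans r" "irrefl r" "config_le G r \<omega> \<omega>'" "config_le G r \<omega>' \<omega>"
    "\<omega> \<in> extensional (verts G)" "\<omega>' \<in> extensional (verts G)"
  shows "\<omega> = \<omega>'"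
proof (rule extensionalityI[OF assms(5,6)])
  fix x assume "x \<in> verts G"
  then show "\<omega> x = \<omega>' x" using assms(1-4) unfolding config_le_def irrefl_def trans_def by metis
qed

text \<open>
  A configuration on a finite set is the assignment of singleton lists there and full lists elsewhere.
\<close>

lemma eliminable_imp_UMC:
  fixes H :: "'v ugraph" and G :: "'x ugraph"
  assumes G: "ugraph G" and fin: "finite (verts H)"
    and e: "eliminable H (verts H) \<F>" and \<F>: "verts H \<in> \<F>" "\<And>v. v \<in> verts H \<Longrightarrow> {v} \<in> \<F>"
  shows "UMC G H"
proof -
  obtain r where r: "strict_linear_order_on (verts H) r"
    and ex: "\<forall>L. (\<forall>x\<in>verts G. L x \<in> \<F>) \<and> list_homs G H L \<noteq> {} \<longrightarrow> (\<exists>\<omega>. list_max G H r L \<omega>)"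
    and loc: "\<forall>L1 L2 \<omega>1 \<omega>2 x. (\<forall>x\<in>verts G. L1 x \<in> \<F>) \<and> (\<forall>x\<in>verts G. L2 x \<in> \<F>) \<and>
        list_max G H r L1 \<omega>1 \<and> list_max G H r L2 \<omega>2 \<and> x \<in> verts G \<and> \<omega>1 x \<noteq> \<omega>2 x \<longrightarrow>
        (\<exists>y. near G (card (verts H)) x y \<and> L1 y \<noteq> L2 y)"
    using eliminable_imp_list_max[OF G e order_refl fin] by (elim exE conjE) (rule that)
  define lst where "lst A \<alpha> x = (if x \<in> A then {\<alpha> x} else verts H)" for A and \<alpha> :: "'x \<Rightarrow> 'v" and x
  have cyl: "cylinder G H A \<alpha> = list_homs G H (lst A \<alpha>)" if "A \<subseteq> verts G" "\<alpha> \<in> language G H A" for A \<alpha>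
  proof -
    have "\<alpha> \<in> extensional A" using that(2) languageE by metis
    then have "restrict \<omega> A = \<alpha> \<longleftrightarrow> (\<forall>x\<in>A. \<omega> x = \<alpha> x)" for \<omega>
      by (auto simp: restrict_def extensional_def fun_eq_iff)
    then show ?thesis using that(1) homsD(1)
      by (fastforce simp: cylinder_def list_homs_def lst_def split: if_splits)
  qed
  have mp: "maximal_point G H r A \<alpha> \<omega> \<longleftrightarrow> list_max G H r (lst A \<alpha>) \<omega>"
    if "A \<subseteq> verts G" "\<alpha> \<in> language G H A" for A \<alpha> \<omega>
    by (simp add: maximal_point_def list_max_def cyl[OF that])
  have lF: "\<forall>x\<in>verts G. lst A \<alpha> x \<in> \<F>" if "A \<subseteq> verts G" and \<alpha>: "\<alpha> \<in> language G H A" for A \<alpha>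
  proof
    fix x assume x: "x \<in> verts G"
    show "lst A \<alpha> x \<in> \<F>"
    proof (cases "x \<in> A")
      case True
      obtain \<omega> where "\<omega> \<in> homs G H" "\<And>x. x \<in> A \<Longrightarrow> \<omega> x = \<alpha> x"
        using languageE[OF \<alpha>] by blast
      then have "\<alpha> x \<in> verts H" using homsD(1)[OF _ x] True by metis
      then show ?thesis using True \<F>(2) by (simp add: lst_def)
    qed (simp add: lst_def \<F>(1))
  qed
  show ?thesis unfolding UMC_def
  proof (intro exI[of _ "card (verts H)"] exI[of _ r] conjI allI impI ballI)
    show "strict_linear_order_on (verts H) r" by (rule r)
  next
    fix A \<alpha> assume A: "A \<subseteq> verts G" "finite A" "\<alpha> \<in> language G H A"
    have "list_homs G H (lst A \<alpha>) \<noteq> {}"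
      using A cyl[OF A(1,3)] by (auto simp: cylinder_def language_def)
    then obtain \<omega> where "list_max G H r (lst A \<alpha>) \<omega>"
      using ex[rule_format, of "lst A \<alpha>"] lF[OF A(1,3)] by blast
    then have "maximal_point G H r A \<alpha> \<omega>" using mp[OF A(1,3)] by simp
    moreover have "\<omega>1 = \<omega>2" if "maximal_point G H r A \<alpha> \<omega>1" "maximal_point G H r A \<alpha> \<omega>2" for \<omega>1 \<omega>2
    proof -
      have h: "\<omega>1 \<in> homs G H" "\<omega>2 \<in> homs G H" using that by (auto simp: maximal_point_def cylinder_def)
      have "config_le G r \<omega>1 \<omega>2" "config_le G r \<omega>2 \<omega>1" using that by (auto simp: maximal_point_def)
      then show ?thesis
        using config_le_antisym[OF strict_linear_order_onD(1,2)[OF r]] h[THEN homsD(3)] by blast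
    qed
    ultimately show "\<exists>!\<omega>. maximal_point G H r A \<alpha> \<omega>" by blast
  next
    fix A \<alpha>1 \<alpha>2 \<omega>1 \<omega>2
    assume A: "A \<subseteq> verts G" "finite A" and \<alpha>: "\<alpha>1 \<in> language G H A" "\<alpha>2 \<in> language G H A"
      and m: "maximal_point G H r A \<alpha>1 \<omega>1" "maximal_point G H r A \<alpha>2 \<omega>2"
    show "disagreement (verts G) \<omega>1 \<omega>2 \<subseteq> nbhd_n G (card (verts H)) (disagreement A \<alpha>1 \<alpha>2)"
    proof
      fix x assume "x \<in> disagreement (verts G) \<omega>1 \<omega>2"
      then have x: "x \<in> verts G" "\<omega>1 x \<noteq> \<omega>2 x" by (auto simp: disagreement_def)
      obtain y where y: "near G (card (verts H)) x y" "lst A \<alpha>1 y \<noteq> lst A \<alpha>2 y"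
        using loc[rule_format, of "lst A \<alpha>1" "lst A \<alpha>2" \<omega>1 \<omega>2 x] lF[OF A(1)] \<alpha> m mp[OF A(1)] x by blast
      then have "y \<in> disagreement A \<alpha>1 \<alpha>2" by (auto simp: lst_def disagreement_def split: if_splits)
      then show "x \<in> nbhd_n G (card (verts H)) (disagreement A \<alpha>1 \<alpha>2)"
        using y mem_nbhd_n_iff by fastforce
    qed
  qed
qed

section \<open>Chordal graphs\<close>

text \<open>
  Loops may be present here, so a chord is required to join distinct vertices.
\<close>

definition all_cycles_chorded :: "'v ugraph \<Rightarrow> 'v set \<Rightarrow> bool" where
  "all_cycles_chorded H W \<longleftrightarrow> (\<forall>xs. distinct xs \<longrightarrow> length xs \<ge> 4 \<longrightarrow> set xs \<subseteq> W \<longrightarrow>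
     (\<forall>i<length xs. adj H (xs ! i) (xs ! (Suc i mod length xs))) \<longrightarrow>
     (\<exists>u\<in>set xs. \<exists>v\<in>set xs. u \<noteq> v \<and> adj H u v \<and> {u, v} \<notin> cycle_edges xs))"

lemma all_cycles_chorded_mono: "all_cycles_chorded H W \<Longrightarrow> X \<subseteq> W \<Longrightarrow> all_cycles_chorded H X"
  unfolding all_cycles_chorded_def by (meson subset_trans)

text \<open>
  If not all pairs are adjacent, take a maximal connected set \<open>S\<close> whose closed neighbourhood \<open>N(S)\<close> is not
  everything, and put \<open>R = W - N(S)\<close>. By maximality every vertex of \<open>B = N(S) - S\<close> is adjacent to all of
  \<open>R\<close>. Two non-adjacent vertices of \<open>B\<close> would give, with a shortest path between them through \<open>S\<close> and
  any vertex of \<open>R\<close>, a cycle without chords, so \<open>B\<close> is a clique. Hence a vertex that is simplicial in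
  \<open>R\<close>, which exists by induction, is simplicial in \<open>W\<close>.
\<close>

lemma ex_simplicial_vertex:
  assumes "finite W" "W \<noteq> {}" "\<forall>v\<in>W. adj H v v" "all_cycles_chorded H W"
  shows "\<exists>u\<in>W. \<forall>a\<in>W. \<forall>b\<in>W. adj H u a \<longrightarrow> adj H u b \<longrightarrow> adj H a b"
  using assms
proof (induction W rule: finite_psubset_induct)
  case (psubset W)
  define N where "N S = {w\<in>W. \<exists>s\<in>S. adj H s w}" for S
  define \<S> where "\<S> = {S. S \<subseteq> W \<and> S \<noteq> {} \<and> (\<forall>a\<in>S. \<forall>b\<in>S. linked H S a b) \<and> N S \<noteq> W}"
  show ?case
  proof (cases "\<forall>a\<in>W. \<forall>b\<in>W. adj H a b")
    case True
    then show ?thesis using psubset.prems by blast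
  next
    case False
    then obtain v0 w0 where v0: "v0 \<in> W" "w0 \<in> W" "\<not> adj H v0 w0" by blast
    have "{v0} \<in> \<S>" using v0 by (auto simp: \<S>_def N_def linked_def)
    moreover have "finite \<S>" by (rule finite_subset[of _ "Pow W"]) (use psubset in \<open>auto simp: \<S>_def\<close>)
    ultimately obtain S where S: "S \<in> \<S>" and mx: "\<And>S'. S' \<in> \<S> \<Longrightarrow> S \<subseteq> S' \<Longrightarrow> S' = S"
      using finite_has_maximal[of \<S>] by blast
    have SW: "S \<subseteq> W" "S \<noteq> {}" "\<And>a b. a \<in> S \<Longrightarrow> b \<in> S \<Longrightarrow> linked H S a b" "N S \<noteq> W"
      using S by (auto simp: \<S>_def)
    have SN: "S \<subseteq> N S" using SW psubset.prems by (auto simp: N_def)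
    have NW: "N S \<subseteq> W" by (auto simp: N_def)
    define R where "R = W - N S"
    define B where "B = N S - S"
    have nS: "\<not> adj H s w" if "s \<in> S" "w \<in> R" for s w using that by (auto simp: R_def N_def)
    have BR: "adj H b w" if b: "b \<in> B" and w: "w \<in> R" for b w
    proof -
      obtain s where s: "s \<in> S" "adj H s b" using b by (auto simp: B_def N_def)
      have l: "linked H (insert b S) s x" if "x \<in> insert b S" for x
        using that linked_mono[OF SW(3)[OF s(1)], of x "insert b S"] linked_adj[OF s(2), of "insert b S"] s
        by auto
      have "linked H (insert b S) x y" if "x \<in> insert b S" "y \<in> insert b S" for x y
        using linked_trans[OF linked_sym[OF l[OF that(1)]] l[OF that(2)]] .
      moreover have "insert b S \<noteq> S" "insert b S \<subseteq> W" using b SW NW by (auto simp: B_def)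
      ultimately have "N (insert b S) = W" using mx[of "insert b S"] by (auto simp: \<S>_def)
      then have "w \<in> N (insert b S)" using w by (simp add: R_def)
      then obtain x where "x \<in> insert b S" "adj H x w" by (auto simp: N_def)
      then show ?thesis using w nS by blast
    qed
    have BB: "adj H b b'" if b: "b \<in> B" and b': "b' \<in> B" for b b'
    proof (rule ccontr)
      assume nadj: "\<not> adj H b b'"
      have bW: "b \<in> W" "b' \<in> W" using b b' NW by (auto simp: B_def)
      then have bb: "b \<noteq> b'" using nadj psubset.prems by auto
      let ?X = "insert b (insert b' S)"
      obtain s s' where s: "s \<in> S" "adj H s b" "s' \<in> S" "adj H s' b'" using b b' by (auto simp: B_def N_def)
      have "linked H ?X b s" by (rule linked_sym[OF linked_adj[OF s(2)]]) (use s in auto)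
      moreover have "linked H ?X s' b'" by (rule linked_adj[OF s(4)]) (use s in auto)
      moreover have "linked H ?X s s'" by (rule linked_mono[OF SW(3)[OF s(1,3)]]) auto
      ultimately have "linked H ?X b b'" by (blast intro: linked_trans)
      then obtain p where p: "path_in H ?X b b' p" "distinct p"
        "\<And>i j. Suc i < j \<Longrightarrow> j < length p \<Longrightarrow> \<not> adj H (p ! i) (p ! j)"
        using linked_imp_induced_path by (metis insertI1)
      have p0: "p \<noteq> []" "p ! 0 = b" "p ! (length p - 1) = b'"
        using p(1) by (auto simp: path_in_def hd_conv_nth last_conv_nth)
      have "length p \<noteq> 1" using p0 bb by auto
      moreover have "length p \<noteq> 2" using p0 nadj path_in_nth_adj[OF p(1), of 0] by auto
      ultimately have len: "length p \<ge> 3" using p0(1) by (cases "length p" rule: nat.exhaust) (auto simp: numeral_eq_Suc Suc_le_eq)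
      obtain r where r: "r \<in> R" using SW NW by (auto simp: R_def)
      have rX: "r \<notin> ?X" using r b b' SN by (auto simp: R_def B_def)
      have pX: "set p \<subseteq> ?X" using p(1) by (auto simp: path_in_def)
      \<comment> \<open>the chordless cycle: from \<open>b\<close> to \<open>b'\<close> through \<open>S\<close>, and back through \<open>r\<close>\<close>
      define xs where "xs = p @ [r]"
      have lx: "length xs = Suc (length p)" by (simp add: xs_def)
      have d: "distinct xs" using p(2) pX rX by (auto simp: xs_def)
      have sx: "set xs \<subseteq> W" using pX bW SW r by (auto simp: xs_def R_def)
      have cyc: "adj H (xs ! i) (xs ! (Suc i mod length xs))" if i: "i < length xs" for i
      proof -
        consider "Suc i < length p" | "Suc i = length p" | "i = length p" using i lx by linarith
        then show ?thesis
        proof cases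
          case 1 then show ?thesis using path_in_nth_adj[OF p(1) 1] lx by (simp add: xs_def nth_append)
        next
          case 2
          then have "i = length p - 1" "i < length p" by auto
          then have "xs ! i = b'" using p0 by (simp add: xs_def nth_append)
          moreover have "xs ! (Suc i mod length xs) = r" using 2 lx by (simp add: xs_def nth_append)
          ultimately show ?thesis using BR[OF b' r] by simp
        next
          case 3
          then have "xs ! i = r" by (simp add: xs_def)
          moreover have "xs ! (Suc i mod length xs) = b" using 3 lx p0 by (simp add: xs_def nth_append)
          ultimately show ?thesis using BR[OF b r] adj_commute by metis
        qed
      qed
      obtain u v where uv: "u \<in> set xs" "v \<in> set xs" "u \<noteq> v" "adj H u v" "{u, v} \<notin> cycle_edges xs"
      proof -
        have "4 \<le> length xs" using len lx by simp
        then have "\<exists>u\<in>set xs. \<exists>v\<in>set xs. u \<noteq> v \<and> adj H u v \<and> {u, v} \<notin> cycle_edges xs"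
          using psubset.prems(3)[unfolded all_cycles_chorded_def, rule_format, of xs] d sx cyc by blast
        then show thesis using that by blast
      qed
      have ce: "{xs ! i, xs ! (Suc i mod length xs)} \<in> cycle_edges xs" if "i < length xs" for i
        using that by (auto simp: cycle_edges_def)
      have ce1: "{p ! i, p ! Suc i} \<in> cycle_edges xs" if "Suc i < length p" for i
        using ce[of i] that lx by (simp add: xs_def nth_append)
      have ce2: "{b', r} \<in> cycle_edges xs" using ce[of "length p - 1"] p0 lx by (simp add: xs_def nth_append)
      have ce3: "{r, b} \<in> cycle_edges xs" using ce[of "length p"] p0 lx by (simp add: xs_def nth_append)
      have notr: False if "x \<in> set p" "adj H x r" "{x, r} \<notin> cycle_edges xs" for x
      proof -
        have "x \<in> ?X" using that pX by blast
        then show False using that nS[OF _ r] ce2 ce3 by (auto simp: insert_commute)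
      qed
      have inp: False if "i < j" "j < length p" "adj H (p ! i) (p ! j)" "{p ! i, p ! j} \<notin> cycle_edges xs" for i j
        using that p(3)[of i j] ce1[of i] by (cases "j = Suc i") auto
      consider "u \<in> set p" "v \<in> set p" | "u = r" "v \<in> set p" | "u \<in> set p" "v = r"
        using uv by (auto simp: xs_def)
      then show False
      proof cases
        case 1
        then obtain i j where ij: "i < length p" "j < length p" "u = p ! i" "v = p ! j"
          by (metis in_set_conv_nth)
        then have "i \<noteq> j" using uv by auto
        then show False using inp[of i j] inp[of j i] ij uv adj_commute
          by (metis insert_commute linorder_neqE_nat)
      next
        case 2 then show False using notr[of v] uv adj_commute by (metis insert_commute)
      next
        case 3 then show False using notr[of u] uv by auto
      qed
    qed
    have "R \<subset> W" using SW SN NW by (auto simp: R_def)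
    moreover have "R \<noteq> {}" using SW NW by (auto simp: R_def)
    ultimately obtain w where w: "w \<in> R" "\<And>a b. a \<in> R \<Longrightarrow> b \<in> R \<Longrightarrow> adj H w a \<Longrightarrow> adj H w b \<Longrightarrow> adj H a b"
      using psubset.IH[of R] psubset.prems all_cycles_chorded_mono[of H W R] by blast
    have cl: "a \<in> R \<union> B" if "a \<in> W" "adj H w a" for a
      using that w(1) nS[of a w] adj_sym[OF that(2)] by (auto simp: R_def B_def)
    have "adj H a b" if h: "a \<in> W" "b \<in> W" "adj H w a" "adj H w b" for a b
    proof -
      consider "a \<in> R" "b \<in> R" | "a \<in> B" "b \<in> B" | "a \<in> B" "b \<in> R" | "b \<in> B" "a \<in> R"
        using cl[OF h(1,3)] cl[OF h(2,4)] by blast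
      then show ?thesis
      proof cases
        case 1 then show ?thesis using w(2) h(3,4) by blast
      next
        case 2 then show ?thesis by (rule BB)
      next
        case 3 then show ?thesis by (rule BR)
      next
        case 4 then show ?thesis using BR adj_sym by metis
      qed
    qed
    moreover have "w \<in> W" using w(1) by (simp add: R_def)
    ultimately show ?thesis by blast
  qed
qed

section \<open>Leaves of a tree\<close>

definition acyclic_on :: "'v ugraph \<Rightarrow> 'v set \<Rightarrow> bool" where
  "acyclic_on H X \<longleftrightarrow> (\<forall>a\<in>X. \<not> adj H a a) \<and>
     (\<forall>xs. distinct xs \<longrightarrow> length xs \<ge> 3 \<longrightarrow> set xs \<subseteq> X \<longrightarrow>
       \<not> (\<forall>i<length xs. adj H (xs ! i) (xs ! (Suc i mod length xs))))"

text \<open>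
  The end of a longest path from \<open>r\<close> has no neighbour but its predecessor: all its neighbours lie on the
  path, and an earlier one would close a cycle.
\<close>

lemma acyclic_on_longest_path:
  assumes fin: "finite X" and r: "r \<in> X" and ac: "acyclic_on H X"
  obtains p u where "path_in H X r u p" "distinct p"
    "\<And>w. w \<in> X \<Longrightarrow> adj H u w \<Longrightarrow> length p \<ge> 2 \<and> w = p ! (length p - 2)"
proof -
  let ?P = "\<lambda>p. distinct p \<and> (\<exists>u. path_in H X r u p)"
  have "?P [r]" using r by (auto simp: path_in_def)
  moreover have "\<forall>p. ?P p \<longrightarrow> length p < Suc (card X)"
    using fin by (auto simp: path_in_def less_Suc_eq_le) (metis card_mono distinct_card)
  ultimately obtain p where p: "?P p" "\<And>q. ?P q \<Longrightarrow> length q \<le> length p"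
    using ex_has_greatest_nat[of ?P "[r]" length] by blast
  then obtain u where u: "path_in H X r u p" by blast
  have pn: "p \<noteq> []" "last p = u" "hd p = r" "set p \<subseteq> X" "successively (adj H) p" using u by (auto simp: path_in_def)
  have "length p \<ge> 2 \<and> w = p ! (length p - 2)" if w: "w \<in> X" "adj H u w" for w
  proof -
    have "w \<in> set p"
    proof (rule ccontr)
      assume "w \<notin> set p"
      then have "?P (p @ [w])" using p(1) pn w by (auto simp: path_in_def successively_append_iff)
      then show False using p(2)[of "p @ [w]"] by simp
    qed
    then obtain k where k: "k < length p" "w = p ! k" by (metis in_set_conv_nth)
    have ul: "u = p ! (length p - 1)" using pn by (simp add: last_conv_nth)
    have "k \<noteq> length p - 1"
    proof
      assume "k = length p - 1"
      then have "adj H u u" using w k ul by simp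
      moreover have "u \<in> X" using pn by (metis last_in_set subsetD)
      ultimately show False using ac by (auto simp: acyclic_on_def)
    qed
    then have k2: "k \<le> length p - 2" "length p \<ge> 2" using k by auto
    have "k = length p - 2"
    proof (rule ccontr)
      assume "k \<noteq> length p - 2"
      then have len: "length (drop k p) \<ge> 3" using k2 by auto
      have cyc: "adj H (drop k p ! i) (drop k p ! (Suc i mod length (drop k p)))" if i: "i < length (drop k p)" for i
      proof (cases "Suc i < length (drop k p)")
        case True
        then show ?thesis using path_in_nth_adj[OF u, of "k + i"] by auto
      next
        case False
        then have si: "Suc i = length (drop k p)" using i by simp
        then have ki: "k + i = length p - 1" by simp
        have "drop k p ! i = u" unfolding ul ki[symmetric] using k(1) by (simp add: less_imp_le)
        moreover have "drop k p ! (Suc i mod length (drop k p)) = w"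
          unfolding si k(2) mod_self using k(1) by (simp add: less_imp_le)
        ultimately show ?thesis using w(2) by simp
      qed
      have "set (drop k p) \<subseteq> X" by (rule subset_trans[OF set_drop_subset pn(4)])
      moreover have "distinct (drop k p)" using p(1) by simp
      ultimately have "\<not> (\<forall>i<length (drop k p). adj H (drop k p ! i) (drop k p ! (Suc i mod length (drop k p))))"
        using ac[unfolded acyclic_on_def, THEN conjunct2, rule_format, of "drop k p"] len by simp
      then show False using cyc by blast
    qed
    then show ?thesis using k k2 by simp
  qed
  then show thesis using that u p(1) by blast
qed

section \<open>Chordal/tree decompositions\<close>

text \<open>
  The lists that occur are the full one, singletons, and lists \<open>L\<close> without vertices of \<open>T\<close> for which
  \<open>L \<inter> C\<close> is a clique and that contain, with a vertex \<open>u\<close> of \<open>J\<close>, its neighbour \<open>c u\<close> in \<open>C\<close>. Cutting the full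
  list down to \<open>N(u)\<close> leaves \<open>c u\<close> and a part of \<open>J\<close> if \<open>u \<in> J\<close>, the predecessor of \<open>u\<close> if \<open>u\<close> is the
  end of a longest path from the vertex of \<open>C\<close> to which a tree is attached into that tree, and a
  clique if \<open>u\<close> is simplicial. The substitute for \<open>u\<close> is \<open>c u\<close> in the first case, the predecessor of the predecessor in the second (or the vertex of
  \<open>C\<close> to which the tree is attached), and in the third any other element of the clique or, for the full
  list, any other neighbour of \<open>u\<close>. The order of elimination is expressed by the conditions that \<open>W\<close>
  contains all of \<open>C\<close> as long as vertices outside \<open>C\<close> remain, and all of \<open>T\<close> as long as vertices of \<open>J\<close>
  do; connectedness ensures that there is a substitute in the full list, and that a tree is not cut
  off from its root.
\<close>

lemma decomposition_eliminable:
  fixes H :: "'v ugraph" and c :: "'v \<Rightarrow> 'v"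
  defines "fam \<equiv> (\<lambda>C T J W. {L. L \<subseteq> W \<and> (L = W \<or> (\<exists>v. L = {v}) \<or>
      (L \<inter> T = {} \<and> (\<forall>a\<in>L \<inter> C. \<forall>b\<in>L \<inter> C. adj H a b) \<and> (\<forall>u\<in>L \<inter> J. c u \<in> L)))})"
  assumes V: "V = C \<union> T \<union> J" "C \<inter> T = {}" "C \<inter> J = {}" "T \<inter> J = {}"
    and refl: "\<And>v. v \<in> C \<Longrightarrow> adj H v v" and chord: "all_cycles_chorded H C"
    and J1: "\<And>u. u \<in> J \<Longrightarrow> c u \<in> C \<and> adj H u (c u)"
    and J2: "\<And>u w. u \<in> J \<Longrightarrow> w \<in> V \<Longrightarrow> adj H u w \<Longrightarrow> w = c u \<or> (w \<in> J \<and> c w = c u)"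
    and T1: "\<And>t. t \<in> T \<Longrightarrow> \<exists>X r d. t \<in> X \<and> X \<subseteq> T \<and> r \<in> X \<and> d \<in> C \<and> adj H r d \<and> acyclic_on H X \<and>
       (\<forall>a\<in>X. \<forall>w\<in>V. adj H a w \<longrightarrow> w \<in> X \<or> a = r \<and> w = d)"
    and fin: "finite W" and WV: "W \<subseteq> V" and WC: "W \<inter> C \<noteq> {}"
    and up1: "W \<inter> (T \<union> J) \<noteq> {} \<Longrightarrow> C \<subseteq> W" and up2: "W \<inter> J \<noteq> {} \<Longrightarrow> T \<subseteq> W"
    and conn: "\<And>a b. a \<in> W \<Longrightarrow> b \<in> W \<Longrightarrow> linked H W a b"
  shows "eliminable H W (fam C T J W)"
  using fin WV WC up1 up2 conn
proof (induction W rule: finite_psubset_induct)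
  case (psubset W)
  note WV = psubset.prems(1) and WC = psubset.prems(2) and up1 = psubset.prems(3)
    and up2 = psubset.prems(4) and conn = psubset.prems(5)
  show ?case
  proof (cases "\<exists>s. W = {s}")
    case True
    then obtain s where "W = {s}" by blast
    then show ?thesis by (auto simp: fam_def intro!: eliminable.last)
  next
    case False
    have TJ: "\<not> adj H t j" if "t \<in> T" "j \<in> J" for t j
      using J2[OF that(2), of t] J1[OF that(2)] that V adj_commute[of H t j] by blast
    have cJ: "c w = c u" if "u \<in> J" "w \<in> J" "adj H u w" for u w
      using J2[OF that(1) _ that(3)] J1[OF that(1)] that V by blast
    \<comment> \<open>the vertex to be eliminated: from \<open>J\<close> if possible, else from \<open>T\<close>, else from \<open>C\<close>\<close>
    have "\<exists>u\<in>W. (\<exists>t\<in>W - {u}. \<forall>w\<in>W. adj H u w \<longrightarrow> adj H t w) \<and>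
        (\<forall>L. L \<subseteq> W \<longrightarrow> u \<in> L \<longrightarrow> L \<noteq> {u} \<longrightarrow> L \<inter> T = {} \<longrightarrow> (\<forall>a\<in>L \<inter> C. \<forall>b\<in>L \<inter> C. adj H a b) \<longrightarrow>
           (\<forall>u\<in>L \<inter> J. c u \<in> L) \<longrightarrow> (\<exists>t\<in>L - {u}. \<forall>w\<in>W. adj H u w \<longrightarrow> adj H t w)) \<and>
        W \<inter> nbhd H u - {u} \<in> fam C T J (W - {u}) \<and>
        (u \<in> C \<longrightarrow> W \<subseteq> C) \<and> (u \<in> T \<longrightarrow> W \<inter> J = {})"
    proof (cases "W \<inter> J = {}")
      case False
      then obtain u where u: "u \<in> W" "u \<in> J" by blast
      have CW: "C \<subseteq> W" using up1 False by blast
      have cu: "c u \<in> C" "c u \<noteq> u" "adj H u (c u)" using J1[OF u(2)] u V by auto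
      have f: "adj H (c u) w" if "w \<in> W" "adj H u w" for w
        using J2[OF u(2) _ that(2)] that WV J1 refl[OF cu(1)] adj_commute by (metis subsetD)
      have m: "W \<inter> nbhd H u - {u} \<in> fam C T J (W - {u})"
      proof -
        have 1: "w = c u \<or> (w \<in> J \<and> c w = c u)" if "w \<in> W \<inter> nbhd H u - {u}" for w
          using that J2[OF u(2), of w] WV by (auto simp: nbhd_def adj_commute)
        have 2: "c u \<in> W \<inter> nbhd H u - {u}" using cu CW by (auto simp: nbhd_def adj_commute)
        have 3: "(W \<inter> nbhd H u - {u}) \<inter> T = {}" using 1 V cu(1) by blast
        have 4: "(W \<inter> nbhd H u - {u}) \<inter> C \<subseteq> {c u}" using 1 V by blast
        have 5: "\<forall>w\<in>(W \<inter> nbhd H u - {u}) \<inter> J. c w \<in> W \<inter> nbhd H u - {u}"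
        proof
          fix w assume "w \<in> (W \<inter> nbhd H u - {u}) \<inter> J"
          then have "c w = c u" using 1[of w] V(3) cu(1) by blast
          then show "c w \<in> W \<inter> nbhd H u - {u}" using 2 by simp
        qed
        have 6: "\<forall>a\<in>(W \<inter> nbhd H u - {u}) \<inter> C. \<forall>b\<in>(W \<inter> nbhd H u - {u}) \<inter> C. adj H a b"
          using 4 refl[OF cu(1)] by blast
        show ?thesis unfolding fam_def using 3 5 6 by blast
      qed
      show ?thesis
      proof (rule bexI[of _ u], intro conjI)
        show "\<exists>t\<in>W - {u}. \<forall>w\<in>W. adj H u w \<longrightarrow> adj H t w"
          using f cu CW by (intro bexI[of _ "c u"]) auto
        show "\<forall>L. L \<subseteq> W \<longrightarrow> u \<in> L \<longrightarrow> L \<noteq> {u} \<longrightarrow> L \<inter> T = {} \<longrightarrow> (\<forall>a\<in>L \<inter> C. \<forall>b\<in>L \<inter> C. adj H a b) \<longrightarrow>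
           (\<forall>u\<in>L \<inter> J. c u \<in> L) \<longrightarrow> (\<exists>t\<in>L - {u}. \<forall>w\<in>W. adj H u w \<longrightarrow> adj H t w)"
          using f cu u by (intro allI impI bexI[of _ "c u"]) auto
        show "u \<in> C \<longrightarrow> W \<subseteq> C" "u \<in> T \<longrightarrow> W \<inter> J = {}" using u V by auto
      qed (use u m in auto)
    next
      case noJ: True
      show ?thesis
      proof (cases "W \<inter> T = {}")
        case False
        then obtain t0 where t0: "t0 \<in> W" "t0 \<in> T" by blast
        have CW: "C \<subseteq> W" using up1 False by blast
        obtain X r d where X: "t0 \<in> X" "X \<subseteq> T" "r \<in> X" "d \<in> C" "adj H r d" "acyclic_on H X"
          "\<And>a w. a \<in> X \<Longrightarrow> w \<in> V \<Longrightarrow> adj H a w \<Longrightarrow> w \<in> X \<or> a = r \<and> w = d"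
          using T1[OF t0(2)] by blast
        have rW: "r \<in> W"
        proof (rule ccontr)
          assume "r \<notin> W"
          then have cl: "y \<in> X" if "x \<in> X" "x \<in> W" "y \<in> W" "adj H x y" for x y
            using X(7)[OF that(1) _ that(4)] that WV by blast
          obtain e where e: "e \<in> W" "e \<in> C" using WC by blast
          have "e \<in> X" by (rule linked_closed[OF conn[OF t0(1) e(1)] X(1)]) (rule cl)
          then show False using e X V by blast
        qed
        have ac: "acyclic_on H (X \<inter> W)" using X(6) unfolding acyclic_on_def by (meson IntD1 le_inf_iff)
        obtain p u where p: "path_in H (X \<inter> W) r u p" "distinct p"
          and nb: "\<And>w. w \<in> X \<inter> W \<Longrightarrow> adj H u w \<Longrightarrow> length p \<ge> 2 \<and> w = p ! (length p - 2)"
        proof -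
          have fr: "finite (X \<inter> W)" "r \<in> X \<inter> W" using psubset.hyps(1) rW X(3) by auto
          show thesis by (rule acyclic_on_longest_path[OF fr ac]) (rule that)
        qed
        have pp: "p \<noteq> []" "set p \<subseteq> X \<inter> W" "p ! 0 = r" "p ! (length p - 1) = u"
          using p(1) by (auto simp: path_in_def hd_conv_nth last_conv_nth)
        have uXW: "u \<in> X" "u \<in> W"
          using pp nth_mem[of "length p - 1" p] by auto
        have inW: "p ! i \<in> X \<and> p ! i \<in> W" if "i < length p" for i using pp(2) nth_mem[OF that] by blast
        have Xnl: "\<not> adj H u u" using X(6) uXW by (auto simp: acyclic_on_def)
        have dW: "d \<in> W" using X CW by blast
        have "\<exists>q t. t \<in> W - {u} \<and> adj H t q \<and> q \<in> W \<and> q \<noteq> u \<and> adj H u q \<and> (\<forall>w\<in>W. adj H u w \<longrightarrow> w = q)"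
        proof -
          have un: "u = r" if "length p = 1" using that pp by simp
          have un2: "u \<noteq> r" if "length p \<ge> 2"
          proof -
            have "length p - 1 < length p" "0 < length p" "length p - 1 \<noteq> 0" using that by auto
            then show ?thesis using p(2) pp(3,4) by (metis nth_eq_iff_index_eq)
          qed
          have ud: "u \<noteq> d" using uXW X V by blast
          consider "length p = 1" | "length p = 2" | "length p \<ge> 3" using pp(1)
            by (metis One_nat_def Suc_1 Suc_leI length_greater_0_conv nat_less_le numeral_3_eq_3)
          then show ?thesis
          proof cases
            case 1
            have "\<forall>w\<in>W. adj H u w \<longrightarrow> w = d"
            proof (intro ballI impI)
              fix w assume w: "w \<in> W" "adj H u w"
              then have "w \<in> X \<or> w = d" using X(7)[OF uXW(1) _ w(2)] WV by blast
              moreover have "w \<notin> X"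
              proof
                assume "w \<in> X"
                then have "length p \<ge> 2" using nb[of w] w by simp
                then show False using 1 by simp
              qed
              ultimately show "w = d" by simp
            qed
            moreover have "adj H d d" "adj H u d" using refl[OF X(4)] X(5) un[OF 1] by simp_all
            moreover have "d \<in> W - {u}" "d \<noteq> u" using dW ud by auto
            ultimately show ?thesis using dW by blast
          next
            case 2
            then have ur: "u \<noteq> r" using un2 by simp
            have nbs: "\<forall>w\<in>W. adj H u w \<longrightarrow> w = r"
            proof (intro ballI impI)
              fix w assume w: "w \<in> W" "adj H u w"
              then have "w \<in> X" using X(7)[OF uXW(1) _ w(2)] ur WV by blast
              then show "w = r" using nb[of w] w 2 pp(3) by simp
            qed
            have "adj H (p ! 0) (p ! Suc 0)" using path_in_nth_adj[OF p(1), of 0] 2 by simp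
            then have "adj H u r" using pp(3,4) 2 adj_commute by fastforce
            moreover have "adj H d r" using X(5) adj_commute by metis
            moreover have "d \<in> W - {u}" "r \<noteq> u" using dW ud ur by auto
            ultimately show ?thesis using nbs rW by blast
          next
            case 3
            then have ur: "u \<noteq> r" using un2 by simp
            let ?q = "p ! (length p - 2)" and ?t = "p ! (length p - 3)"
            have nbs: "\<forall>w\<in>W. adj H u w \<longrightarrow> w = ?q"
            proof (intro ballI impI)
              fix w assume w: "w \<in> W" "adj H u w"
              then have "w \<in> X" using X(7)[OF uXW(1) _ w(2)] ur WV by blast
              then show "w = ?q" using nb[of w] w by simp
            qed
            have s: "Suc (length p - 2) = length p - 1" "Suc (length p - 3) = length p - 2" using 3 by auto
            have "adj H ?q u" using path_in_nth_adj[OF p(1), of "length p - 2"] 3 s pp(4) by simp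
            then have "adj H u ?q" using adj_commute by metis
            moreover have "adj H ?t ?q" using path_in_nth_adj[OF p(1), of "length p - 3"] 3 s by simp
            moreover have "?t \<noteq> u" using p(2) pp(4) 3 nth_eq_iff_index_eq[OF p(2), of "length p - 3" "length p - 1"] by auto
            moreover have "?q \<noteq> u" using Xnl calculation(1) by auto
            moreover have "?q \<in> W" "?t \<in> W" using inW 3 by auto
            ultimately show ?thesis using nbs by blast
          qed
        qed
        then obtain q t where qt: "t \<in> W - {u}" "adj H t q" "q \<in> W" "q \<noteq> u" "adj H u q"
          "\<And>w. w \<in> W \<Longrightarrow> adj H u w \<Longrightarrow> w = q" by blast
        have "W \<inter> nbhd H u - {u} = {q}"
        proof
          show "W \<inter> nbhd H u - {u} \<subseteq> {q}" unfolding nbhd_def using adj_sym[of H _ u] qt(6) by blast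
          show "{q} \<subseteq> W \<inter> nbhd H u - {u}" using qt(3,4) adj_sym[OF qt(5)] by (simp add: nbhd_def)
        qed
        then have m: "W \<inter> nbhd H u - {u} \<in> fam C T J (W - {u})" using qt(3,4) by (auto simp: fam_def)
        have uT: "u \<in> T" using uXW X by blast
        show ?thesis
        proof (rule bexI[of _ u], intro conjI)
          show "\<exists>t\<in>W - {u}. \<forall>w\<in>W. adj H u w \<longrightarrow> adj H t w" using qt by blast
        qed (use uT uXW V m noJ in auto)
      next
        case True
        then have WsC: "W \<subseteq> C" using noJ WV V by blast
        obtain u where u: "u \<in> W" "\<And>a b. a \<in> W \<Longrightarrow> b \<in> W \<Longrightarrow> adj H u a \<Longrightarrow> adj H u b \<Longrightarrow> adj H a b"
          using ex_simplicial_vertex[OF psubset.hyps(1), of H] WC WsC refl all_cycles_chorded_mono[OF chord WsC]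
          by (metis inf_bot_left subsetD)
        have f: "\<forall>w\<in>W. adj H u w \<longrightarrow> adj H t w" if "t \<in> W" "adj H u t" for t using u that by blast
        have "\<exists>t\<in>W - {u}. adj H u t"
        proof -
          obtain b where b: "b \<in> W" "b \<noteq> u" using False u(1) by blast
          show ?thesis
          proof (rule ccontr)
            assume n: "\<not> ?thesis"
            have "b \<in> {u}" by (rule linked_closed[OF conn[OF u(1) b(1)]]) (use n in auto)
            then show False using b by simp
          qed
        qed
        then obtain t where t: "t \<in> W - {u}" "adj H u t" by blast
        have m: "W \<inter> nbhd H u - {u} \<in> fam C T J (W - {u})"
        proof -
          have "(W \<inter> nbhd H u - {u}) \<inter> T = {}" "(W \<inter> nbhd H u - {u}) \<inter> J = {}" using True noJ by auto
          moreover have "\<forall>a\<in>W \<inter> nbhd H u. \<forall>b\<in>W \<inter> nbhd H u. adj H a b"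
            using u by (auto simp: nbhd_def adj_commute)
          ultimately show ?thesis unfolding fam_def by blast
        qed
        show ?thesis
        proof (rule bexI[of _ u], intro conjI)
          show "\<exists>t\<in>W - {u}. \<forall>w\<in>W. adj H u w \<longrightarrow> adj H t w" using f t by blast
          show "\<forall>L. L \<subseteq> W \<longrightarrow> u \<in> L \<longrightarrow> L \<noteq> {u} \<longrightarrow> L \<inter> T = {} \<longrightarrow> (\<forall>a\<in>L \<inter> C. \<forall>b\<in>L \<inter> C. adj H a b) \<longrightarrow>
             (\<forall>u\<in>L \<inter> J. c u \<in> L) \<longrightarrow> (\<exists>t\<in>L - {u}. \<forall>w\<in>W. adj H u w \<longrightarrow> adj H t w)"
          proof (intro allI impI)
            fix L assume L: "L \<subseteq> W" "u \<in> L" "L \<noteq> {u}" "\<forall>a\<in>L \<inter> C. \<forall>b\<in>L \<inter> C. adj H a b"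
            then obtain t where "t \<in> L" "t \<noteq> u" by blast
            then show "\<exists>t\<in>L - {u}. \<forall>w\<in>W. adj H u w \<longrightarrow> adj H t w" using L f WsC by blast
          qed
        qed (use u m WsC noJ in auto)
      qed
    qed
    then obtain u where u: "u \<in> W"
      and fold: "\<exists>t\<in>W - {u}. \<forall>w\<in>W. adj H u w \<longrightarrow> adj H t w"
      and foldL: "\<And>L. L \<subseteq> W \<Longrightarrow> u \<in> L \<Longrightarrow> L \<noteq> {u} \<Longrightarrow> L \<inter> T = {} \<Longrightarrow> (\<forall>a\<in>L \<inter> C. \<forall>b\<in>L \<inter> C. adj H a b) \<Longrightarrow>
           (\<forall>u\<in>L \<inter> J. c u \<in> L) \<Longrightarrow> \<exists>t\<in>L - {u}. \<forall>w\<in>W. adj H u w \<longrightarrow> adj H t w"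
      and nbu: "W \<inter> nbhd H u - {u} \<in> fam C T J (W - {u})"
      and uC: "u \<in> C \<Longrightarrow> W \<subseteq> C" and uT: "u \<in> T \<Longrightarrow> W \<inter> J = {}" by blast
    obtain t where t: "t \<in> W" "t \<noteq> u" "\<And>w. w \<in> W \<Longrightarrow> adj H u w \<Longrightarrow> adj H t w" using fold by blast
    have ind: "eliminable H (W - {u}) (fam C T J (W - {u}))"
    proof (rule psubset.IH)
      show "W - {u} \<subset> W" "W - {u} \<subseteq> V" using u WV by auto
      show "(W - {u}) \<inter> C \<noteq> {}" using uC WC t by blast
      show "C \<subseteq> W - {u}" if "(W - {u}) \<inter> (T \<union> J) \<noteq> {}" using up1 that uC V by blast
      show "T \<subseteq> W - {u}" if "(W - {u}) \<inter> J \<noteq> {}" using up2 that uT V by blast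
      show "linked H (W - {u}) a b" if "a \<in> W - {u}" "b \<in> W - {u}" for a b
        using linked_fold[OF conn[of a b] _ _ t] that by blast
    qed
    have cases: "L - {u} \<in> fam C T J (W - {u}) \<and> L \<inter> nbhd H u - {u} \<in> fam C T J (W - {u})"
      if L: "L \<in> fam C T J W" "L \<noteq> {u}" for L
    proof -
      consider "L = W" | v where "L = {v}" "v \<noteq> u" | "L \<subseteq> W" "L \<inter> T = {}" "\<forall>a\<in>L \<inter> C. \<forall>b\<in>L \<inter> C. adj H a b" "\<forall>u\<in>L \<inter> J. c u \<in> L"
        using L by (auto simp: fam_def)
      then show ?thesis
      proof cases
        case 1
        then show ?thesis using nbu by (auto simp: fam_def)
      next
        case 2
        then have e: "L - {u} = {v}" "L \<inter> nbhd H u - {u} = {v} \<or> L \<inter> nbhd H u - {u} = {}" by auto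
        have "v \<in> W - {u}" using L 2 by (auto simp: fam_def)
        then have "{v} \<in> fam C T J (W - {u})" "{} \<in> fam C T J (W - {u})" by (auto simp: fam_def)
        then show ?thesis using e by metis
      next
        case 3
        have "\<forall>w\<in>(L - {u}) \<inter> J. c w \<in> L - {u}"
          using 3 uC J1 V by blast
        moreover have "\<forall>w\<in>(L \<inter> nbhd H u - {u}) \<inter> J. c w \<in> L \<inter> nbhd H u - {u}"
        proof
          fix w assume w: "w \<in> (L \<inter> nbhd H u - {u}) \<inter> J"
          then have uw: "adj H u w" "adj H w u" "w \<in> W" "w \<in> J" using 3 by (auto simp: nbhd_def adj_commute)
          have "u \<notin> C" using uC uw V by blast
          moreover have "u \<notin> T" using TJ uw by blast
          ultimately have uJ: "u \<in> J" using u WV V by blast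
          have e: "c w = c u" using cJ[OF uJ uw(4,1)] .
          have "c w \<in> L" using 3 w by blast
          moreover have "c w \<in> nbhd H u" "c w \<noteq> u" using e J1[OF uJ] V uJ by (auto simp: nbhd_def adj_commute)
          ultimately show "c w \<in> L \<inter> nbhd H u - {u}" by blast
        qed
        ultimately show ?thesis using 3 unfolding fam_def by blast
      qed
    qed
    show ?thesis
    proof (rule eliminable.step[where u = u and \<F>' = "fam C T J (W - {u})"])
      show "fam C T J W \<subseteq> Pow W" "W \<in> fam C T J W" "W - {u} \<in> fam C T J (W - {u})" by (auto simp: fam_def)
      show "u \<in> W" "W \<noteq> {u}" using u False by auto
      show "\<exists>t\<in>L - {u}. \<forall>w\<in>W. adj H u w \<longrightarrow> adj H t w" if "L \<in> fam C T J W" "u \<in> L" "L \<noteq> {u}" for L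
        using that fold foldL[of L] by (auto simp: fam_def)
    qed (use ind cases in auto)
  qed
qed

lemma loop_chordal_imp_all_cycles_chorded:
  assumes "loop_chordal (induced H C)" "C \<subseteq> verts H"
  shows "all_cycles_chorded H C"
  unfolding all_cycles_chorded_def
proof (intro allI impI)
  fix xs assume xs: "distinct xs" "4 \<le> length xs" "set xs \<subseteq> C"
    and adj: "\<forall>i<length xs. adj H (xs ! i) (xs ! (Suc i mod length xs))"
  let ?G = "\<lparr>verts = verts (induced H C), edges = edges (induced H C) - {{v} | v. v \<in> verts (induced H C)}\<rparr>"
  have ch: "chordal ?G" using assms by (simp add: loop_chordal_def)
  have "cycle_edges xs \<subseteq> edges ?G"
  proof
    fix e assume "e \<in> cycle_edges xs"
    then obtain i where i: "i < length xs" "e = {xs ! i, xs ! (Suc i mod length xs)}" by (auto simp: cycle_edges_def)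
    have i2: "Suc i mod length xs < length xs" using xs(2) by (intro mod_less_divisor) linarith
    have "Suc i mod length xs \<noteq> i"
    proof (cases "Suc i = length xs")
      case True then show ?thesis using xs(2) by auto
    qed (use i in auto)
    then have "xs ! i \<noteq> xs ! (Suc i mod length xs)" using xs(1) i(1) i2 nth_eq_iff_index_eq by metis
    moreover have "xs ! i \<in> C" "xs ! (Suc i mod length xs) \<in> C" using xs(3) i(1) i2 nth_mem by blast+
    moreover have "e \<in> edges H" using adj i by (auto simp: adj_def)
    ultimately show "e \<in> edges ?G" using i by (auto simp: induced_def)
  qed
  then have "is_cycle ?G xs" using xs assms(2) by (auto simp: is_cycle_def induced_def)
  then obtain u v where "u \<in> set xs" "v \<in> set xs" "{u, v} \<in> edges ?G" "{u, v} \<notin> cycle_edges xs"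
    using ch xs(2) unfolding chordal_def by blast
  moreover from this have "u \<noteq> v" "adj H u v" using xs(3) assms(2) by (auto simp: induced_def adj_def)
  ultimately show "\<exists>u\<in>set xs. \<exists>v\<in>set xs. u \<noteq> v \<and> adj H u v \<and> {u, v} \<notin> cycle_edges xs" by blast
qed

lemma is_tree_imp_acyclic_on:
  assumes "is_tree (induced H X)" "X \<subseteq> verts H"
  shows "acyclic_on H X"
  unfolding acyclic_on_def
proof (intro conjI ballI allI impI notI)
  fix a assume "a \<in> X" "adj H a a"
  then show False using assms by (auto simp: is_tree_def loopless_def induced_def adj_def)
next
  fix xs assume xs: "distinct xs" "3 \<le> length xs" "set xs \<subseteq> X"
    and adj: "\<forall>i<length xs. adj H (xs ! i) (xs ! (Suc i mod length xs))"
  have "cycle_edges xs \<subseteq> edges (induced H X)"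
  proof
    fix e assume "e \<in> cycle_edges xs"
    then obtain i where i: "i < length xs" "e = {xs ! i, xs ! (Suc i mod length xs)}" by (auto simp: cycle_edges_def)
    have i2: "Suc i mod length xs < length xs" using xs(2) by (intro mod_less_divisor) linarith
    have "xs ! i \<in> X" "xs ! (Suc i mod length xs) \<in> X" using xs(3) i(1) i2 nth_mem by blast+
    then show "e \<in> edges (induced H X)" using adj i by (auto simp: induced_def adj_def)
  qed
  then have "is_cycle (induced H X) xs" using xs assms(2) by (auto simp: is_cycle_def induced_def)
  then show False using assms(1) by (auto simp: is_tree_def)
qed

text \<open>
  Extracts from a decomposition the function \<open>c\<close> and, for every vertex of \<open>T\<close>, its tree with the edge
  that attaches it to \<open>C\<close>.
\<close>

lemma chordal_tree_decomposable_imp_UMC: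
  fixes G :: "'x ugraph" and H :: "'v ugraph"
  assumes G: "ugraph G" and H: "constraint_graph H" and conn: "connected_graph H"
    and dec: "chordal_tree_decomposable H"
  shows "UMC G H"
proof -
  have fin: "finite (verts H)" using H by (simp add: constraint_graph_def)
  obtain C T J \<T> \<J> where V: "verts H = C \<union> T \<union> J" "C \<inter> T = {}" "C \<inter> J = {}" "T \<inter> J = {}"
    and C: "C \<noteq> {}" "loop_chordal (induced H C)"
    and pT: "partition_on T \<T>"
    and tree: "\<forall>Tj\<in>\<T>. is_tree (induced H Tj) \<and> (\<exists>!(r, c). r \<in> Tj \<and> c \<in> C \<and> {r, c} \<in> edges H)"
    and pJ: "partition_on J \<J>"
    and Jk: "\<forall>Jk\<in>\<J>. connected_graph (induced H Jk) \<and> (\<exists>c\<in>C. \<forall>u\<in>Jk. \<forall>c'\<in>C. {u, c'} \<in> edges H \<longleftrightarrow> c' = c)"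
    and TJ: "edges_between H T J = {}"
    and TT: "\<forall>T1\<in>\<T>. \<forall>T2\<in>\<T>. T1 \<noteq> T2 \<longrightarrow> edges_between H T1 T2 = {}"
    and JJ: "\<forall>J1\<in>\<J>. \<forall>J2\<in>\<J>. J1 \<noteq> J2 \<longrightarrow> edges_between H J1 J2 = {}"
    using dec unfolding chordal_tree_decomposable_def by (elim exE conjE) (rule that)
  have eb: "\<not> adj H a b" if "edges_between H A B = {}" "a \<in> A" "b \<in> B" for A B a b
    using that by (auto simp: edges_between_def adj_def)
  have refl: "adj H v v" if "v \<in> C" for v
    using C(2) that V by (auto simp: loop_chordal_def induced_def adj_def)
  have chord: "all_cycles_chorded H C" using loop_chordal_imp_all_cycles_chorded[OF C(2)] V by blast
  define c where "c u = (THE c'. c' \<in> C \<and> adj H u c')" for u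
  have cK: "\<exists>d\<in>C. \<forall>u\<in>K. c u = d \<and> (\<forall>c'\<in>C. adj H u c' \<longleftrightarrow> c' = d)" if K: "K \<in> \<J>" for K
  proof -
    have "\<exists>d\<in>C. \<forall>u\<in>K. \<forall>c'\<in>C. {u, c'} \<in> edges H \<longleftrightarrow> c' = d" using Jk K by blast
    then obtain d where d: "d \<in> C" and d': "\<forall>u\<in>K. \<forall>c'\<in>C. adj H u c' \<longleftrightarrow> c' = d"
      by (auto simp: adj_def)
    then have "c u = d" if "u \<in> K" for u
      unfolding c_def using that d d' by (intro the_equality) auto
    then show ?thesis using d d' by blast
  qed
  have J0: "\<exists>K\<in>\<J>. u \<in> K" if "u \<in> J" for u using pJ that by (auto simp: partition_on_def)
  have J1: "c u \<in> C \<and> adj H u (c u)" if "u \<in> J" for u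
    using J0[OF that] cK by metis
  have J2: "w = c u \<or> (w \<in> J \<and> c w = c u)" if uw: "u \<in> J" "w \<in> verts H" "adj H u w" for u w
  proof -
    obtain K where K: "K \<in> \<J>" "u \<in> K" using J0[OF uw(1)] by blast
    consider "w \<in> C" | "w \<in> T" | "w \<in> J" using V uw by blast
    then show ?thesis
    proof cases
      case 1 then show ?thesis using cK[OF K(1)] K(2) uw by metis
    next
      case 2 then show ?thesis using eb[OF TJ 2 uw(1)] uw(3) adj_commute by metis
    next
      case 3
      then obtain K' where K': "K' \<in> \<J>" "w \<in> K'" using J0 by blast
      then have "K' = K" using JJ K eb uw(3) by metis
      then show ?thesis using cK[OF K(1)] K(2) K' 3 by metis
    qed
  qed
  have T1: "\<exists>X r d. t \<in> X \<and> X \<subseteq> T \<and> r \<in> X \<and> d \<in> C \<and> adj H r d \<and> acyclic_on H X \<and>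
       (\<forall>a\<in>X. \<forall>w\<in>verts H. adj H a w \<longrightarrow> w \<in> X \<or> a = r \<and> w = d)" if t: "t \<in> T" for t
  proof -
    obtain X where X: "X \<in> \<T>" "t \<in> X" using pT t by (auto simp: partition_on_def)
    have XT: "X \<subseteq> T" using pT X by (auto simp: partition_on_def)
    have ex: "\<exists>!(r, c). r \<in> X \<and> c \<in> C \<and> {r, c} \<in> edges H" using tree X by blast
    obtain r d where rd: "r \<in> X" "d \<in> C" "adj H r d"
      and un: "\<And>a w. a \<in> X \<Longrightarrow> w \<in> C \<Longrightarrow> adj H a w \<Longrightarrow> a = r \<and> w = d"
    proof -
      obtain q where q: "case q of (r, c) \<Rightarrow> r \<in> X \<and> c \<in> C \<and> {r, c} \<in> edges H"
        "\<And>q'. (case q' of (r, c) \<Rightarrow> r \<in> X \<and> c \<in> C \<and> {r, c} \<in> edges H) \<Longrightarrow> q' = q"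
        using ex by (elim ex1E) blast
      show thesis
      proof (rule that)
        show "fst q \<in> X" "snd q \<in> C" "adj H (fst q) (snd q)" using q(1) by (auto simp: adj_def split: prod.splits)
        show "a = fst q \<and> w = snd q" if "a \<in> X" "w \<in> C" "adj H a w" for a w
          using q(2)[of "(a, w)"] that by (auto simp: adj_def)
      qed
    qed
    have "w \<in> X \<or> a = r \<and> w = d" if aw: "a \<in> X" "w \<in> verts H" "adj H a w" for a w
    proof -
      consider "w \<in> C" | "w \<in> T" | "w \<in> J" using V aw by blast
      then show ?thesis
      proof cases
        case 1 then show ?thesis using un aw by blast
      next
        case 2
        then obtain Y where Y: "Y \<in> \<T>" "w \<in> Y" using pT by (auto simp: partition_on_def)
        then have "X = Y" using TT X eb aw by metis
        then show ?thesis using Y by simp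
      next
        case 3 then show ?thesis using eb[OF TJ _ 3, of a] aw XT by blast
      qed
    qed
    moreover have "acyclic_on H X" using is_tree_imp_acyclic_on[of H X] tree X XT V by blast
    ultimately show ?thesis using X XT rd by blast
  qed
  note el = decomposition_eliminable[of "verts H" C T J H c "verts H", OF V refl chord J1 J2 T1 fin order_refl]
  have "eliminable H (verts H) {L. L \<subseteq> verts H \<and> (L = verts H \<or> (\<exists>v. L = {v}) \<or>
      (L \<inter> T = {} \<and> (\<forall>a\<in>L \<inter> C. \<forall>b\<in>L \<inter> C. adj H a b) \<and> (\<forall>u\<in>L \<inter> J. c u \<in> L)))}"
    by (rule el) (use V C connected_graph_linked[OF conn] in auto)
  then show ?thesis by (rule eliminable_imp_UMC[OF G fin]) auto
qed

section \<open>Unique maximal configurations and topological mixing\<close>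

lemma TSSM_imp_strongly_irreducible:
  assumes "TSSM G H"
  shows "strongly_irreducible G H"
proof -
  obtain g where g: "\<And>A B S \<alpha> \<beta> \<sigma>. A \<subseteq> verts G \<Longrightarrow> B \<subseteq> verts G \<Longrightarrow> S \<subseteq> verts G \<Longrightarrow>
        finite A \<Longrightarrow> finite B \<Longrightarrow> finite S \<Longrightarrow>
        A \<inter> B = {} \<Longrightarrow> A \<inter> S = {} \<Longrightarrow> B \<inter> S = {} \<Longrightarrow> sdist G A B \<ge> enat g \<Longrightarrow>
        \<alpha>\<in>A \<rightarrow>\<^sub>E verts H \<Longrightarrow> \<beta>\<in>B \<rightarrow>\<^sub>E verts H \<Longrightarrow> \<sigma>\<in>S \<rightarrow>\<^sub>E verts H \<Longrightarrow>
           glue A \<alpha> \<sigma> \<in> language G H (A \<union> S) \<Longrightarrow>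
           glue S \<sigma> \<beta> \<in> language G H (S \<union> B) \<Longrightarrow>
           glue A \<alpha> (glue S \<sigma> \<beta>) \<in> language G H (A \<union> S \<union> B)"
    using assms unfolding TSSM_def
    apply (elim exE)
    subgoal premises p for g
      by (rule p(1)[of g], rule p(2)[rule_format])
    done
  show ?thesis unfolding strongly_irreducible_def
  proof (intro exI[of _ g] allI impI ballI)
    fix A B \<alpha> \<beta>
    assume AB: "A \<subseteq> verts G" "B \<subseteq> verts G" "finite A" "finite B" "A \<inter> B = {}" "enat g \<le> sdist G A B"
      and \<alpha>: "\<alpha> \<in> language G H A" and \<beta>: "\<beta> \<in> language G H B"
    have PiE: "\<gamma> \<in> X \<rightarrow>\<^sub>E verts H" if "\<gamma> \<in> language G H X" "X \<subseteq> verts G" for \<gamma> X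
      using that by (auto simp: language_def homs_def)
    have e1: "glue A \<alpha> (\<lambda>x. undefined) = \<alpha>" using \<alpha>
      by (auto simp: glue_def override_on_def fun_eq_iff language_def)
    have e2: "glue {} \<sigma> \<beta> = \<beta>" for \<sigma> by (simp add: glue_def)
    show "glue A \<alpha> \<beta> \<in> language G H (A \<union> B)"
      using g[of A B "{}" \<alpha> \<beta> "\<lambda>x. undefined"] AB \<alpha> \<beta> e1 e2 PiE by simp
  qed
qed

lemma UMC_E:
  assumes "UMC G H"
  obtains g r where "strict_linear_order_on (verts H) r"
    and "\<And>A \<alpha>. A \<subseteq> verts G \<Longrightarrow> finite A \<Longrightarrow> \<alpha> \<in> language G H A \<Longrightarrow> \<exists>\<omega>. maximal_point G H r A \<alpha> \<omega>"
    and "\<And>A \<alpha>1 \<alpha>2 \<omega>1 \<omega>2 x. A \<subseteq> verts G \<Longrightarrow> finite A \<Longrightarrow>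
       maximal_point G H r A \<alpha>1 \<omega>1 \<Longrightarrow> maximal_point G H r A \<alpha>2 \<omega>2 \<Longrightarrow>
       x \<in> verts G \<Longrightarrow> \<omega>1 x \<noteq> \<omega>2 x \<Longrightarrow> \<exists>y\<in>A. near G g x y \<and> \<alpha>1 y \<noteq> \<alpha>2 y"
proof -
  obtain g r where r: "strict_linear_order_on (verts H) r" and all: "\<forall>A. A \<subseteq> verts G \<longrightarrow> finite A \<longrightarrow>
           (\<forall>\<alpha>\<in>language G H A. \<exists>!\<omega>. maximal_point G H r A \<alpha> \<omega>) \<and>
           (\<forall>\<alpha>1\<in>language G H A. \<forall>\<alpha>2\<in>language G H A. \<forall>\<omega>1 \<omega>2.
              maximal_point G H r A \<alpha>1 \<omega>1 \<longrightarrow> maximal_point G H r A \<alpha>2 \<omega>2 \<longrightarrow>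
              disagreement (verts G) \<omega>1 \<omega>2 \<subseteq> nbhd_n G g (disagreement A \<alpha>1 \<alpha>2))"
    using assms unfolding UMC_def by (elim exE conjE) (rule that)
  have ex: "\<exists>\<omega>. maximal_point G H r A \<alpha> \<omega>" if "A \<subseteq> verts G" "finite A" "\<alpha> \<in> language G H A" for A \<alpha>
    using bspec[OF all[rule_format, OF that(1,2), THEN conjunct1] that(3)] by (rule ex1_implies_ex)
  have loc: "\<exists>y\<in>A. near G g x y \<and> \<alpha>1 y \<noteq> \<alpha>2 y"
    if A: "A \<subseteq> verts G" "finite A" and m: "maximal_point G H r A \<alpha>1 \<omega>1" "maximal_point G H r A \<alpha>2 \<omega>2"
      and x: "x \<in> verts G" "\<omega>1 x \<noteq> \<omega>2 x" for A \<alpha>1 \<alpha>2 \<omega>1 \<omega>2 x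
  proof -
    have l: "\<alpha>1 \<in> language G H A" "\<alpha>2 \<in> language G H A"
      using m by (auto simp: maximal_point_def cylinder_def language_def)
    have "disagreement (verts G) \<omega>1 \<omega>2 \<subseteq> nbhd_n G g (disagreement A \<alpha>1 \<alpha>2)"
      using bspec[OF bspec[OF all[rule_format, OF A, THEN conjunct2] l(1)] l(2)] m by blast
    moreover have "x \<in> disagreement (verts G) \<omega>1 \<omega>2" using x by (simp add: disagreement_def)
    ultimately have "x \<in> nbhd_n G g (disagreement A \<alpha>1 \<alpha>2)" by (rule subsetD)
    then show ?thesis unfolding mem_nbhd_n_iff disagreement_def by blast
  qed
  show thesis by (rule that[OF r ex loc])
qed

text \<open>
  Pinning further sites to the values that a maximal point has anyway only shrinks the set of
  competitors. This makes maximal points over different sets of sites comparable.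
\<close>

lemma maximal_point_refine:
  assumes m: "maximal_point G H r S \<sigma> \<tau>" and sub: "S \<subseteq> S'"
  shows "maximal_point G H r S' (restrict \<tau> S') \<tau>"
proof -
  have \<tau>: "\<tau> \<in> homs G H" "restrict \<tau> S = \<sigma>" using m by (auto simp: maximal_point_def cylinder_def)
  have "cylinder G H S' (restrict \<tau> S') \<subseteq> cylinder G H S \<sigma>"
  proof
    fix \<eta> assume \<eta>: "\<eta> \<in> cylinder G H S' (restrict \<tau> S')"
    then have e: "restrict \<eta> S' = restrict \<tau> S'" by (simp add: cylinder_def)
    have "restrict \<eta> S = restrict \<tau> S"
    proof (rule restrict_ext)
      fix y assume "y \<in> S"
      then show "\<eta> y = \<tau> y" using fun_cong[OF e, of y] sub by auto
    qed
    then show "\<eta> \<in> cylinder G H S \<sigma>" using \<eta> \<tau> by (auto simp: cylinder_def)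
  qed
  then show ?thesis using m \<tau> unfolding maximal_point_def by (auto simp: cylinder_def)
qed

text \<open>
  The gap is \<open>2g + 2\<close>, so that no site within \<open>g\<close> of \<open>A\<close> is adjacent to one within \<open>g\<close> of \<open>B\<close>. Near \<open>A\<close> use the
  maximal point over \<open>\<alpha>\<sigma>\<close> and elsewhere the one over \<open>\<sigma>\<beta>\<close>; where the two meet, both agree with the
  maximal point over \<open>\<sigma>\<close>.
\<close>

lemma UMC_imp_TSSM:
  fixes G :: "'x ugraph"
  assumes G: "ugraph G" and "UMC G H"
  shows "TSSM G H"
proof -
  obtain g r where r: "strict_linear_order_on (verts H) r"
    and ex: "\<And>A \<alpha>. A \<subseteq> verts G \<Longrightarrow> finite A \<Longrightarrow> \<alpha> \<in> language G H A \<Longrightarrow> \<exists>\<omega>. maximal_point G H r A \<alpha> \<omega>"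
    and loc: "\<And>A \<alpha>1 \<alpha>2 \<omega>1 \<omega>2 x. A \<subseteq> verts G \<Longrightarrow> finite A \<Longrightarrow>
       maximal_point G H r A \<alpha>1 \<omega>1 \<Longrightarrow> maximal_point G H r A \<alpha>2 \<omega>2 \<Longrightarrow>
       x \<in> verts G \<Longrightarrow> \<omega>1 x \<noteq> \<omega>2 x \<Longrightarrow> \<exists>y\<in>A. near G g x y \<and> \<alpha>1 y \<noteq> \<alpha>2 y"
    by (rule UMC_E[OF assms(2)]) (rule that)
  \<comment> \<open>pinning the sites of \<open>A\<close> moves the maximal point over \<open>\<sigma>\<close> only near \<open>A\<close>\<close>
  have diff: "\<exists>y\<in>A. near G g x y"
    if A: "A \<subseteq> verts G" "S \<subseteq> verts G" "finite A" "finite S" and m: "maximal_point G H r S \<sigma> \<tau>"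
      and m1: "maximal_point G H r (A \<union> S) \<alpha> \<omega>" and e: "\<And>y. y \<in> S \<Longrightarrow> \<alpha> y = \<sigma> y"
      and x: "x \<in> verts G" "\<omega> x \<noteq> \<tau> x" for A S \<sigma> \<tau> \<alpha> \<omega> x
  proof -
    have \<tau>: "\<tau> \<in> homs G H" "restrict \<tau> S = \<sigma>" using m by (auto simp: maximal_point_def cylinder_def)
    have m2: "maximal_point G H r (A \<union> S) (restrict \<tau> (A \<union> S)) \<tau>"
      by (rule maximal_point_refine[OF m]) simp
    have "A \<union> S \<subseteq> verts G" "finite (A \<union> S)" using A by auto
    from loc[OF this m1 m2 x] obtain y where y: "y \<in> A \<union> S" "near G g x y" "\<alpha> y \<noteq> \<tau> y"
      by auto
    have "y \<notin> S" using y(3) e[of y] fun_cong[OF \<tau>(2), of y] by auto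
    then show ?thesis using y by blast
  qed
  show ?thesis unfolding TSSM_def
  proof (intro exI[of _ "2 * g + 2"] allI impI ballI)
    fix A B S \<alpha> \<beta> \<sigma>
    assume sub: "A \<subseteq> verts G" "B \<subseteq> verts G" "S \<subseteq> verts G" and fin: "finite A" "finite B" "finite S"
      and disj: "A \<inter> B = {}" "A \<inter> S = {}" "B \<inter> S = {}" and d: "enat (2 * g + 2) \<le> sdist G A B"
      and PiE: "\<alpha> \<in> A \<rightarrow>\<^sub>E verts H" "\<beta> \<in> B \<rightarrow>\<^sub>E verts H" "\<sigma> \<in> S \<rightarrow>\<^sub>E verts H"
      and a: "glue A \<alpha> \<sigma> \<in> language G H (A \<union> S)" and b: "glue S \<sigma> \<beta> \<in> language G H (S \<union> B)"
    have b': "glue S \<sigma> \<beta> \<in> language G H (B \<union> S)" using b by (simp add: Un_commute)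
    obtain \<omega>a where \<omega>a: "maximal_point G H r (A \<union> S) (glue A \<alpha> \<sigma>) \<omega>a" using ex[of "A \<union> S"] sub fin a by blast
    obtain \<omega>b where \<omega>b: "maximal_point G H r (B \<union> S) (glue S \<sigma> \<beta>) \<omega>b" using ex[of "B \<union> S"] sub fin b' by blast
    have ga: "glue A \<alpha> \<sigma> y = (if y \<in> A then \<alpha> y else \<sigma> y)" for y by (simp add: glue_def override_on_def)
    have gb: "glue S \<sigma> \<beta> y = (if y \<in> S then \<sigma> y else \<beta> y)" for y by (simp add: glue_def override_on_def)
    have ha: "\<omega>a \<in> homs G H" "restrict \<omega>a (A \<union> S) = glue A \<alpha> \<sigma>" using \<omega>a by (auto simp: maximal_point_def cylinder_def)
    have hb: "\<omega>b \<in> homs G H" "restrict \<omega>b (B \<union> S) = glue S \<sigma> \<beta>" using \<omega>b by (auto simp: maximal_point_def cylinder_def)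
    have va: "\<omega>a y = \<alpha> y" if "y \<in> A" for y
      using fun_cong[OF ha(2), of y] that by (simp add: ga)
    have vs: "\<omega>a y = \<sigma> y" "\<omega>b y = \<sigma> y" if "y \<in> S" for y
      using fun_cong[OF ha(2), of y] fun_cong[OF hb(2), of y] that disj by (auto simp: ga gb)
    have vb: "\<omega>b y = \<beta> y" if "y \<in> B" for y
      using fun_cong[OF hb(2), of y] that disj by (auto simp: gb)
    have "\<sigma> \<in> extensional S" using PiE(3) by (simp add: PiE_def)
    then have "\<sigma> \<in> language G H S" by (intro languageI[OF ha(1)]) (simp_all add: vs)
    then obtain \<tau> where \<tau>: "maximal_point G H r S \<sigma> \<tau>" using ex[of S] sub fin by blast
    have h\<tau>: "\<tau> \<in> homs G H" "restrict \<tau> S = \<sigma>" using \<tau> by (auto simp: maximal_point_def cylinder_def)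
    have da: "\<exists>y\<in>A. near G g x y" if "x \<in> verts G" "\<omega>a x \<noteq> \<tau> x" for x
      by (rule diff[OF sub(1,3) fin(1,3) \<tau> \<omega>a _ that]) (use disj in \<open>auto simp: ga\<close>)
    have db: "\<exists>y\<in>B. near G g x y" if "x \<in> verts G" "\<omega>b x \<noteq> \<tau> x" for x
      by (rule diff[OF sub(2,3) fin(2,3) \<tau> \<omega>b _ that]) (use disj in \<open>auto simp: gb\<close>)
    have far: False if "y \<in> A" "z \<in> B" "near G g x y" "near G (Suc g) x z" for x y z
    proof -
      have "near G (g + Suc g) y z" using near_trans[OF near_sym[OF that(3)] that(4)] .
      moreover have "g + Suc g < 2 * g + 2" by simp
      ultimately show False using d that(1,2) unfolding sdist_ge_iff by blast
    qed
    define P where "P x \<longleftrightarrow> (\<exists>y\<in>A. near G g x y)" for x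
    define \<omega> where "\<omega> = restrict (\<lambda>x. if P x then \<omega>a x else \<omega>b x) (verts G)"
    have "\<omega> \<in> homs G H" unfolding \<omega>_def
    proof (rule homs_restrictI)
      fix x assume "x \<in> verts G"
      then show "(if P x then \<omega>a x else \<omega>b x) \<in> verts H" using homsD(1) ha hb by metis
    next
      fix x y assume xy: "x \<in> verts G" "y \<in> verts G" "adj G x y"
      have mixed: "\<omega>b x = \<tau> x \<and> \<omega>a y = \<tau> y" if h: "P x" "\<not> P y" "adj G x y" "x \<in> verts G" "y \<in> verts G" for x y
      proof
        show "\<omega>a y = \<tau> y" using da[OF h(5)] h(2) by (auto simp: P_def)
        show "\<omega>b x = \<tau> x"
        proof (rule ccontr)
          assume "\<omega>b x \<noteq> \<tau> x"
          then obtain z where "z \<in> B" "near G g x z" using db[OF h(4)] by blast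
          then show False using h(1) far near_mono[of G g x z "Suc g"] by (auto simp: P_def)
        qed
      qed
      have mixed2: "\<omega>b y = \<tau> y" if P: "P x" and xy: "adj G x y" "x \<in> verts G" "y \<in> verts G" for x y
      proof (rule ccontr)
        assume "\<omega>b y \<noteq> \<tau> y"
        then obtain z where "z \<in> B" "near G g y z" using db[OF xy(3)] by blast
        then have "near G (Suc g) x z" using near_step[OF G xy(1)] by blast
        then show False using P far \<open>z \<in> B\<close> by (auto simp: P_def)
      qed
      have yx: "adj G y x" using xy adj_sym by metis
      show "adj H (if P x then \<omega>a x else \<omega>b x) (if P y then \<omega>a y else \<omega>b y)"
        using homsD(2)[OF ha(1) xy] homsD(2)[OF hb(1) xy]
          mixed[OF _ _ xy(3,1,2)] mixed2[OF _ xy(3,1,2)] mixed[OF _ _ yx xy(2,1)] mixed2[OF _ yx xy(2,1)]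
        by (cases "P x"; cases "P y") auto
    qed
    moreover have "\<omega> x = glue A \<alpha> (glue S \<sigma> \<beta>) x" if x: "x \<in> A \<union> S \<union> B" for x
    proof -
      have xG: "x \<in> verts G" using x sub by blast
      have "P x" if "x \<in> A" using that near_refl[OF xG] by (auto simp: P_def)
      moreover have "\<not> P x" if "x \<in> B" using that near_refl[OF xG] far by (auto simp: P_def)
      ultimately show ?thesis using x xG va vs vb disj
        by (auto simp: \<omega>_def glue_def override_on_def)
    qed
    moreover have "glue A \<alpha> (glue S \<sigma> \<beta>) \<in> extensional (A \<union> S \<union> B)"
      using PiE by (auto simp: glue_def override_on_def extensional_def PiE_def)
    ultimately show "glue A \<alpha> (glue S \<sigma> \<beta>) \<in> language G H (A \<union> S \<union> B)" by (rule languageI)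
  qed
qed

section \<open>Dismantlable graphs\<close>

text \<open>
  \<open>F k\<close> is the composition of the first \<open>k\<close> folds of a dismantling, which ends in the vertex \<open>s\<close>. Besides
  being homomorphisms, the maps \<open>F k\<close> and \<open>F (k + 1)\<close> send adjacent vertices to adjacent ones, so they
  can be used at neighbouring sites. The rank of a vertex is the time at which it is folded away;
  folding only increases it.
\<close>

definition folding_sequence ::
    "'v ugraph \<Rightarrow> nat \<Rightarrow> (nat \<Rightarrow> 'v \<Rightarrow> 'v) \<Rightarrow> 'v \<Rightarrow> ('v \<Rightarrow> nat) \<Rightarrow> bool" where
  "folding_sequence H n F s rank \<longleftrightarrow> s \<in> verts H \<and>
     (\<forall>k. \<forall>a\<in>verts H. F k a \<in> verts H) \<and> (\<forall>a\<in>verts H. F 0 a = a) \<and>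
     (\<forall>k\<ge>n. \<forall>a\<in>verts H. F k a = s) \<and>
     (\<forall>k. \<forall>a\<in>verts H. \<forall>b\<in>verts H. adj H a b \<longrightarrow> adj H (F k a) (F k b) \<and> adj H (F (Suc k) a) (F k b)) \<and>
     (\<forall>k. \<forall>a\<in>verts H. rank a \<le> rank (F k a)) \<and> (\<forall>a\<in>verts H. a \<noteq> s \<longrightarrow> rank a < rank s)"

lemma folding_sequenceD:
  assumes "folding_sequence H n F s rank"
  shows "s \<in> verts H"
    and "a \<in> verts H \<Longrightarrow> F k a \<in> verts H"
    and "a \<in> verts H \<Longrightarrow> F 0 a = a"
    and "a \<in> verts H \<Longrightarrow> n \<le> k \<Longrightarrow> F k a = s"
    and "a \<in> verts H \<Longrightarrow> b \<in> verts H \<Longrightarrow> adj H a b \<Longrightarrow> adj H (F k a) (F k b)"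
    and "a \<in> verts H \<Longrightarrow> b \<in> verts H \<Longrightarrow> adj H a b \<Longrightarrow> adj H (F (Suc k) a) (F k b)"
    and "a \<in> verts H \<Longrightarrow> rank a \<le> rank (F k a)"
    and "a \<in> verts H \<Longrightarrow> a \<noteq> s \<Longrightarrow> rank a < rank s"
  using assms by (auto simp: folding_sequence_def)

lemma folding_sequence_adj:
  assumes F: "folding_sequence H n F s rank"
    and ab: "a \<in> verts H" "b \<in> verts H" "adj H a b" and kl: "k \<le> Suc l" "l \<le> Suc k"
  shows "adj H (F k a) (F l b)"
proof -
  consider "k = l" | "k = Suc l" | "l = Suc k" using kl by linarith
  then show ?thesis
  proof cases
    case 1 then show ?thesis using folding_sequenceD(5)[OF F ab] by simp
  next
    case 2 then show ?thesis using folding_sequenceD(6)[OF F ab] by simp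
  next
    case 3
    then show ?thesis using adj_sym[OF folding_sequenceD(6)[OF F ab(2,1) adj_sym[OF ab(3)]]] by simp
  qed
qed

lemma dismantlable_imp_folding_sequence:
  fixes H :: "'v ugraph"
  assumes "dismantlable H"
  shows "\<exists>n F s rank. folding_sequence H n F s rank"
  using assms
proof (induction rule: dismantlable.induct)
  case (single H v)
  then have "folding_sequence H 0 (\<lambda>k a. v) v (\<lambda>a. 0)" by (auto simp: folding_sequence_def)
  then show ?case by blast
next
  case (fold H u v f)
  let ?H = "induced H (verts H - {u})"
  have vs: "verts ?H = verts H - {u}" by (auto simp: induced_def)
  have ad: "adj ?H a b \<longleftrightarrow> adj H a b \<and> a \<in> verts H - {u} \<and> b \<in> verts H - {u}" for a b
    by (auto simp: adj_def induced_def)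
  obtain n F s rank where F: "folding_sequence ?H n F s rank" using fold.IH by blast
  note FD = folding_sequenceD[OF F, unfolded vs ad]
  have s: "s \<in> verts H - {u}" by (rule FD(1))
  have Fa: "adj H (F k a) (F k b)" "adj H (F (Suc k) a) (F k b)"
    if "a \<in> verts H - {u}" "b \<in> verts H - {u}" "adj H a b" for k a b
    using FD(5)[OF that(1,2)] FD(6)[OF that(1,2)] that by blast+
  have u: "u \<in> verts H" and sub: "nbhd H u \<subseteq> nbhd H v" and fh: "f \<in> homs H ?H" and fu: "f u = v"
    and fw: "\<And>w. w \<in> verts H - {u} \<Longrightarrow> f w = w"
    using fold.hyps(1) by (auto simp: is_fold_def)
  have fv: "f a \<in> verts H - {u}" if "a \<in> verts H" for a using homsD(1)[OF fh that] vs by simp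
  have fa: "adj H (f a) (f b)" if "a \<in> verts H" "b \<in> verts H" "adj H a b" for a b
    using homsD(2)[OF fh that] ad by simp
  have fb: "adj H (f a) b" if "a \<in> verts H" "adj H a b" for a b
  proof (cases "a = u")
    case True
    then have "b \<in> nbhd H u" using that(2) adj_sym by (auto simp: nbhd_def)
    then have "b \<in> nbhd H v" using sub by blast
    then show ?thesis using True fu adj_sym by (auto simp: nbhd_def)
  next
    case False then show ?thesis using fw that by simp
  qed
  define F' where "F' k a = (case k of 0 \<Rightarrow> a | Suc j \<Rightarrow> F j (f a))" for k a
  define rank' where "rank' a = (if a = u then 0 else Suc (rank a))" for a
  have F's: "F' 0 a = a" "F' (Suc j) a = F j (f a)" for a j by (simp_all add: F'_def)
  have "folding_sequence H (Suc n) F' s rank'"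
    unfolding folding_sequence_def
  proof (intro conjI allI impI ballI)
    show "s \<in> verts H" using s by blast
  next
    fix k a assume a: "a \<in> verts H"
    show "F' k a \<in> verts H" using a FD(2)[OF fv[OF a]] by (cases k) (auto simp: F's)
  next
    fix a show "F' 0 a = a" by (simp add: F's)
  next
    fix k a assume k: "Suc n \<le> k" and a: "a \<in> verts H"
    then show "F' k a = s" using FD(4)[OF fv[OF a]] by (cases k) (auto simp: F's)
  next
    fix k a b assume ab: "a \<in> verts H" "b \<in> verts H" "adj H a b"
    show "adj H (F' k a) (F' k b)"
      using ab Fa[OF fv[OF ab(1)] fv[OF ab(2)] fa[OF ab]] by (cases k) (auto simp: F's)
    show "adj H (F' (Suc k) a) (F' k b)"
    proof (cases k)
      case 0
      then show ?thesis using fb[OF ab(1,3)] FD(3)[OF fv[OF ab(1)]] by (simp add: F's)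
    next
      case (Suc j)
      then show ?thesis using Fa(2)[OF fv[OF ab(1)] fv[OF ab(2)] fa[OF ab]] by (simp add: F's)
    qed
  next
    fix k a assume a: "a \<in> verts H"
    show "rank' a \<le> rank' (F' k a)"
    proof (cases "k = 0 \<or> a = u")
      case True then show ?thesis by (auto simp: F's rank'_def)
    next
      case False
      then obtain j where j: "k = Suc j" "a \<noteq> u" by (cases k) auto
      then show ?thesis using FD(2)[of a j] FD(7)[of a j] fw[of a] a by (auto simp: F's rank'_def)
    qed
  next
    fix a assume "a \<in> verts H" "a \<noteq> s"
    then show "rank' a < rank' s" using s FD(8) by (auto simp: rank'_def)
  qed
  then show ?case by blast
qed

text \<open>
  The distance from \<open>A\<close>, cut off at \<open>n\<close>. It changes by at most \<open>1\<close> between neighbours, so the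
  maps \<open>F k\<close> with \<open>k\<close> equal to the level, or to \<open>n\<close> minus the level, fit together.
\<close>

definition level :: "'x ugraph \<Rightarrow> nat \<Rightarrow> 'x set \<Rightarrow> 'x \<Rightarrow> nat" where
  "level G n A x = (LEAST k. k = n \<or> (\<exists>y\<in>A. near G k x y))"

lemma level_cases: "level G n A x = n \<or> (\<exists>y\<in>A. near G (level G n A x) x y)"
  unfolding level_def by (rule LeastI) (rule disjI1, rule refl)

lemma level_le: "level G n A x \<le> n"
  unfolding level_def by (rule Least_le) simp

lemma level_le_near: "near G k x y \<Longrightarrow> y \<in> A \<Longrightarrow> level G n A x \<le> k"
  unfolding level_def by (rule Least_le) blast

lemma level_lt: "level G n A x < n \<Longrightarrow> \<exists>y\<in>A. near G (level G n A x) x y"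
  using level_cases[of G n A x] by auto

lemma level_adj:
  assumes G: "ugraph G" and "adj G x y"
  shows "level G n A x \<le> Suc (level G n A y)"
proof (cases "level G n A y = n")
  case True then show ?thesis using level_le[of G n A x] by simp
next
  case False
  then obtain z where "z \<in> A" "near G (level G n A y) y z" using level_cases[of G n A y] by blast
  then show ?thesis using level_le_near near_step[OF assms] by metis
qed

lemma level_mem: "x \<in> A \<Longrightarrow> x \<in> verts G \<Longrightarrow> level G n A x = 0"
  using level_le_near[OF near_refl[of x G 0], of A n] by simp

text \<open>
  Apply \<open>F k\<close> to the first point at distance \<open>k\<close> from \<open>A\<close>, and to the second one at distance \<open>k\<close> from \<open>B\<close>. Far
  from both sets either recipe gives the constant \<open>s\<close>, so they fit together.
\<close>

lemma dismantlable_imp_strongly_irreducible: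
  fixes G :: "'x ugraph" and H :: "'v ugraph"
  assumes G: "ugraph G" and H: "dismantlable H"
  shows "strongly_irreducible G H"
proof -
  obtain n F s rank where FS: "folding_sequence H n F s rank"
    using dismantlable_imp_folding_sequence[OF H] by blast
  note Fv = folding_sequenceD(2)[OF FS] and F0 = folding_sequenceD(3)[OF FS]
    and Fn = folding_sequenceD(4)[OF FS] and Fkl = folding_sequence_adj[OF FS]
  define N where "N = Suc n"
  show ?thesis unfolding strongly_irreducible_def
  proof (intro exI[of _ "2 * N + 2"] allI impI ballI)
    fix A B \<alpha> \<beta>
    assume AB: "A \<subseteq> verts G" "B \<subseteq> verts G" "enat (2 * N + 2) \<le> sdist G A B"
      and \<alpha>: "\<alpha> \<in> language G H A" and \<beta>: "\<beta> \<in> language G H B"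
    obtain \<omega>1 where w1: "\<omega>1 \<in> homs G H" "\<And>x. x \<in> A \<Longrightarrow> \<omega>1 x = \<alpha> x" "\<alpha> \<in> extensional A"
      using languageE[OF \<alpha>] by blast
    obtain \<omega>2 where w2: "\<omega>2 \<in> homs G H" "\<And>x. x \<in> B \<Longrightarrow> \<omega>2 x = \<beta> x" "\<beta> \<in> extensional B"
      using languageE[OF \<beta>] by blast
    let ?a = "level G N A" and ?b = "level G N B"
    have far: "?b y = N" if h: "?a x < N" "near G 1 x y" for x y
    proof (rule ccontr)
      assume "?b y \<noteq> N"
      then have blt: "?b y < N" using level_le[of G N B y] by simp
      obtain q where q: "q \<in> B" "near G (?b y) y q" using level_lt[OF blt] by blast
      obtain p where p: "p \<in> A" "near G (?a x) x p" using level_lt[OF h(1)] by blast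
      have "near G (?a x + (1 + ?b y)) p q"
        using near_trans[OF near_sym[OF p(2)] near_trans[OF h(2) q(2)]] .
      moreover have "?a x + (1 + ?b y) < 2 * N + 2" using h(1) blt by simp
      ultimately show False using AB(3) p(1) q(1) unfolding sdist_ge_iff by blast
    qed
    define f where "f x = (if ?a x < N then F (?a x) (\<omega>1 x) else F (?b x) (\<omega>2 x))" for x
    have mixed: "adj H (f x) (f y)" if xy: "x \<in> verts G" "y \<in> verts G" "adj G x y"
      and c: "?a x < N" "\<not> ?a y < N" for x y
    proof -
      have "?b y = N" using far[OF c(1) near_1[OF G xy(3)]] .
      moreover have "F N (\<omega>2 y) = F N (\<omega>1 y)"
        using Fn[OF homsD(1)[OF w1(1) xy(2)], of N] Fn[OF homsD(1)[OF w2(1) xy(2)], of N]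
        by (simp add: N_def)
      ultimately have "f y = F N (\<omega>1 y)"
        using c(2) by (simp add: f_def)
      moreover have "?a y \<le> Suc (?a x)" using level_adj[OF G adj_sym[OF xy(3)]] .
      moreover have "?a y = N" using c(2) level_le[of G N A y] by simp
      ultimately show ?thesis
        using Fkl[OF homsD(1)[OF w1(1) xy(1)] homsD(1)[OF w1(1) xy(2)] homsD(2)[OF w1(1) xy], of "?a x" N] c
        by (simp add: f_def)
    qed
    have "restrict f (verts G) \<in> homs G H"
    proof (rule homs_restrictI)
      fix x assume "x \<in> verts G"
      then show "f x \<in> verts H"
        using Fv[OF homsD(1)[OF w1(1)]] Fv[OF homsD(1)[OF w2(1)]] by (simp add: f_def)
    next
      fix x y assume xy: "x \<in> verts G" "y \<in> verts G" "adj G x y"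
      have yx: "adj G y x" using adj_sym[OF xy(3)] .
      show "adj H (f x) (f y)"
      proof (cases "?a x < N"; cases "?a y < N")
        assume "?a x < N" "?a y < N"
        then show ?thesis
          using Fkl[OF homsD(1)[OF w1(1) xy(1)] homsD(1)[OF w1(1) xy(2)] homsD(2)[OF w1(1) xy],
              OF level_adj[OF G xy(3)] level_adj[OF G yx]] by (simp add: f_def)
      next
        assume "\<not> ?a x < N" "\<not> ?a y < N"
        then show ?thesis
          using Fkl[OF homsD(1)[OF w2(1) xy(1)] homsD(1)[OF w2(1) xy(2)] homsD(2)[OF w2(1) xy],
              OF level_adj[OF G xy(3)] level_adj[OF G yx]] by (simp add: f_def)
      next
        assume "?a x < N" "\<not> ?a y < N"
        then show ?thesis using mixed[OF xy] by blast
      next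
        assume "\<not> ?a x < N" "?a y < N"
        then have "adj H (f y) (f x)" using mixed[OF xy(2,1) yx] by blast
        then show ?thesis by (rule adj_sym)
      qed
    qed
    moreover have "restrict f (verts G) x = glue A \<alpha> \<beta> x" if x: "x \<in> A \<union> B" for x
    proof (cases "x \<in> A")
      case True
      then have xG: "x \<in> verts G" using AB by blast
      then have "f x = \<omega>1 x" using level_mem[OF True xG, of N] F0 homsD(1)[OF w1(1)] by (simp add: f_def N_def)
      then show ?thesis using True xG w1(2) by (simp add: glue_def override_on_def)
    next
      case False
      then have xB: "x \<in> B" and xG: "x \<in> verts G" using x AB by auto
      have b0: "?b x = 0" using level_mem[OF xB xG] .
      have "\<not> ?a x < N"
        using far[of x x] b0 near_refl[OF xG] by (auto simp: N_def)
      then have "f x = \<omega>2 x" using b0 F0 homsD(1)[OF w2(1) xG] by (simp add: f_def)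
      then show ?thesis using False xG w2(2)[OF xB] by (simp add: glue_def override_on_def)
    qed
    moreover have "glue A \<alpha> \<beta> \<in> extensional (A \<union> B)"
      using w1(3) w2(3) by (auto simp: glue_def override_on_def extensional_def)
    ultimately show "glue A \<alpha> \<beta> \<in> language G H (A \<union> B)" by (rule languageI)
  qed
qed

text \<open>
  Sites are pairs \<open>(v, n)\<close>, encoded as \<open>pt v n\<close>, and \<open>val\<close>, \<open>lev\<close> are the projections; \<open>(v, n)\<close> is joined to
  \<open>(w, n + 1)\<close> iff \<open>v \<sim> w\<close>. If a point equals \<open>val\<close> on layer \<open>n\<close>, its value at \<open>(v, n + 1)\<close> is adjacent to
  all neighbours of \<open>v\<close>, hence it is \<open>v\<close> as no vertex dominates another. So layer \<open>0\<close> forces all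
  layers, although at any given distance there are points, alternating between two adjacent vertices,
  that take another value. The board is one component of this graph, which need not be connected; a
  component contains all neighbours of its sites, which suffices for the argument.
\<close>

lemma stiff_not_strongly_irreducible:
  fixes H :: "'v ugraph"
  assumes uH: "ugraph H" and fin: "finite (verts H)"
    and two: "v1 \<in> verts H" "v2 \<in> verts H" "v1 \<noteq> v2"
    and stiff: "\<And>u v. u \<in> verts H \<Longrightarrow> v \<in> verts H \<Longrightarrow> nbhd H u \<subseteq> nbhd H v \<Longrightarrow> u = v"
  shows "\<exists>G :: nat ugraph. board G \<and> \<not> strongly_irreducible G H"
proof -
  let ?V = "verts H"
  obtain h :: "'v \<Rightarrow> nat" where h: "inj_on h ?V"
    using finite_imp_inj_to_nat_seg[OF fin] by blast
  define pt where "pt v n = prod_encode (h v, n)" for v n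
  define val where "val x = inv_into ?V h (fst (prod_decode x))" for x
  define lev where "lev x = snd (prod_decode x)" for x
  have vp: "val (pt v n) = v" if "v \<in> ?V" for v n using that h by (simp add: val_def pt_def)
  have lp: "lev (pt v n) = n" for v n by (simp add: lev_def pt_def)
  define P where "P = {pt v n | v n. v \<in> ?V}"
  have PV: "val x \<in> ?V" and Pp: "pt (val x) (lev x) = x" if "x \<in> P" for x
    using that vp lp by (auto simp: P_def)
  have ptP: "pt v n \<in> P" if "v \<in> ?V" for v n using that by (auto simp: P_def)
  define R where "R x y \<longleftrightarrow> x \<in> P \<and> y \<in> P \<and> adj H (val x) (val y) \<and> (lev y = Suc (lev x) \<or> lev x = Suc (lev y))" for x y
  have Rsym: "R y x" if "R x y" for x y using that adj_sym by (auto simp: R_def)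
  define x0 where "x0 = pt v1 0"
  define K where "K = {x. R\<^sup>*\<^sup>* x0 x}"
  have x0K: "x0 \<in> K" by (simp add: K_def)
  have KR: "y \<in> K" if "x \<in> K" "R x y" for x y using that by (auto simp: K_def)
  have KP: "x \<in> P" if "x \<in> K" for x
  proof -
    have "R\<^sup>*\<^sup>* x0 x" using that by (simp add: K_def)
    then show ?thesis by (cases rule: rtranclp.cases) (use ptP[OF two(1)] in \<open>auto simp: x0_def R_def\<close>)
  qed
  define G where "G = \<lparr>verts = K, edges = {{x, y} | x y. x \<in> K \<and> y \<in> K \<and> R x y}\<rparr>"
  have vG: "verts G = K" by (simp add: G_def)
  have aG: "adj G x y \<longleftrightarrow> x \<in> K \<and> y \<in> K \<and> R x y" for x y
    using Rsym by (auto simp: adj_def G_def doubleton_eq_iff)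
  have ex_nb: "\<exists>w\<in>?V. adj H v w" if v: "v \<in> ?V" for v
  proof (rule ccontr)
    assume n: "\<not> ?thesis"
    have "\<not> adj H w v" for w
      using n adj_sym[of H w v] adj_in_verts(1)[OF uH, of w v] by blast
    then have "nbhd H v \<subseteq> nbhd H w" for w by (auto simp: nbhd_def)
    then have "v = v1" "v = v2" using stiff[OF v] two by blast+
    then show False using two by blast
  qed
  have ugG: "ugraph G" by (auto simp: ugraph_def G_def)
  have lv: "\<exists>x\<in>K. lev x = m" for m
  proof (induction m)
    case 0 then show ?case using x0K lp by (auto simp: x0_def)
  next
    case (Suc m)
    then obtain x where x: "x \<in> K" "lev x = m" by blast
    obtain w where w: "w \<in> ?V" "adj H (val x) w" using ex_nb[OF PV[OF KP[OF x(1)]]] by blast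
    have "R x (pt w (Suc m))" using x KP w ptP by (auto simp: R_def vp lp)
    then show ?case using KR[OF x(1)] lp by blast
  qed
  have board: "board G"
  proof -
    have "linked G K x y" if "x \<in> K" "y \<in> K" for x y
    proof -
      have l: "linked G K x0 z" if "z \<in> K" for z
      proof -
        have "R\<^sup>*\<^sup>* x0 z" using that by (simp add: K_def)
        then show ?thesis
        proof (induction rule: rtranclp_induct)
          case base then show ?case by (simp add: linked_def)
        next
          case (step y z)
          have "y \<in> K" "z \<in> K" using step(1,2) by (auto simp: K_def)
          then show ?case using linked_trans[OF step(3) linked_adj[of G y z K]] step(2) by (simp add: aG)
        qed
      qed
      show ?thesis using linked_trans[OF linked_sym[OF l] l] that by blast
    qed
    then have "walks G x y \<noteq> {}" if "x \<in> K" "y \<in> K" for x y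
      using linked_imp_path_in[of G K x y] that by (force simp: path_in_def walks_def vG)
    then have "connected_graph G" using x0K by (auto simp: connected_graph_def vG)
    moreover have "finite (nbhd G x)" for x
    proof (rule finite_subset)
      show "nbhd G x \<subseteq> (\<lambda>(v, n). pt v n) ` (?V \<times> {..Suc (lev x)})"
      proof
        fix y assume "y \<in> nbhd G x"
        then have "R y x" by (simp add: nbhd_def aG)
        then have "y = pt (val y) (lev y)" "val y \<in> ?V" "lev y \<le> Suc (lev x)"
          using PV Pp by (auto simp: R_def)
        then show "y \<in> (\<lambda>(v, n). pt v n) ` (?V \<times> {..Suc (lev x)})" by force
      qed
    qed (use fin in auto)
    moreover have "loopless G" by (auto simp: loopless_def aG R_def)
    moreover have "\<exists>x\<in>verts G. \<exists>y\<in>verts G. x \<noteq> y"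
      using lv[of 0] lv[of 1] unfolding vG by (metis zero_neq_one)
    ultimately show ?thesis using ugG by (auto simp: board_def)
  qed
  have near_lev: "lev y \<le> lev x + k" if "near G k x y" for k x y
    using that
  proof (induction k arbitrary: x)
    case 0 then show ?case by (simp add: near_0)
  next
    case (Suc k)
    show ?case
    proof (cases "near G k x y")
      case True then show ?thesis using Suc.IH[OF True] by simp
    next
      case False
      then obtain z where "adj G x z" "near G k z y" using Suc.prems by (auto simp: near_Suc)
      then show ?thesis using Suc.IH[of z] by (auto simp: aG R_def)
    qed
  qed
  define A where "A = {x\<in>K. lev x = 0}"
  have finA: "finite A"
  proof (rule finite_subset)
    show "A \<subseteq> (\<lambda>v. pt v 0) ` ?V"
    proof
      fix x assume "x \<in> A"
      then have "x \<in> P" "lev x = 0" using KP by (auto simp: A_def)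
      then show "x \<in> (\<lambda>v. pt v 0) ` ?V" using PV[of x] Pp[of x] by (metis image_eqI)
    qed
  qed (use fin in auto)
  have \<phi>: "restrict val K \<in> homs G H"
    using homs_restrictI[of G val H] PV KP by (auto simp: vG aG R_def)
  have forced: "\<omega> x = val x" if \<omega>: "\<omega> \<in> homs G H" "\<And>y. y \<in> A \<Longrightarrow> \<omega> y = val y" and x: "x \<in> K" for \<omega> x
    using x
  proof (induction "lev x" arbitrary: x)
    case 0 then show ?case using \<omega>(2) by (auto simp: A_def)
  next
    case (Suc n)
    have xP: "x \<in> P" using KP Suc by blast
    have "nbhd H (val x) \<subseteq> nbhd H (\<omega> x)"
    proof
      fix w assume "w \<in> nbhd H (val x)"
      then have w: "adj H (val x) w" "w \<in> ?V" using adj_sym adj_in_verts[OF uH] by (auto simp: nbhd_def)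
      have R: "R x (pt w n)" using Suc(2) xP w ptP by (auto simp: R_def vp lp)
      then have k: "pt w n \<in> K" using KR Suc.prems by blast
      then have "\<omega> (pt w n) = w" using Suc(1)[of "pt w n"] lp vp w by auto
      moreover have "adj H (\<omega> x) (\<omega> (pt w n))"
        using homsD(2)[OF \<omega>(1), of x "pt w n"] R k Suc.prems by (simp add: vG aG)
      ultimately show "w \<in> nbhd H (\<omega> x)" using adj_sym by (auto simp: nbhd_def)
    qed
    then show ?case using stiff[of "val x" "\<omega> x"] PV[OF xP] homsD(1)[OF \<omega>(1), of x] Suc.prems
      by (simp add: vG)
  qed
  have "\<not> strongly_irreducible G H"
  proof
    assume "strongly_irreducible G H"
    then obtain g where g: "\<And>A B \<alpha> \<beta>. A \<subseteq> verts G \<Longrightarrow> B \<subseteq> verts G \<Longrightarrow> finite A \<Longrightarrow> finite B \<Longrightarrow>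
        A \<noteq> {} \<Longrightarrow> B \<noteq> {} \<Longrightarrow> A \<inter> B = {} \<Longrightarrow> sdist G A B \<ge> enat g \<Longrightarrow>
        \<alpha>\<in>language G H A \<Longrightarrow> \<beta>\<in>language G H B \<Longrightarrow> glue A \<alpha> \<beta> \<in> language G H (A \<union> B)"
        unfolding strongly_irreducible_def
      apply (elim exE)
      subgoal premises p for g
        by (rule p(1)[of g], rule p(2)[rule_format])
      done
    obtain b where b: "b \<in> K" "lev b = Suc g" using lv by blast
    obtain a where a: "a \<in> ?V" "a \<noteq> val b" using two by metis
    obtain a' where a': "a' \<in> ?V" "adj H a a'" using ex_nb[OF a(1)] by blast
    define \<omega>' where "\<omega>' = restrict (\<lambda>x. if even (lev x) = even (lev b) then a else a') K"
    have "restrict (\<lambda>x. if even (lev x) = even (lev b) then a else a') (verts G) \<in> homs G H"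
    proof (rule homs_restrictI)
      fix x y assume "adj G x y"
      then have "even (lev x) \<noteq> even (lev y)" by (auto simp: aG R_def)
      then show "adj H (if even (lev x) = even (lev b) then a else a') (if even (lev y) = even (lev b) then a else a')"
        using a'(2) adj_sym[OF a'(2)] by auto
    qed (use a a' in auto)
    then have \<omega>': "\<omega>' \<in> homs G H" by (simp add: \<omega>'_def vG)
    have l1: "restrict (restrict val K) A \<in> language G H A" unfolding language_def using \<phi> by (rule imageI)
    have l2: "restrict \<omega>' {b} \<in> language G H {b}" unfolding language_def using \<omega>' by (rule imageI)
    have dist: "enat g \<le> sdist G A {b}"
      unfolding sdist_ge_iff using near_lev b by (fastforce simp: A_def)
    have "glue A (restrict (restrict val K) A) (restrict \<omega>' {b}) \<in> language G H (A \<union> {b})"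
      using g[OF _ _ finA _ _ _ _ dist l1 l2] b x0K lp by (auto simp: A_def vG x0_def)
    then obtain \<omega> where \<omega>: "\<omega> \<in> homs G H"
      "\<And>x. x \<in> A \<union> {b} \<Longrightarrow> \<omega> x = glue A (restrict (restrict val K) A) (restrict \<omega>' {b}) x"
      using languageE by blast
    have bA: "b \<notin> A" using b by (simp add: A_def)
    have "\<omega> x = val x" if "x \<in> A" for x using \<omega>(2)[of x] that by (auto simp: glue_def override_on_def A_def)
    then have "\<omega> b = val b" using forced[OF \<omega>(1)] b by blast
    moreover have "\<omega> b = a" using \<omega>(2)[of b] bA b by (simp add: glue_def override_on_def \<omega>'_def)
    ultimately show False using a by simp
  qed
  then show ?thesis using board by blast
qed

text \<open>
  Configurations with values in the smaller graph can be joined in \<open>H\<close>, and composing with the fold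
  brings the result back without changing them.
\<close>

lemma strongly_irreducible_fold:
  assumes f: "is_fold H u v f" and SI: "strongly_irreducible G H"
  shows "strongly_irreducible G (induced H (verts H - {u}))"
proof -
  let ?H = "induced H (verts H - {u})"
  have ad: "adj ?H a b \<longleftrightarrow> adj H a b \<and> a \<in> verts H - {u} \<and> b \<in> verts H - {u}" and vs: "verts ?H = verts H - {u}" for a b
    by (auto simp: adj_def induced_def)
  have fh: "f \<in> homs H ?H" and fw: "\<And>w. w \<in> verts H - {u} \<Longrightarrow> f w = w" using f by (auto simp: is_fold_def)
  have inc: "\<omega> \<in> homs G H" if "\<omega> \<in> homs G ?H" for \<omega>
    using homsD[OF that] by (intro homsI) (auto simp: ad vs)
  have lin: "\<alpha> \<in> language G H A" if "\<alpha> \<in> language G ?H A" for \<alpha> A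
    using that inc by (auto simp: language_def)
  have ret: "\<alpha> \<in> language G ?H A"
    if \<alpha>: "\<alpha> \<in> language G H A" and V: "\<And>x. x \<in> A \<Longrightarrow> \<alpha> x \<in> verts ?H" and A: "A \<subseteq> verts G" for \<alpha> A
  proof -
    obtain \<omega> where \<omega>: "\<omega> \<in> homs G H" "\<And>x. x \<in> A \<Longrightarrow> \<omega> x = \<alpha> x" "\<alpha> \<in> extensional A"
      using languageE[OF \<alpha>] by blast
    have "restrict (\<lambda>x. f (\<omega> x)) (verts G) \<in> homs G ?H"
      using homsD[OF \<omega>(1)] homsD[OF fh] by (intro homs_restrictI) auto
    moreover have "restrict (\<lambda>x. f (\<omega> x)) (verts G) x = \<alpha> x" if "x \<in> A" for x
      using that A V[OF that] \<omega>(2)[OF that] fw by (auto simp: vs)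
    ultimately show ?thesis using \<omega>(3) by (rule languageI)
  qed
  obtain g where g: "\<And>A B \<alpha> \<beta>. A \<subseteq> verts G \<Longrightarrow> B \<subseteq> verts G \<Longrightarrow> finite A \<Longrightarrow> finite B \<Longrightarrow>
        A \<noteq> {} \<Longrightarrow> B \<noteq> {} \<Longrightarrow> A \<inter> B = {} \<Longrightarrow> sdist G A B \<ge> enat g \<Longrightarrow>
        \<alpha>\<in>language G H A \<Longrightarrow> \<beta>\<in>language G H B \<Longrightarrow> glue A \<alpha> \<beta> \<in> language G H (A \<union> B)"
    using SI unfolding strongly_irreducible_def
    apply (elim exE)
    subgoal premises p for g
      by (rule p(1)[of g], rule p(2)[rule_format])
    done
  have vals: "\<alpha> x \<in> verts ?H" if "\<alpha> \<in> language G ?H A" "x \<in> A" "A \<subseteq> verts G" for \<alpha> A x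
    using that homsD(1) by (force simp: language_def)
  show ?thesis unfolding strongly_irreducible_def
  proof (intro exI[of _ g] allI impI ballI)
    fix A B \<alpha> \<beta>
    assume AB: "A \<subseteq> verts G" "B \<subseteq> verts G" "finite A" "finite B" "A \<noteq> {}" "B \<noteq> {}" "A \<inter> B = {}" "enat g \<le> sdist G A B"
      and l: "\<alpha> \<in> language G ?H A" "\<beta> \<in> language G ?H B"
    show "glue A \<alpha> \<beta> \<in> language G ?H (A \<union> B)"
      using g[OF AB lin[OF l(1)] lin[OF l(2)]] vals[OF l(1)] vals[OF l(2)] AB
      by (intro ret) (auto simp: glue_def override_on_def)
  qed
qed

text \<open>
  Fold as long as possible. The process can only stop at a single vertex, since a larger graph without
  folds is not strongly irreducible on some board.
\<close>

lemma strongly_irreducible_imp_dismantlable: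
  fixes H :: "'v ugraph"
  assumes H: "constraint_graph H" and "every_board (\<lambda>G. strongly_irreducible G H)"
  shows "dismantlable H"
  using assms
proof (induction "card (verts H)" arbitrary: H rule: less_induct)
  case less
  have uH: "ugraph H" and fin: "finite (verts H)" and ne: "verts H \<noteq> {}"
    using less.prems by (auto simp: constraint_graph_def)
  show ?case
  proof (cases "\<exists>v. verts H = {v}")
    case True
    then obtain v where "verts H = {v}" ..
    then show ?thesis by (rule dismantlable.single)
  next
    case False
    obtain v1 where v1: "v1 \<in> verts H" using ne by blast
    obtain v2 where v2: "v2 \<in> verts H" "v2 \<noteq> v1" using False v1 by blast
    have "\<exists>u\<in>verts H. \<exists>v\<in>verts H. nbhd H u \<subseteq> nbhd H v \<and> u \<noteq> v"
    proof (rule ccontr)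
      assume n: "\<not> ?thesis"
      then obtain G :: "nat ugraph" where "board G" "\<not> strongly_irreducible G H"
        using stiff_not_strongly_irreducible[OF uH fin v1 v2(1)] v2(2) by metis
      then show False using less.prems(2) by (auto simp: every_board_def)
    qed
    then obtain u v where uv: "u \<in> verts H" "v \<in> verts H" "nbhd H u \<subseteq> nbhd H v" "u \<noteq> v" by blast
    let ?H = "induced H (verts H - {u})"
    define f where "f = restrict (\<lambda>w. if w = u then v else w) (verts H)"
    have uv': "adj H v w" if "adj H u w" for w
      using that uv(3) adj_sym by (fastforce simp: nbhd_def)
    have "f \<in> homs H ?H" unfolding f_def
    proof (rule homs_restrictI)
      fix w assume "w \<in> verts H"
      then show "(if w = u then v else w) \<in> verts ?H" using uv by (auto simp: induced_def)
    next
      fix a b assume ab: "a \<in> verts H" "b \<in> verts H" "adj H a b"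
      have "adj H (if a = u then v else a) (if b = u then v else b)"
      proof (cases "a = u"; cases "b = u")
        assume e: "a = u" "b = u"
        then have "adj H u u" using ab(3) by simp
        have "adj H u v" by (rule adj_sym[OF uv'[OF \<open>adj H u u\<close>]])
        then have "adj H v v" by (rule uv')
        then show ?thesis using e by simp
      next
        assume e: "a = u" "b \<noteq> u"
        then show ?thesis using uv' ab(3) by simp
      next
        assume e: "a \<noteq> u" "b = u"
        then have "adj H v a" using uv' adj_sym[OF ab(3)] by simp
        then show ?thesis using e adj_sym[of H v a] by simp
      qed (use ab in simp)
      then show "adj ?H (if a = u then v else a) (if b = u then v else b)"
        using ab uv by (auto simp: adj_def induced_def)
    qed
    then have fold: "is_fold H u v f" using uv by (auto simp: is_fold_def f_def)
    have sub: "constraint_graph ?H"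
      unfolding constraint_graph_def
    proof (intro conjI)
      show "ugraph ?H" unfolding ugraph_def
      proof
        fix e assume "e \<in> edges ?H"
        then have e: "e \<in> edges H" "e \<subseteq> verts H - {u}" by (auto simp: induced_def)
        then obtain a b where "e = {a, b}" using uH by (auto simp: ugraph_def)
        then show "\<exists>u'\<in>verts ?H. \<exists>v\<in>verts ?H. e = {u', v}" using e by (auto simp: induced_def)
      qed
      show "finite (verts ?H)" "verts ?H \<noteq> {}" using fin uv by (auto simp: induced_def)
    qed
    have "verts ?H = verts H - {u}" by (auto simp: induced_def)
    then have "card (verts ?H) < card (verts H)" using card_Diff1_less[OF fin uv(1)] by simp
    moreover have "every_board (\<lambda>G. strongly_irreducible G ?H)"
      using less.prems(2) strongly_irreducible_fold[OF fold] unfolding every_board_def by blast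
    ultimately have "dismantlable ?H" using less.hyps sub by blast
    then show ?thesis by (rule dismantlable.fold[OF fold])
  qed
qed

section \<open>Gibbs specifications that favour vertices of high rank\<close>

definition bias :: "real \<Rightarrow> ('v \<Rightarrow> nat) \<Rightarrow> 'v + 'v set \<Rightarrow> real" where
  "bias c rank p = (case p of Inl v \<Rightarrow> - c * real (rank v) | Inr e \<Rightarrow> 0)"

text \<open>
  The Boltzmann factor of the interaction \<open>bias c rank\<close>; it does not depend on the boundary condition.
\<close>

definition weight :: "real \<Rightarrow> ('v \<Rightarrow> nat) \<Rightarrow> 'x set \<Rightarrow> ('x \<Rightarrow> 'v) \<Rightarrow> real" where
  "weight c rank A \<alpha> = exp (c * (\<Sum>x\<in>A. real (rank (\<alpha> x))))"

lemma weight_pos: "weight c rank A \<alpha> > 0"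
  by (simp add: weight_def)

lemma exp_energy_bias: "exp (- energy G (bias c rank) A \<omega> \<alpha>) = weight c rank A \<alpha>"
proof -
  have "energy G (bias c rank) A \<omega> \<alpha> = - (c * (\<Sum>x\<in>A. real (rank (\<alpha> x))))"
    by (simp add: energy_def bias_def sum_distrib_left sum_negf)
  then show ?thesis by (simp add: weight_def)
qed

lemma interaction_bias: "0 \<le> c \<Longrightarrow> interaction H (bias c rank)"
  by (auto simp: interaction_def bias_def)

lemma glue_apply: "glue A \<alpha> \<omega> x = (if x \<in> A then \<alpha> x else \<omega> x)"
  by (simp add: glue_def override_on_def)

lemma mem_compatible_iff:
  assumes "A \<subseteq> verts G"
  shows "\<alpha> \<in> compatible G H A \<omega> \<longleftrightarrow> \<alpha> \<in> extensional A \<and> glue A \<alpha> \<omega> \<in> homs G H"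
proof -
  have "\<alpha> \<in> language G H A" if "\<alpha> \<in> extensional A" "glue A \<alpha> \<omega> \<in> homs G H"
    by (rule languageI[OF that(2) _ that(1)]) (simp add: glue_apply)
  moreover have "\<alpha> \<in> extensional A" if "\<alpha> \<in> language G H A" using that languageE by metis
  ultimately show ?thesis by (auto simp: compatible_def)
qed

lemma finite_language: "finite A \<Longrightarrow> A \<subseteq> verts G \<Longrightarrow> finite (verts H) \<Longrightarrow> finite (language G H A)"
  by (rule finite_subset[of _ "A \<rightarrow>\<^sub>E verts H"]) (auto simp: language_def homs_def intro: finite_PiE)

lemma finite_compatible: "finite A \<Longrightarrow> A \<subseteq> verts G \<Longrightarrow> finite (verts H) \<Longrightarrow> finite (compatible G H A \<omega>)"
  by (rule finite_subset[OF _ finite_language]) (auto simp: compatible_def)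

text \<open>
  Compatibility only involves the values on \<open>A\<close> and its boundary, so outside of these the point \<open>\<zeta>\<close> may be
  exchanged for \<open>\<omega>\<close>.
\<close>

lemma restrict_mem_compatible:
  assumes G: "ugraph G" and A: "A \<subseteq> verts G" and \<zeta>: "\<zeta> \<in> homs G H" and \<omega>: "\<omega> \<in> homs G H"
    and eq: "\<And>y. y \<in> boundary G A \<Longrightarrow> \<zeta> y = \<omega> y"
  shows "restrict \<zeta> A \<in> compatible G H A \<omega>"
proof -
  have "glue A (restrict \<zeta> A) \<omega> \<in> homs G H"
  proof (rule homsI)
    fix x assume "x \<in> verts G"
    then show "glue A (restrict \<zeta> A) \<omega> x \<in> verts H"
      using homsD(1)[OF \<zeta>] homsD(1)[OF \<omega>] by (simp add: glue_apply)
  next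
    fix x y assume xy: "x \<in> verts G" "y \<in> verts G" "adj G x y"
    have b: "\<zeta> v = \<omega> v" if "u \<in> A" "v \<notin> A" "adj G u v" for u v
      using that mem_boundary_iff[OF G A] adj_sym[OF that(3)] by (intro eq) blast
    show "adj H (glue A (restrict \<zeta> A) \<omega> x) (glue A (restrict \<zeta> A) \<omega> y)"
      using homsD(2)[OF \<zeta> xy] homsD(2)[OF \<omega> xy] b[of x y] b[of y x] xy(3) adj_sym[OF xy(3)]
      by (cases "x \<in> A"; cases "y \<in> A") (simp_all add: glue_apply)
  next
    show "glue A (restrict \<zeta> A) \<omega> \<in> extensional (verts G)"
      using homsD(3)[OF \<omega>] A by (auto simp: glue_apply extensional_def)
  qed
  then show ?thesis unfolding mem_compatible_iff[OF A] by simp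
qed

lemma marginal_bias:
  assumes A: "finite A" "A \<subseteq> verts G" and H: "finite (verts H)"
  shows "marginal G H (gibbs G H (bias c rank)) A \<omega> B \<beta> =
    (\<Sum>\<alpha>\<in>{\<alpha> \<in> compatible G H A \<omega>. restrict \<alpha> B = \<beta>}. weight c rank A \<alpha>) /
    (\<Sum>\<alpha>\<in>compatible G H A \<omega>. weight c rank A \<alpha>)"
proof -
  have sub: "compatible G H A \<omega> \<subseteq> language G H A" by (auto simp: compatible_def)
  have "marginal G H (gibbs G H (bias c rank)) A \<omega> B \<beta> =
    (\<Sum>\<alpha>\<in>{\<alpha> \<in> compatible G H A \<omega>. restrict \<alpha> B = \<beta>}. gibbs G H (bias c rank) A \<omega> \<alpha>)"
    unfolding marginal_def
    by (rule sum.mono_neutral_right) (use finite_language[OF A H] sub in \<open>auto simp: gibbs_def\<close>)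
  also have "\<dots> = (\<Sum>\<alpha>\<in>{\<alpha> \<in> compatible G H A \<omega>. restrict \<alpha> B = \<beta>}.
      weight c rank A \<alpha> / (\<Sum>\<alpha>\<in>compatible G H A \<omega>. weight c rank A \<alpha>))"
    by (rule sum.cong) (auto simp: gibbs_def exp_energy_bias)
  finally show ?thesis by (simp add: sum_divide_distrib)
qed

text \<open>
  Raising a configuration that differs from \<open>\<theta>\<close> on all of \<open>Q\<close> multiplies its weight by at least
  \<open>e\<^sup>c\<close> to the power \<open>|Q|\<close>, whereas a configuration arises from at most \<open>|V|\<close> to the power \<open>|Y|\<close> others,
  \<open>Y\<close> being the set of sites that may change.
\<close>

lemma peierls_bound:
  fixes rank :: "'v \<Rightarrow> nat" and A :: "'x set"
  assumes c: "0 \<le> c" and A: "finite A" and V: "finite V" and C: "finite C" "C \<subseteq> A \<rightarrow>\<^sub>E V"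
    and Q: "Q \<subseteq> A" and Y: "card Y \<le> D * card Q" "finite Y"
    and raise: "\<And>\<alpha>. \<alpha> \<in> C \<Longrightarrow> \<exists>\<alpha>'\<in>C. (\<forall>x\<in>A - Y. \<alpha>' x = \<alpha> x) \<and> (\<forall>x\<in>A. rank (\<alpha> x) \<le> rank (\<alpha>' x)) \<and>
       (\<forall>x\<in>Q. \<alpha> x \<noteq> \<theta> x \<longrightarrow> rank (\<alpha> x) < rank (\<alpha>' x))"
    and V0: "V \<noteq> {}"
  shows "(\<Sum>\<alpha>\<in>{\<alpha>\<in>C. \<forall>x\<in>Q. \<alpha> x \<noteq> \<theta> x}. weight c rank A \<alpha>)
    \<le> (real (card V ^ D) / exp c) ^ card Q * (\<Sum>\<alpha>\<in>C. weight c rank A \<alpha>)"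
proof -
  let ?w = "weight c rank A"
  let ?S = "{\<alpha>\<in>C. \<forall>x\<in>Q. \<alpha> x \<noteq> \<theta> x}"
  have "\<forall>\<alpha>\<in>C. \<exists>\<alpha>'. \<alpha>' \<in> C \<and> (\<forall>x\<in>A - Y. \<alpha>' x = \<alpha> x) \<and> (\<forall>x\<in>A. rank (\<alpha> x) \<le> rank (\<alpha>' x)) \<and>
       (\<forall>x\<in>Q. \<alpha> x \<noteq> \<theta> x \<longrightarrow> rank (\<alpha> x) < rank (\<alpha>' x))"
    using raise by blast
  then obtain T where T: "\<forall>\<alpha>\<in>C. T \<alpha> \<in> C \<and> (\<forall>x\<in>A - Y. T \<alpha> x = \<alpha> x) \<and> (\<forall>x\<in>A. rank (\<alpha> x) \<le> rank (T \<alpha> x)) \<and>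
       (\<forall>x\<in>Q. \<alpha> x \<noteq> \<theta> x \<longrightarrow> rank (\<alpha> x) < rank (T \<alpha> x))"
    by (rule bchoice[THEN exE])
  have le: "?w \<alpha> \<le> ?w (T \<alpha>) / exp c ^ card Q" if "\<alpha> \<in> ?S" for \<alpha>
  proof -
    have "(\<Sum>x\<in>A. real (rank (\<alpha> x))) + real (card Q) = (\<Sum>x\<in>A. real (rank (\<alpha> x)) + (if x \<in> Q then 1 else 0))"
      using A Q by (simp add: sum.distrib sum.If_cases Int_absorb1)
    also have "\<dots> \<le> (\<Sum>x\<in>A. real (rank (T \<alpha> x)))"
    proof (rule sum_mono)
      fix x assume x: "x \<in> A"
      have 1: "rank (\<alpha> x) \<le> rank (T \<alpha> x)" using T that x by blast
      have 2: "rank (\<alpha> x) < rank (T \<alpha> x)" if "x \<in> Q" using T \<open>\<alpha> \<in> ?S\<close> that by blast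
      show "real (rank (\<alpha> x)) + (if x \<in> Q then 1 else 0) \<le> real (rank (T \<alpha> x))"
        using 1 2 by (cases "x \<in> Q") auto
    qed
    finally have s: "(\<Sum>x\<in>A. real (rank (\<alpha> x))) + real (card Q) \<le> (\<Sum>x\<in>A. real (rank (T \<alpha> x)))" .
    have "?w \<alpha> * exp c ^ card Q = exp (c * ((\<Sum>x\<in>A. real (rank (\<alpha> x))) + real (card Q)))"
      by (simp add: weight_def exp_add[symmetric] exp_of_nat_mult[symmetric] algebra_simps)
    also have "\<dots> \<le> ?w (T \<alpha>)" unfolding weight_def using s c by (simp add: mult_left_mono)
    finally show ?thesis by (simp add: pos_le_divide_eq)
  qed
  have fiber: "real (card {\<alpha>\<in>?S. T \<alpha> = \<alpha>'}) \<le> real (card V ^ D) ^ card Q" for \<alpha>'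
  proof -
    let ?F = "{\<alpha>\<in>?S. T \<alpha> = \<alpha>'}"
    have "inj_on (\<lambda>\<alpha>. restrict \<alpha> (A \<inter> Y)) ?F"
    proof (rule inj_onI)
      fix \<alpha> \<alpha>2 assume a: "\<alpha> \<in> ?F" "\<alpha>2 \<in> ?F" and e: "restrict \<alpha> (A \<inter> Y) = restrict \<alpha>2 (A \<inter> Y)"
      have ext: "\<alpha> \<in> extensional A" "\<alpha>2 \<in> extensional A" using a C(2) by (auto simp: PiE_def)
      show "\<alpha> = \<alpha>2"
      proof (rule extensionalityI[OF ext])
        fix x assume x: "x \<in> A"
        show "\<alpha> x = \<alpha>2 x"
        proof (cases "x \<in> Y")
          case True then show ?thesis using fun_cong[OF e, of x] x by simp
        next
          case False
          then have xY: "x \<in> A - Y" using x by simp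
          have C12: "\<alpha> \<in> C" "\<alpha>2 \<in> C" and TT: "T \<alpha> = T \<alpha>2" using a by simp_all
          show ?thesis
            using bspec[OF bspec[OF T C12(1), THEN conjunct2, THEN conjunct1] xY]
              bspec[OF bspec[OF T C12(2), THEN conjunct2, THEN conjunct1] xY] TT by simp
        qed
      qed
    qed
    moreover have "(\<lambda>\<alpha>. restrict \<alpha> (A \<inter> Y)) ` ?F \<subseteq> (A \<inter> Y) \<rightarrow>\<^sub>E V"
    proof (rule image_subsetI)
      fix \<alpha> assume "\<alpha> \<in> ?F"
      then have "\<alpha> \<in> A \<rightarrow>\<^sub>E V" using C(2) by blast
      then have "\<alpha> x \<in> V" if "x \<in> A" for x using that by (rule PiE_mem)
      then show "restrict \<alpha> (A \<inter> Y) \<in> (A \<inter> Y) \<rightarrow>\<^sub>E V" by simp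
    qed
    moreover have "finite ((A \<inter> Y) \<rightarrow>\<^sub>E V)" using A V by (simp add: finite_PiE)
    ultimately have "card ?F \<le> card ((A \<inter> Y) \<rightarrow>\<^sub>E V)" by (rule card_inj_on_le)
    also have "\<dots> = card V ^ card (A \<inter> Y)" using A by (simp add: card_PiE)
    also have "\<dots> \<le> card V ^ (D * card Q)"
    proof (rule power_increasing)
      show "card (A \<inter> Y) \<le> D * card Q" using card_mono[OF Y(2), of "A \<inter> Y"] Y(1) by simp
      show "1 \<le> card V" using V V0 by (simp add: Suc_le_eq card_gt_0_iff)
    qed
    finally have "card ?F \<le> (card V ^ D) ^ card Q" unfolding power_mult .
    then have "real (card ?F) \<le> real ((card V ^ D) ^ card Q)" by (rule of_nat_mono)
    then show ?thesis by (simp only: of_nat_power)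
  qed
  have finS: "finite ?S" using C(1) by simp
  have "(\<Sum>\<alpha>\<in>?S. ?w \<alpha>) \<le> (\<Sum>\<alpha>\<in>?S. ?w (T \<alpha>) / exp c ^ card Q)"
    by (rule sum_mono) (rule le)
  also have "\<dots> = (\<Sum>\<alpha>'\<in>C. \<Sum>\<alpha>\<in>{\<alpha>\<in>?S. T \<alpha> = \<alpha>'}. ?w (T \<alpha>) / exp c ^ card Q)"
    by (rule sum.group[symmetric, OF finS C(1)]) (use T in blast)
  also have "\<dots> = (\<Sum>\<alpha>'\<in>C. real (card {\<alpha>\<in>?S. T \<alpha> = \<alpha>'}) * (?w \<alpha>' / exp c ^ card Q))"
    by (rule sum.cong[OF refl]) simp
  also have "\<dots> \<le> (\<Sum>\<alpha>'\<in>C. real (card V ^ D) ^ card Q * (?w \<alpha>' / exp c ^ card Q))"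
    by (intro sum_mono mult_right_mono fiber) (simp add: less_imp_le[OF weight_pos])
  also have "\<dots> = (real (card V ^ D) / exp c) ^ card Q * (\<Sum>\<alpha>\<in>C. ?w \<alpha>)"
    by (simp add: sum_distrib_left power_divide)
  finally show ?thesis .
qed

definition walks_from :: "'x ugraph \<Rightarrow> nat \<Rightarrow> 'x \<Rightarrow> 'x list set" where
  "walks_from G n x = {p. length p = Suc n \<and> hd p = x \<and> set p \<subseteq> verts G \<and> successively (adj G) p}"

lemma walks_from_bound:
  assumes "\<forall>x\<in>verts G. finite (nbhd G x) \<and> card (nbhd G x) \<le> d"
  shows "finite (walks_from G n x) \<and> card (walks_from G n x) \<le> d ^ n"
proof (induction n arbitrary: x)
  case 0
  have "walks_from G 0 x \<subseteq> {[x]}" by (auto simp: walks_from_def length_Suc_conv)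
  then show ?case using finite_subset card_mono[of "{[x]}"] by fastforce
next
  case (Suc n)
  show ?case
  proof (cases "x \<in> verts G")
    case False
    then have "walks_from G (Suc n) x = {}" by (auto simp: walks_from_def length_Suc_conv)
    then show ?thesis by simp
  next
    case True
    have sub: "walks_from G (Suc n) x \<subseteq> (\<Union>y\<in>nbhd G x. (#) x ` walks_from G n y)"
    proof
      fix p assume p: "p \<in> walks_from G (Suc n) x"
      then obtain y q where q: "p = x # y # q" by (auto simp: walks_from_def length_Suc_conv)
      then have "y # q \<in> walks_from G n y" "y \<in> nbhd G x"
        using p adj_sym[of G x y] by (auto simp: walks_from_def nbhd_def)
      then show "p \<in> (\<Union>y\<in>nbhd G x. (#) x ` walks_from G n y)" using q by blast
    qed
    have N: "finite (nbhd G x)" "card (nbhd G x) \<le> d" using assms True by auto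
    have f: "finite (\<Union>y\<in>nbhd G x. (#) x ` walks_from G n y)" using N Suc by blast
    have "card (walks_from G (Suc n) x) \<le> card (\<Union>y\<in>nbhd G x. (#) x ` walks_from G n y)"
      by (rule card_mono[OF f sub])
    also have "\<dots> \<le> (\<Sum>y\<in>nbhd G x. card ((#) x ` walks_from G n y))" by (rule card_UN_le[OF N(1)])
    also have "\<dots> \<le> (\<Sum>y\<in>nbhd G x. d ^ n)"
      by (rule sum_mono) (use Suc card_image_le le_trans in blast)
    also have "\<dots> \<le> d * d ^ n" using N by simp
    finally show ?thesis using finite_subset[OF sub f] by simp
  qed
qed

lemma sum_involution_zero:
  fixes f :: "'a \<Rightarrow> real"
  assumes "\<And>p. p \<in> S \<Longrightarrow> \<sigma> p \<in> S" "\<And>p. p \<in> S \<Longrightarrow> \<sigma> (\<sigma> p) = p" "\<And>p. p \<in> S \<Longrightarrow> f (\<sigma> p) = - f p"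
  shows "sum f S = 0"
proof -
  have "sum f S = (\<Sum>p\<in>S. - f p)"
    by (rule sum.reindex_bij_witness[of _ \<sigma> \<sigma>]) (use assms in auto)
  then show ?thesis by (simp add: sum_negf)
qed

text \<open>
  Exchanging two configurations on \<open>U\<close> keeps them compatible with their boundary conditions if everything
  next to \<open>U\<close> is common to both.
\<close>

lemma compatible_swap:
  assumes G: "ugraph G" and A: "A \<subseteq> verts G"
    and a: "\<alpha>1 \<in> compatible G H A \<omega>1" "\<alpha>2 \<in> compatible G H A \<omega>2" and U: "U \<subseteq> A"
    and e1: "\<And>x y. x \<in> U \<Longrightarrow> adj G x y \<Longrightarrow> y \<notin> U \<Longrightarrow> y \<in> A \<Longrightarrow> \<alpha>1 y = \<alpha>2 y"
    and e2: "\<And>x y. x \<in> U \<Longrightarrow> adj G x y \<Longrightarrow> y \<in> boundary G A \<Longrightarrow> \<omega>1 y = \<omega>2 y"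
  shows "(\<lambda>x. if x \<in> U then \<alpha>2 x else \<alpha>1 x) \<in> compatible G H A \<omega>1"
proof -
  let ?\<alpha> = "\<lambda>x. if x \<in> U then \<alpha>2 x else \<alpha>1 x"
  have 1: "\<alpha>1 \<in> extensional A" "glue A \<alpha>1 \<omega>1 \<in> homs G H" using a(1) mem_compatible_iff[OF A] by auto
  have 2: "\<alpha>2 \<in> extensional A" "glue A \<alpha>2 \<omega>2 \<in> homs G H" using a(2) mem_compatible_iff[OF A] by auto
  have cross: "glue A \<alpha>1 \<omega>1 y = glue A \<alpha>2 \<omega>2 y" if "x \<in> U" "y \<notin> U" "adj G x y" for x y
    using e1[OF that(1,3,2)] e2[OF that(1,3)] mem_boundary_iff[OF G A, of y] adj_sym[OF that(3)] that U
    by (auto simp: glue_apply)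
  have g: "glue A ?\<alpha> \<omega>1 x = (if x \<in> U then glue A \<alpha>2 \<omega>2 x else glue A \<alpha>1 \<omega>1 x)" for x
    using U by (auto simp: glue_apply)
  have "glue A ?\<alpha> \<omega>1 \<in> homs G H"
  proof (rule homsI)
    fix x assume "x \<in> verts G"
    then show "glue A ?\<alpha> \<omega>1 x \<in> verts H" unfolding g using homsD(1)[OF 1(2)] homsD(1)[OF 2(2)] by simp
  next
    fix x y assume xy: "x \<in> verts G" "y \<in> verts G" "adj G x y"
    show "adj H (glue A ?\<alpha> \<omega>1 x) (glue A ?\<alpha> \<omega>1 y)"
      unfolding g using homsD(2)[OF 1(2) xy] homsD(2)[OF 2(2) xy] cross[of x y] cross[of y x] xy(3) adj_sym[OF xy(3)]
      by (cases "x \<in> U"; cases "y \<in> U") auto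
  next
    show "glue A ?\<alpha> \<omega>1 \<in> extensional (verts G)"
      unfolding extensional_def using homsD(3)[OF 1(2)] homsD(3)[OF 2(2)] g by (auto simp: extensional_def)
  qed
  moreover have "?\<alpha> \<in> extensional A" using 1(1) 2(1) by (auto simp: extensional_def)
  ultimately show ?thesis using mem_compatible_iff[OF A] by blast
qed

text \<open>
  For two independent configurations, call a site bad if one of them differs from its reference point
  there. If no path of \<open>n + 1\<close> bad sites starts in \<open>B\<close>, then the component \<open>U\<close> of bad sites around \<open>B\<close>
  keeps away from \<open>Z\<close>. Just outside \<open>U\<close> the two configurations agree with their reference points, hence
  with each other, so they can be swapped on \<open>U\<close>. The swap preserves the set of bad sites, so it is an
  involution; it preserves the product of the weights and exchanges the restrictions to \<open>B\<close>. Thus the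
  pairs without such a path contribute nothing to the difference of the marginals. In the other pairs
  the \<open>n + 1\<close> sites of a path are divided in two sets, on which the first and the second
  configuration, respectively, differ from their reference points: each of the at most \<open>|B| d\<^sup>n\<close> paths
  has at most \<open>2\<^sup>n\<^sup>+\<^sup>1\<close> divisions of probability at most \<open>\<epsilon>\<^sup>n\<^sup>+\<^sup>1\<close>.
\<close>

lemma disagreement_percolation:
  fixes G :: "'x ugraph" and H :: "'v ugraph" and \<epsilon> :: real and rank :: "'v \<Rightarrow> nat"
  assumes G: "ugraph G" and deg: "\<forall>x\<in>verts G. finite (nbhd G x) \<and> card (nbhd G x) \<le> d"
    and H: "finite (verts H)" and A: "finite A" "A \<subseteq> verts G" and B: "B \<subseteq> A"
    and \<omega>: "\<omega>1 \<in> homs G H" "\<omega>2 \<in> homs G H"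
    and agree: "\<And>x. x \<in> A - Z \<Longrightarrow> \<theta>1 x = \<theta>2 x" "\<And>x. x \<in> boundary G A - Z \<Longrightarrow> \<omega>1 x = \<omega>2 x"
    and far: "\<And>x z. x \<in> B \<Longrightarrow> z \<in> Z \<Longrightarrow> \<not> near G n x z"
    and \<epsilon>: "0 \<le> \<epsilon>"
    and p1: "\<And>Q. Q \<subseteq> A - Z \<Longrightarrow> (\<Sum>\<alpha>\<in>{\<alpha>\<in>compatible G H A \<omega>1. \<forall>x\<in>Q. \<alpha> x \<noteq> \<theta>1 x}. weight c rank A \<alpha>)
        \<le> \<epsilon> ^ card Q * (\<Sum>\<alpha>\<in>compatible G H A \<omega>1. weight c rank A \<alpha>)"
    and p2: "\<And>Q. Q \<subseteq> A - Z \<Longrightarrow> (\<Sum>\<alpha>\<in>{\<alpha>\<in>compatible G H A \<omega>2. \<forall>x\<in>Q. \<alpha> x \<noteq> \<theta>2 x}. weight c rank A \<alpha>)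
        \<le> \<epsilon> ^ card Q * (\<Sum>\<alpha>\<in>compatible G H A \<omega>2. weight c rank A \<alpha>)"
  shows "\<bar>marginal G H (gibbs G H (bias c rank)) A \<omega>1 B \<beta> - marginal G H (gibbs G H (bias c rank)) A \<omega>2 B \<beta>\<bar>
    \<le> real (card B) * (real d ^ n * (2 * \<epsilon>) ^ Suc n)"
proof -
  define C1 where "C1 = compatible G H A \<omega>1"
  define C2 where "C2 = compatible G H A \<omega>2"
  define w where "w = weight c rank A"
  define W1 where "W1 = sum w C1"
  define W2 where "W2 = sum w C2"
  have wpos: "w \<alpha> > 0" for \<alpha> by (simp add: w_def weight_pos)
  have fin: "finite C1" "finite C2" using finite_compatible[OF A H] by (auto simp: C1_def C2_def)
  have ne: "C1 \<noteq> {}" "C2 \<noteq> {}"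
    using restrict_mem_compatible[OF G A(2) \<omega>(1) \<omega>(1)] restrict_mem_compatible[OF G A(2) \<omega>(2) \<omega>(2)]
    by (auto simp: C1_def C2_def)
  have W: "W1 > 0" "W2 > 0" using fin ne wpos by (auto simp: W1_def W2_def intro: sum_pos)
  define i where "i \<alpha> = (if restrict \<alpha> B = \<beta> then 1 else (0::real))" for \<alpha> :: "'x \<Rightarrow> 'v"
  have m: "marginal G H (gibbs G H (bias c rank)) A \<omega>1 B \<beta> = (\<Sum>\<alpha>\<in>C1. w \<alpha> * i \<alpha>) / W1"
          "marginal G H (gibbs G H (bias c rank)) A \<omega>2 B \<beta> = (\<Sum>\<alpha>\<in>C2. w \<alpha> * i \<alpha>) / W2"
    using fin by (simp_all add: marginal_bias[OF A H] C1_def[symmetric] C2_def[symmetric] w_def[symmetric]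
        W1_def W2_def i_def if_distrib sum.inter_filter cong: if_cong)
  define f where "f = (\<lambda>(\<alpha>1, \<alpha>2). w \<alpha>1 * w \<alpha>2 * (i \<alpha>1 - i \<alpha>2))"
  have mm: "marginal G H (gibbs G H (bias c rank)) A \<omega>1 B \<beta> - marginal G H (gibbs G H (bias c rank)) A \<omega>2 B \<beta>
     = sum f (C1 \<times> C2) / (W1 * W2)"
  proof -
    have "sum f (C1 \<times> C2) = (\<Sum>\<alpha>1\<in>C1. \<Sum>\<alpha>2\<in>C2. (w \<alpha>1 * i \<alpha>1) * w \<alpha>2 - w \<alpha>1 * (w \<alpha>2 * i \<alpha>2))"
      unfolding f_def sum.cartesian_product[symmetric] by (simp add: algebra_simps)
    also have "\<dots> = (\<Sum>\<alpha>\<in>C1. w \<alpha> * i \<alpha>) * W2 - W1 * (\<Sum>\<alpha>\<in>C2. w \<alpha> * i \<alpha>)"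
      by (simp add: sum_subtractf W1_def W2_def sum_product)
    finally show ?thesis unfolding m using W by (simp add: field_simps)
  qed
  define bad where "bad \<alpha>1 \<alpha>2 = {x\<in>A. \<not> (\<alpha>1 x = \<theta>1 x \<and> \<alpha>2 x = \<theta>2 x)}" for \<alpha>1 \<alpha>2
  define paths where "paths = {p. \<exists>x\<in>B. p \<in> walks_from G n x \<and> distinct p \<and> set p \<subseteq> A - Z}"
  define E where "E = {(\<alpha>1, \<alpha>2). \<alpha>1 \<in> C1 \<and> \<alpha>2 \<in> C2 \<and> (\<exists>p\<in>paths. set p \<subseteq> bad \<alpha>1 \<alpha>2)}"
  define U where "U \<alpha>1 \<alpha>2 = {y. \<exists>x\<in>B \<inter> bad \<alpha>1 \<alpha>2. linked G (bad \<alpha>1 \<alpha>2) x y}" for \<alpha>1 \<alpha>2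
  have finB: "finite B" using A B finite_subset by blast
  have badA: "bad \<alpha>1 \<alpha>2 \<subseteq> A" for \<alpha>1 \<alpha>2 by (auto simp: bad_def)
  have Ubad: "U \<alpha>1 \<alpha>2 \<subseteq> bad \<alpha>1 \<alpha>2" for \<alpha>1 \<alpha>2
  proof
    fix y assume "y \<in> U \<alpha>1 \<alpha>2"
    then obtain x where "x \<in> bad \<alpha>1 \<alpha>2" "linked G (bad \<alpha>1 \<alpha>2) x y" by (auto simp: U_def)
    then show "y \<in> bad \<alpha>1 \<alpha>2" using linked_closed[of G "bad \<alpha>1 \<alpha>2" x y "bad \<alpha>1 \<alpha>2"] by blast
  qed
  have Uclosed: "y \<in> U \<alpha>1 \<alpha>2" if "x \<in> U \<alpha>1 \<alpha>2" "adj G x y" "y \<in> bad \<alpha>1 \<alpha>2" for x y \<alpha>1 \<alpha>2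
    using that Ubad linked_trans[OF _ linked_adj[OF that(2), of "bad \<alpha>1 \<alpha>2"]] unfolding U_def by blast
  \<comment> \<open>without a long bad path, the bad component of \<open>B\<close> stays away from \<open>Z\<close>\<close>
  have UZ: "u \<notin> Z \<and> (\<forall>y. adj G u y \<longrightarrow> y \<notin> Z)"
    if h: "\<alpha>1 \<in> C1" "\<alpha>2 \<in> C2" "(\<alpha>1, \<alpha>2) \<notin> E" "u \<in> U \<alpha>1 \<alpha>2" for \<alpha>1 \<alpha>2 u
  proof -
    obtain x where x: "x \<in> B" "x \<in> bad \<alpha>1 \<alpha>2" "linked G (bad \<alpha>1 \<alpha>2) x u" using h(4) by (auto simp: U_def)
    obtain p where p: "path_in G (bad \<alpha>1 \<alpha>2) x u p" "distinct p"
      using linked_imp_induced_path[OF x(3,2)] by metis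
    have px: "p \<noteq> []" "p ! 0 = x" "last p = u" "set p \<subseteq> bad \<alpha>1 \<alpha>2" "successively (adj G) p"
      using p(1) by (auto simp: path_in_def hd_conv_nth)
    have nr: "near G k x (p ! k)" if "k < length p" for k
      using that
    proof (induction k)
      case 0
      have "x \<in> verts G" using x(1) B A by blast
      then show ?case using px near_refl by metis
    next
      case (Suc k)
      have "adj G (p ! k) (p ! Suc k)" by (rule path_in_nth_adj[OF p(1) Suc.prems])
      then have "near G (k + 1) x (p ! Suc k)" using near_trans[OF _ near_1[OF G]] Suc by auto
      then show ?case by simp
    qed
    have short: "length p \<le> n"
    proof (rule ccontr)
      assume "\<not> length p \<le> n"
      then have len: "length p \<ge> Suc n" by simp
      let ?q = "take (Suc n) p"
      have "?q \<in> walks_from G n x"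
        using path_in_truncate[OF p(1), of n] len badA A by (fastforce simp: walks_from_def path_in_def)
      moreover have "set ?q \<subseteq> A - Z"
      proof
        fix z assume "z \<in> set ?q"
        then obtain k where k: "k < length ?q" "z = ?q ! k" by (metis in_set_conv_nth)
        then have "k < length p" "k \<le> n" "z = p ! k" using len by auto
        then have "near G n x z" using near_mono[OF nr] by blast
        moreover have "z \<in> A" using \<open>z = p ! k\<close> \<open>k < length p\<close> px(4) badA nth_mem by blast
        ultimately show "z \<in> A - Z" using far x(1) by blast
      qed
      moreover have "distinct ?q" using p(2) by simp
      ultimately have "?q \<in> paths" using x(1) by (auto simp: paths_def)
      moreover have "set ?q \<subseteq> bad \<alpha>1 \<alpha>2" using px(4) set_take_subset by (rule subset_trans[rotated])
      ultimately show False using h by (auto simp: E_def)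
    qed
    have "near G (length p - 1) x u" using nr[of "length p - 1"] px by (simp add: last_conv_nth)
    moreover have "0 < length p" using px(1) by simp
    ultimately have u: "near G (length p - 1) x u" "Suc (length p - 1) \<le> n" using short by auto
    have "u \<notin> Z" using far[OF x(1)] near_mono[OF u(1), of n] u(2) by auto
    moreover have "y \<notin> Z" if "adj G u y" for y
      using far[OF x(1)] near_mono[OF near_trans[OF u(1) near_1[OF G that]], of n] u(2) by auto
    ultimately show ?thesis by blast
  qed
  have BZ: "x \<notin> Z" if "x \<in> B" for x
    using far[OF that] near_refl[of x G n] that A B by blast
  define sw where "sw = (\<lambda>(\<alpha>1, \<alpha>2). ((\<lambda>x. if x \<in> U \<alpha>1 \<alpha>2 then \<alpha>2 x else \<alpha>1 x), (\<lambda>x. if x \<in> U \<alpha>1 \<alpha>2 then \<alpha>1 x else \<alpha>2 (x::'x) :: 'v)))"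
  have swap: "sw p \<in> C1 \<times> C2 - E \<and> sw (sw p) = p \<and> f (sw p) = - f p" if p: "p \<in> C1 \<times> C2 - E" for p
  proof -
    obtain \<alpha>1 \<alpha>2 where pe: "p = (\<alpha>1, \<alpha>2)" by (cases p)
    have h: "\<alpha>1 \<in> C1" "\<alpha>2 \<in> C2" "(\<alpha>1, \<alpha>2) \<notin> E" using p pe by auto
    let ?U = "U \<alpha>1 \<alpha>2"
    define \<alpha>1' where "\<alpha>1' x = (if x \<in> ?U then \<alpha>2 x else \<alpha>1 x)" for x
    define \<alpha>2' where "\<alpha>2' x = (if x \<in> ?U then \<alpha>1 x else \<alpha>2 x)" for x
    have sp: "sw p = (\<alpha>1', \<alpha>2')" by (simp add: pe sw_def \<alpha>1'_def \<alpha>2'_def fun_eq_iff)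
    have UA: "?U \<subseteq> A" using Ubad badA by blast
    have UnZ: "u \<notin> Z" "\<And>y. adj G u y \<Longrightarrow> y \<notin> Z" if "u \<in> ?U" for u using UZ[OF h that] by auto
    have eqA: "\<alpha>1 y = \<alpha>2 y" if "x \<in> ?U" "adj G x y" "y \<notin> ?U" "y \<in> A" for x y
    proof -
      have "y \<notin> bad \<alpha>1 \<alpha>2" using Uclosed[OF that(1,2)] that(3) by blast
      then have "\<alpha>1 y = \<theta>1 y" "\<alpha>2 y = \<theta>2 y" using that(4) by (auto simp: bad_def)
      then show ?thesis using agree(1)[of y] UnZ(2)[OF that(1,2)] that(4) by simp
    qed
    have eqb: "\<omega>1 y = \<omega>2 y" if "x \<in> ?U" "adj G x y" "y \<in> boundary G A" for x y
      using agree(2)[of y] UnZ(2)[OF that(1,2)] that(3) by simp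
    have c1: "\<alpha>1' \<in> C1" unfolding \<alpha>1'_def C1_def
      by (rule compatible_swap[OF G A(2) h(1)[unfolded C1_def] h(2)[unfolded C2_def] UA eqA eqb])
    have c2: "\<alpha>2' \<in> C2" unfolding \<alpha>2'_def C2_def
      by (rule compatible_swap[OF G A(2) h(2)[unfolded C2_def] h(1)[unfolded C1_def] UA eqA[symmetric] eqb[symmetric]])
    have bad': "bad \<alpha>1' \<alpha>2' = bad \<alpha>1 \<alpha>2"
    proof -
      have "x \<in> bad \<alpha>1' \<alpha>2' \<longleftrightarrow> x \<in> bad \<alpha>1 \<alpha>2" if x: "x \<in> A" for x
      proof (cases "x \<in> ?U")
        case True
        then have "\<theta>1 x = \<theta>2 x" using agree(1)[of x] UnZ(1) x by blast
        then show ?thesis using True x by (auto simp: bad_def \<alpha>1'_def \<alpha>2'_def)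
      next
        case False then show ?thesis by (simp add: bad_def \<alpha>1'_def \<alpha>2'_def)
      qed
      then show ?thesis using badA by blast
    qed
    then have U': "U \<alpha>1' \<alpha>2' = ?U" by (simp add: U_def)
    have nE: "(\<alpha>1', \<alpha>2') \<notin> E" using h by (simp add: E_def bad' c1 c2)
    have inv: "sw (\<alpha>1', \<alpha>2') = p" by (auto simp: sw_def U' pe \<alpha>1'_def \<alpha>2'_def fun_eq_iff)
    have sumr: "(\<Sum>x\<in>A. real (rank (\<alpha>1' x))) + (\<Sum>x\<in>A. real (rank (\<alpha>2' x)))
        = (\<Sum>x\<in>A. real (rank (\<alpha>1 x))) + (\<Sum>x\<in>A. real (rank (\<alpha>2 x)))"
      unfolding sum.distrib[symmetric] by (rule sum.cong) (auto simp: \<alpha>1'_def \<alpha>2'_def)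
    have ww: "w \<alpha>1' * w \<alpha>2' = w \<alpha>1 * w \<alpha>2"
      unfolding w_def weight_def exp_add[symmetric] distrib_left[symmetric] sumr ..
    have onB: "\<alpha>1' x = \<alpha>2 x \<and> \<alpha>2' x = \<alpha>1 x" if x: "x \<in> B" for x
    proof (cases "x \<in> ?U")
      case True then show ?thesis by (simp add: \<alpha>1'_def \<alpha>2'_def)
    next
      case False
      have "x \<notin> bad \<alpha>1 \<alpha>2"
      proof
        assume "x \<in> bad \<alpha>1 \<alpha>2"
        moreover have "linked G (bad \<alpha>1 \<alpha>2) x x" by (simp add: linked_def)
        ultimately show False using False x by (auto simp: U_def)
      qed
      then have "\<alpha>1 x = \<theta>1 x" "\<alpha>2 x = \<theta>2 x" using x B by (auto simp: bad_def)
      moreover have "\<theta>1 x = \<theta>2 x" using agree(1)[of x] BZ[OF x] x B by blast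
      ultimately show ?thesis using False by (simp add: \<alpha>1'_def \<alpha>2'_def)
    qed
    then have "restrict \<alpha>1' B = restrict \<alpha>2 B" "restrict \<alpha>2' B = restrict \<alpha>1 B" by auto
    then have "f (\<alpha>1', \<alpha>2') = - f p" by (simp add: f_def pe ww i_def)
    then show ?thesis using sp c1 c2 nE inv by simp
  qed
  have zero: "sum f (C1 \<times> C2 - E) = 0"
    by (rule sum_involution_zero[of _ sw]) (use swap in auto)
  have ES: "E \<subseteq> C1 \<times> C2" by (auto simp: E_def)
  have pf: "finite paths" "card paths \<le> card B * d ^ n"
  proof -
    have sub: "paths \<subseteq> (\<Union>x\<in>B. walks_from G n x)" by (auto simp: paths_def)
    have f: "finite (\<Union>x\<in>B. walks_from G n x)" using finB walks_from_bound[OF deg] by blast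
    show "finite paths" using finite_subset[OF sub f] .
    have "card paths \<le> card (\<Union>x\<in>B. walks_from G n x)" by (rule card_mono[OF f sub])
    also have "\<dots> \<le> (\<Sum>x\<in>B. card (walks_from G n x))" by (rule card_UN_le[OF finB])
    also have "\<dots> \<le> (\<Sum>x\<in>B. d ^ n)" by (rule sum_mono) (use walks_from_bound[OF deg] in blast)
    finally show "card paths \<le> card B * d ^ n" by simp
  qed
  have "sum f (C1 \<times> C2) = sum f E"
    using sum.subset_diff[OF ES, of f] fin zero by simp
  then have "\<bar>sum f (C1 \<times> C2)\<bar> \<le> (\<Sum>p\<in>E. \<bar>f p\<bar>)" by (simp add: sum_abs)
  also have "\<dots> \<le> (\<Sum>(\<alpha>1, \<alpha>2)\<in>E. w \<alpha>1 * w \<alpha>2)"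
  proof (rule sum_mono)
    fix p :: "('x \<Rightarrow> 'v) \<times> ('x \<Rightarrow> 'v)"
    obtain \<alpha>1 \<alpha>2 where pe: "p = (\<alpha>1, \<alpha>2)" by (cases p)
    have "\<bar>i \<alpha>1 - i \<alpha>2\<bar> \<le> 1" by (simp add: i_def)
    then have "w \<alpha>1 * w \<alpha>2 * \<bar>i \<alpha>1 - i \<alpha>2\<bar> \<le> w \<alpha>1 * w \<alpha>2 * 1"
      using wpos[of \<alpha>1] wpos[of \<alpha>2] by (intro mult_left_mono) auto
    then show "\<bar>f p\<bar> \<le> (case p of (\<alpha>1, \<alpha>2) \<Rightarrow> w \<alpha>1 * w \<alpha>2)"
      using wpos[of \<alpha>1] wpos[of \<alpha>2] by (simp add: f_def pe abs_mult)
  qed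
  also have "\<dots> \<le> (\<Sum>p\<in>paths. (2 * \<epsilon>) ^ Suc n * (W1 * W2))"
  proof -
    let ?B1 = "\<lambda>Q. {\<alpha>\<in>C1. \<forall>x\<in>Q. \<alpha> x \<noteq> \<theta>1 x}" and ?B2 = "\<lambda>Q. {\<alpha>\<in>C2. \<forall>x\<in>Q. \<alpha> x \<noteq> \<theta>2 x}"
    let ?X = "\<lambda>p. \<Union>Q\<in>Pow (set p). ?B1 Q \<times> ?B2 (set p - Q)"
    have EU: "E \<subseteq> (\<Union>p\<in>paths. ?X p)"
    proof
      fix e assume "e \<in> E"
      then obtain \<alpha>1 \<alpha>2 p where e: "e = (\<alpha>1, \<alpha>2)" "\<alpha>1 \<in> C1" "\<alpha>2 \<in> C2" "p \<in> paths" "set p \<subseteq> bad \<alpha>1 \<alpha>2"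
        by (auto simp: E_def)
      let ?Q = "{x\<in>set p. \<alpha>1 x \<noteq> \<theta>1 x}"
      have "\<alpha>2 x \<noteq> \<theta>2 x" if "x \<in> set p - ?Q" for x using that e(5) by (auto simp: bad_def)
      then have "e \<in> ?B1 ?Q \<times> ?B2 (set p - ?Q)" using e by auto
      then show "e \<in> (\<Union>p\<in>paths. ?X p)" using e(4) by blast
    qed
    have nn: "0 \<le> (case e of (\<alpha>1, \<alpha>2) \<Rightarrow> w \<alpha>1 * w \<alpha>2)" for e
      by (cases e) (simp add: less_imp_le[OF wpos])
    have un: "sum g (\<Union>i\<in>I. S i) \<le> (\<Sum>i\<in>I. sum g (S i))"
      if "finite I" "\<And>i. i \<in> I \<Longrightarrow> finite (S i)" "\<And>e. 0 \<le> g e" for g :: "_ \<Rightarrow> real" and I :: "'i set" and S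
      using that
    proof (induction I rule: finite_induct)
      case (insert j I)
      have "sum g (\<Union>i\<in>insert j I. S i) = sum g (S j \<union> (\<Union>i\<in>I. S i))" by simp
      also have "\<dots> \<le> sum g (S j) + sum g (\<Union>i\<in>I. S i)"
      proof -
        have "finite (S j)" "finite (\<Union>i\<in>I. S i)" using insert by auto
        moreover have "0 \<le> sum g (S j \<inter> (\<Union>i\<in>I. S i))" using insert by (intro sum_nonneg) auto
        ultimately show ?thesis by (simp add: sum_Un)
      qed
      also have "sum g (\<Union>i\<in>I. S i) \<le> (\<Sum>i\<in>I. sum g (S i))" using insert by auto
      finally show ?case using insert by simp
    qed simp
    have one: "(\<Sum>(\<alpha>1, \<alpha>2)\<in>?X p. w \<alpha>1 * w \<alpha>2) \<le> (2 * \<epsilon>) ^ Suc n * (W1 * W2)" if p: "p \<in> paths" for p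
    proof -
      have pp: "set p \<subseteq> A - Z" "card (set p) = Suc n"
        using p by (auto simp: paths_def walks_from_def distinct_card)
      have "(\<Sum>(\<alpha>1, \<alpha>2)\<in>?X p. w \<alpha>1 * w \<alpha>2) \<le> (\<Sum>Q\<in>Pow (set p). \<Sum>(\<alpha>1, \<alpha>2)\<in>?B1 Q \<times> ?B2 (set p - Q). w \<alpha>1 * w \<alpha>2)"
        by (rule un) (use fin nn in auto)
      also have "\<dots> \<le> (\<Sum>Q\<in>Pow (set p). \<epsilon> ^ Suc n * (W1 * W2))"
      proof (rule sum_mono)
        fix Q assume Q: "Q \<in> Pow (set p)"
        then have cQ: "card Q + card (set p - Q) = Suc n"
          using pp(2) by (metis List.finite_set Pow_iff card_Diff_subset card_mono finite_subset le_add_diff_inverse)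
        have 1: "sum w (?B1 Q) \<le> \<epsilon> ^ card Q * W1"
          using p1[of Q] Q pp(1) unfolding C1_def w_def W1_def by blast
        have 2: "sum w (?B2 (set p - Q)) \<le> \<epsilon> ^ card (set p - Q) * W2"
          using p2[of "set p - Q"] pp(1) unfolding C2_def w_def W2_def by blast
        have "(\<Sum>(\<alpha>1, \<alpha>2)\<in>?B1 Q \<times> ?B2 (set p - Q). w \<alpha>1 * w \<alpha>2) = sum w (?B1 Q) * sum w (?B2 (set p - Q))"
          by (simp add: sum_product sum.cartesian_product)
        also have "\<dots> \<le> (\<epsilon> ^ card Q * W1) * (\<epsilon> ^ card (set p - Q) * W2)"
        proof (rule mult_mono[OF 1 2])
          show "0 \<le> \<epsilon> ^ card Q * W1" using \<epsilon> W by simp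
          show "0 \<le> sum w (?B2 (set p - Q))" by (rule sum_nonneg) (simp add: less_imp_le[OF wpos])
        qed
        also have "\<dots> = \<epsilon> ^ Suc n * (W1 * W2)" unfolding cQ[symmetric] power_add by simp
        finally show "(\<Sum>(\<alpha>1, \<alpha>2)\<in>?B1 Q \<times> ?B2 (set p - Q). w \<alpha>1 * w \<alpha>2) \<le> \<epsilon> ^ Suc n * (W1 * W2)" .
      qed
      also have "\<dots> = (2 * \<epsilon>) ^ Suc n * (W1 * W2)"
        using pp(2) by (simp add: card_Pow power_mult_distrib)
      finally show ?thesis .
    qed
    have "(\<Sum>(\<alpha>1, \<alpha>2)\<in>E. w \<alpha>1 * w \<alpha>2) \<le> (\<Sum>(\<alpha>1, \<alpha>2)\<in>(\<Union>p\<in>paths. ?X p). w \<alpha>1 * w \<alpha>2)"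
      by (rule sum_mono2[OF _ EU]) (use pf fin nn in auto)
    also have "\<dots> \<le> (\<Sum>p\<in>paths. \<Sum>(\<alpha>1, \<alpha>2)\<in>?X p. w \<alpha>1 * w \<alpha>2)"
      by (rule un) (use pf fin nn in auto)
    also have "\<dots> \<le> (\<Sum>p\<in>paths. (2 * \<epsilon>) ^ Suc n * (W1 * W2))" by (rule sum_mono) (rule one)
    finally show ?thesis .
  qed
  also have "\<dots> \<le> (real (card B) * (real d ^ n * (2 * \<epsilon>) ^ Suc n)) * (W1 * W2)"
  proof -
    have "real (card paths) \<le> real (card B * d ^ n)" using pf(2) by (rule of_nat_mono)
    then have "real (card paths) * ((2 * \<epsilon>) ^ Suc n * (W1 * W2)) \<le> real (card B * d ^ n) * ((2 * \<epsilon>) ^ Suc n * (W1 * W2))"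
      using \<epsilon> W by (intro mult_right_mono) auto
    then show ?thesis by (simp only: of_nat_mult of_nat_power mult.assoc sum_constant)
  qed
  finally have "\<bar>sum f (C1 \<times> C2)\<bar> / (W1 * W2) \<le> real (card B) * (real d ^ n * (2 * \<epsilon>) ^ Suc n)"
    using W by (simp add: pos_divide_le_eq)
  then show ?thesis unfolding mm using mult_pos_pos[OF W] by (simp only: abs_div_pos)
qed

section \<open>Strong and weak spatial mixing\<close>

lemma exp_decay_bound:
  fixes x c \<gamma> :: real
  assumes \<gamma>: "0 < \<gamma>" and bnd: "\<And>m. enat m \<le> D \<Longrightarrow> x \<le> c * exp (- \<gamma> * real m)"
  shows "x \<le> c * exp_decay \<gamma> D"
proof (cases D)
  case (enat m) then show ?thesis using bnd[of m] by (simp add: exp_decay_def)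
next
  case infinity
  have "(\<lambda>m. exp (- \<gamma>) ^ m) \<longlonglongrightarrow> 0" by (rule LIMSEQ_power_zero) (use \<gamma> in simp)
  then have "(\<lambda>m. c * exp (- \<gamma>) ^ m) \<longlonglongrightarrow> c * 0" by (rule tendsto_mult_left)
  moreover have "x \<le> c * exp (- \<gamma>) ^ m" for m
    using bnd[of m] infinity by (simp add: exp_of_nat_mult[symmetric] mult.commute)
  ultimately have "x \<le> c * 0" by (intro LIMSEQ_le_const) auto
  then show ?thesis using infinity by (simp add: exp_decay_def)
qed

lemma marginal_bias_bounds:
  assumes A: "finite A" "A \<subseteq> verts G" and H: "finite (verts H)"
  shows "0 \<le> marginal G H (gibbs G H (bias c rank)) A \<omega> B \<beta> \<and> marginal G H (gibbs G H (bias c rank)) A \<omega> B \<beta> \<le> 1"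
proof -
  have f: "finite (compatible G H A \<omega>)" by (rule finite_compatible[OF A H])
  have "(\<Sum>\<alpha>\<in>{\<alpha> \<in> compatible G H A \<omega>. restrict \<alpha> B = \<beta>}. weight c rank A \<alpha>) \<le> (\<Sum>\<alpha>\<in>compatible G H A \<omega>. weight c rank A \<alpha>)"
    by (rule sum_mono2[OF f]) (auto simp: less_imp_le[OF weight_pos])
  moreover have "0 \<le> (\<Sum>\<alpha>\<in>{\<alpha> \<in> compatible G H A \<omega>. restrict \<alpha> B = \<beta>}. weight c rank A \<alpha>)"
    by (rule sum_nonneg) (auto simp: less_imp_le[OF weight_pos])
  ultimately show ?thesis unfolding marginal_bias[OF A H]
    by (auto simp: divide_le_eq_1 intro: divide_nonneg_nonneg)
qed

text \<open>
  The hypothesis of the Peierls bound for sets \<open>Q\<close> away from \<open>Z\<close>. Under the unique maximal configuration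
  property it holds for all \<open>Q\<close>, but folding has to leave the boundary condition alone and so needs
  \<open>Q\<close> to be far from the boundary.
\<close>

definition raisable ::
    "'x ugraph \<Rightarrow> 'v ugraph \<Rightarrow> ('v \<Rightarrow> nat) \<Rightarrow> nat \<Rightarrow> 'x set \<Rightarrow> 'x set \<Rightarrow> ('x \<Rightarrow> 'v) \<Rightarrow> ('x \<Rightarrow> 'v) \<Rightarrow> bool" where
  "raisable G H rank g A Z \<omega> \<theta> \<longleftrightarrow>
     (\<forall>Q. Q \<subseteq> A - Z \<longrightarrow> (\<forall>\<alpha>\<in>compatible G H A \<omega>. \<exists>\<alpha>'\<in>compatible G H A \<omega>.
        (\<forall>x\<in>A - nbhd_n G g Q. \<alpha>' x = \<alpha> x) \<and> (\<forall>x\<in>A. rank (\<alpha> x) \<le> rank (\<alpha>' x)) \<and>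
        (\<forall>x\<in>Q. \<alpha> x \<noteq> \<theta> x \<longrightarrow> rank (\<alpha> x) < rank (\<alpha>' x))))"

text \<open>
  The constant \<open>c\<close> is chosen so that \<open>\<epsilon>\<close> becomes \<open>e\<^sup>-\<^sup>\<gamma> / 2(d + 1)\<close>, which beats the number of paths. It
  depends on \<open>\<gamma>\<close>, \<open>d\<close>, \<open>g\<close> and \<open>|V|\<close> only. A site of \<open>B\<close> at distance \<open>m > g\<close> from \<open>Y\<close> is farther than
  \<open>m - g - 1\<close> from the \<open>g\<close>-neighbourhood of \<open>Y\<close>; for \<open>m \<le> g\<close> the factor \<open>e\<^sup>\<gamma>\<^sup>g\<close> makes the bound trivial.
\<close>

lemma raisable_imp_decay:
  fixes G :: "'x ugraph" and H :: "'v ugraph" and rank :: "'v \<Rightarrow> nat"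
  assumes G: "ugraph G" and deg: "\<forall>x\<in>verts G. finite (nbhd G x) \<and> card (nbhd G x) \<le> d"
    and H: "finite (verts H)" "verts H \<noteq> {}" and \<gamma>: "0 < \<gamma>"
  shows "\<exists>c\<ge>0. \<forall>A B \<beta> \<omega>1 \<omega>2 Y \<theta>1 \<theta>2. finite A \<and> A \<subseteq> verts G \<and> B \<subseteq> A \<and>
     \<omega>1 \<in> homs G H \<and> \<omega>2 \<in> homs G H \<and>
     (\<forall>x\<in>A - nbhd_n G g Y. \<theta>1 x = \<theta>2 x) \<and> (\<forall>x\<in>boundary G A - nbhd_n G g Y. \<omega>1 x = \<omega>2 x) \<and>
     raisable G H rank g A (nbhd_n G g Y) \<omega>1 \<theta>1 \<and> raisable G H rank g A (nbhd_n G g Y) \<omega>2 \<theta>2 \<longrightarrow>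
     \<bar>marginal G H (gibbs G H (bias c rank)) A \<omega>1 B \<beta> - marginal G H (gibbs G H (bias c rank)) A \<omega>2 B \<beta>\<bar>
       \<le> real (card B) * exp (\<gamma> * real g) * exp_decay \<gamma> (sdist G B Y)"
proof -
  define D where "D = (d + 1) ^ g"
  define M where "M = real (card (verts H) ^ D)"
  define \<epsilon> where "\<epsilon> = exp (- \<gamma>) / (2 * real (d + 1))"
  define c where "c = ln (M / \<epsilon>)"
  have M1: "M \<ge> 1" using H by (simp add: M_def Suc_le_eq card_gt_0_iff)
  have \<epsilon>0: "0 < \<epsilon>" by (simp add: \<epsilon>_def)
  have "\<epsilon> \<le> exp (- \<gamma>) / 1" unfolding \<epsilon>_def by (rule divide_left_mono) auto
  moreover have "exp (- \<gamma>) \<le> 1" using \<gamma> by simp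
  ultimately have \<epsilon>1: "\<epsilon> \<le> 1" by linarith
  have "1 \<le> M / \<epsilon>" using M1 \<epsilon>0 \<epsilon>1 by (simp add: le_divide_eq)
  then have c0: "0 \<le> c" and ec: "exp c = M / \<epsilon>" by (simp_all add: c_def)
  have Mc: "M / exp c = \<epsilon>" using ec M1 \<epsilon>0 by simp
  show ?thesis
  proof (intro exI[of _ c] conjI allI impI c0)
    fix A B \<beta> \<omega>1 \<omega>2 Y \<theta>1 \<theta>2
    let ?Z = "nbhd_n G g Y"
    assume h: "finite A \<and> A \<subseteq> verts G \<and> B \<subseteq> A \<and>
     \<omega>1 \<in> homs G H \<and> \<omega>2 \<in> homs G H \<and>
     (\<forall>x\<in>A - ?Z. \<theta>1 x = \<theta>2 x) \<and> (\<forall>x\<in>boundary G A - ?Z. \<omega>1 x = \<omega>2 x) \<and>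
     raisable G H rank g A ?Z \<omega>1 \<theta>1 \<and> raisable G H rank g A ?Z \<omega>2 \<theta>2"
    then have A: "finite A" "A \<subseteq> verts G" and B: "B \<subseteq> A" and w: "\<omega>1 \<in> homs G H" "\<omega>2 \<in> homs G H"
      and r1: "raisable G H rank g A ?Z \<omega>1 \<theta>1" and r2: "raisable G H rank g A ?Z \<omega>2 \<theta>2"
      and agree: "\<And>x. x \<in> A - ?Z \<Longrightarrow> \<theta>1 x = \<theta>2 x" "\<And>x. x \<in> boundary G A - ?Z \<Longrightarrow> \<omega>1 x = \<omega>2 x"
      by blast+
    have pe: "(\<Sum>\<alpha>\<in>{\<alpha>\<in>compatible G H A \<omega>. \<forall>x\<in>Q. \<alpha> x \<noteq> \<theta> x}. weight c rank A \<alpha>)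
        \<le> \<epsilon> ^ card Q * (\<Sum>\<alpha>\<in>compatible G H A \<omega>. weight c rank A \<alpha>)"
      if r: "raisable G H rank g A ?Z \<omega> \<theta>" and Q: "Q \<subseteq> A - ?Z" for \<omega> \<theta> Q
    proof -
      have QA: "Q \<subseteq> A" and finQ: "finite Q" using Q A finite_subset by blast+
      have eq: "nbhd_n G g Q = (\<Union>x\<in>Q. {y. near G g x y})"
      proof -
        have "{y. near G g x y} = {y. near G g y x}" for x
          by (intro Collect_cong iffI) (erule near_sym)+
        then show ?thesis by (auto simp: mem_nbhd_n_iff)
      qed
      have fb: "finite {y. near G g x y}" for x using deg by (intro finite_ball) auto
      have Y: "finite (nbhd_n G g Q)" unfolding eq using finQ fb by blast
      have "card (nbhd_n G g Q) \<le> (\<Sum>x\<in>Q. card {y. near G g x y})" unfolding eq by (rule card_UN_le[OF finQ])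
      also have "\<dots> \<le> (\<Sum>x\<in>Q. D)" unfolding D_def by (rule sum_mono) (rule card_ball_le[OF deg])
      finally have cY: "card (nbhd_n G g Q) \<le> D * card Q" by (simp add: mult.commute)
      have "compatible G H A \<omega> \<subseteq> A \<rightarrow>\<^sub>E verts H"
        using A(2) by (auto simp: compatible_def language_def homs_def)
      from peierls_bound[OF c0 A(1) H(1) finite_compatible[OF A H(1)] this QA cY Y _ H(2)]
      show ?thesis using r Q unfolding raisable_def M_def[symmetric] Mc by blast
    qed
    let ?m = "\<bar>marginal G H (gibbs G H (bias c rank)) A \<omega>1 B \<beta> - marginal G H (gibbs G H (bias c rank)) A \<omega>2 B \<beta>\<bar>"
    show "?m \<le> real (card B) * exp (\<gamma> * real g) * exp_decay \<gamma> (sdist G B Y)"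
    proof (rule exp_decay_bound[OF \<gamma>])
      fix m assume m: "enat m \<le> sdist G B Y"
      show "?m \<le> real (card B) * exp (\<gamma> * real g) * exp (- \<gamma> * real m)"
      proof (cases "B = {}")
        case True
        have "?m \<le> real (card B) * (real d ^ 0 * (2 * \<epsilon>) ^ Suc 0)"
          by (rule disagreement_percolation[OF G deg H(1) A B w agree _ _ pe[OF r1] pe[OF r2]])
             (use True \<epsilon>0 in auto)
        then show ?thesis using True by simp
      next
        case False
        then have B1: "1 \<le> real (card B)" using finite_subset[OF B A(1)] by (simp add: Suc_le_eq card_gt_0_iff)
        show ?thesis
        proof (cases "m \<le> g")
          case True
          have "?m \<le> 1"
            using marginal_bias_bounds[OF A H(1), of c rank \<omega>1 B \<beta>] marginal_bias_bounds[OF A H(1), of c rank \<omega>2 B \<beta>] by linarith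
          also have "1 \<le> exp (\<gamma> * real g + - \<gamma> * real m)" using True \<gamma> by (simp add: algebra_simps)
          also have "\<dots> \<le> real (card B) * exp (\<gamma> * real g + - \<gamma> * real m)" using B1 by simp
          finally show ?thesis by (simp only: exp_add mult.assoc)
        next
          case False
          define n where "n = m - g - 1"
          have mn: "m = n + g + 1" using False by (simp add: n_def)
          have far: "\<not> near G n x z" if x: "x \<in> B" and z: "z \<in> ?Z" for x z
          proof
            assume xz: "near G n x z"
            obtain y where y: "y \<in> Y" "near G g z y" using z by (auto simp: mem_nbhd_n_iff)
            have "near G (n + g) x y" by (rule near_trans[OF xz y(2)])
            then show False using m x y(1) mn unfolding sdist_ge_iff by auto
          qed
          have "?m \<le> real (card B) * (real d ^ n * (2 * \<epsilon>) ^ Suc n)"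
            by (rule disagreement_percolation[OF G deg H(1) A B w agree far _ pe[OF r1] pe[OF r2]])
               (use \<epsilon>0 in auto)
          also have "\<dots> \<le> real (card B) * exp (- \<gamma>) ^ Suc n"
          proof (rule mult_left_mono)
            have "real d ^ n * (2 * \<epsilon>) ^ Suc n \<le> real (d + 1) ^ Suc n * (2 * \<epsilon>) ^ Suc n"
            proof (rule mult_right_mono)
              have "real d ^ n \<le> real (d + 1) ^ n" by (rule power_mono) auto
              also have "\<dots> \<le> real (d + 1) ^ Suc n" by (rule power_increasing) auto
              finally show "real d ^ n \<le> real (d + 1) ^ Suc n" .
            qed (use \<epsilon>0 in simp)
            also have "\<dots> = (real (d + 1) * (2 * \<epsilon>)) ^ Suc n" by (simp only: power_mult_distrib)
            also have "real (d + 1) * (2 * \<epsilon>) = exp (- \<gamma>)"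
            proof -
              have "2 + 2 * real d \<noteq> 0" by linarith
              then show ?thesis by (simp add: \<epsilon>_def field_simps)
            qed
            finally show "real d ^ n * (2 * \<epsilon>) ^ Suc n \<le> exp (- \<gamma>) ^ Suc n" .
          qed simp
          also have "exp (- \<gamma>) ^ Suc n = exp (\<gamma> * real g) * exp (- \<gamma> * real m)"
            by (simp add: mn exp_of_nat_mult[symmetric] exp_add[symmetric] algebra_simps)
          finally show ?thesis by (simp only: mult.assoc)
        qed
      qed
    qed
  qed
qed

lemma finite_boundary:
  assumes G: "ugraph G" and lf: "\<forall>x\<in>verts G. finite (nbhd G x)" and A: "finite A" "A \<subseteq> verts G"
  shows "finite (boundary G A)"
proof (rule finite_subset)
  show "boundary G A \<subseteq> (\<Union>x\<in>A. nbhd G x)"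
    using mem_boundary_iff[OF G A(2)] by (auto simp: nbhd_def)
  show "finite (\<Union>x\<in>A. nbhd G x)" using lf A by blast
qed

text \<open>
  The reference point is the maximal one over the boundary condition. To raise a configuration, pin it
  outside of the \<open>g\<close>-neighbourhood of \<open>Q\<close> and pass to the maximal point over that: it dominates the
  configuration, and on \<open>Q\<close> it agrees with the reference point, since the pinned sites at which the
  two may differ are farther than \<open>g\<close> away. The reference points of two boundary conditions agree
  outside of the \<open>g\<close>-neighbourhood of the set where these differ.
\<close>

lemma UMC_imp_exists_SSM:
  fixes G :: "'x ugraph" and H :: "'v ugraph"
  assumes G: "ugraph G" and bd: "bounded_degree G" and H: "constraint_graph H" and umc: "UMC G H"
  shows "exists_SSM G H"
  unfolding exists_SSM_def
proof (intro allI impI)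
  fix \<gamma> :: real assume \<gamma>: "0 < \<gamma>"
  obtain d where deg: "\<forall>x\<in>verts G. finite (nbhd G x) \<and> card (nbhd G x) \<le> d"
    using bd by (auto simp: bounded_degree_def)
  have finH: "finite (verts H)" "verts H \<noteq> {}" using H by (auto simp: constraint_graph_def)
  obtain g r where r: "strict_linear_order_on (verts H) r"
    and ex: "\<And>A \<alpha>. A \<subseteq> verts G \<Longrightarrow> finite A \<Longrightarrow> \<alpha> \<in> language G H A \<Longrightarrow> \<exists>\<omega>. maximal_point G H r A \<alpha> \<omega>"
    and loc: "\<And>A \<alpha>1 \<alpha>2 \<omega>1 \<omega>2 x. A \<subseteq> verts G \<Longrightarrow> finite A \<Longrightarrow>
       maximal_point G H r A \<alpha>1 \<omega>1 \<Longrightarrow> maximal_point G H r A \<alpha>2 \<omega>2 \<Longrightarrow>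
       x \<in> verts G \<Longrightarrow> \<omega>1 x \<noteq> \<omega>2 x \<Longrightarrow> \<exists>y\<in>A. near G g x y \<and> \<alpha>1 y \<noteq> \<alpha>2 y"
    by (rule UMC_E[OF umc]) (rule that)
  define rank where "rank v = card {u \<in> verts H. (u, v) \<in> r}" for v
  have rank_less: "rank a < rank b" if "(a, b) \<in> r" "a \<in> verts H" for a b
    unfolding rank_def
  proof (rule psubset_card_mono)
    have "trans r" "irrefl r" using r by (auto simp: strict_linear_order_on_def)
    then have "{u \<in> verts H. (u, a) \<in> r} \<subseteq> {u \<in> verts H. (u, b) \<in> r}" "(a, a) \<notin> r"
      using that(1) by (auto simp: irrefl_def dest: transD)
    then show "{u \<in> verts H. (u, a) \<in> r} \<subset> {u \<in> verts H. (u, b) \<in> r}" using that by blast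
  qed (use finH in simp)
  have raise: "raisable G H rank g A (Z :: 'x set) \<omega> \<theta>"
    if A: "finite A" "A \<subseteq> verts G" and \<omega>: "\<omega> \<in> homs G H"
      and \<theta>: "maximal_point G H r (boundary G A) (restrict \<omega> (boundary G A)) \<theta>" for A Z \<omega> \<theta>
    unfolding raisable_def
  proof (intro allI impI ballI)
    fix Q \<alpha> assume Q: "Q \<subseteq> A - Z" and \<alpha>: "\<alpha> \<in> compatible G H A \<omega>"
    let ?b = "boundary G A"
    let ?\<eta> = "glue A \<alpha> \<omega>"
    have \<eta>: "?\<eta> \<in> homs G H" using \<alpha> by (simp add: compatible_def)
    \<comment> \<open>the pinned sites\<close>
    define D where "D = ?b \<union> (A - nbhd_n G g Q)"
    have bsub: "?b \<subseteq> verts G" by (auto simp: boundary_def)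
    have D: "D \<subseteq> verts G" "finite D"
      using bsub A finite_boundary[OF G _ A] deg by (auto simp: D_def)
    have bA: "y \<notin> A" if "y \<in> ?b" for y using that mem_boundary_iff[OF G A(2)] by blast
    have "restrict ?\<eta> D \<in> language G H D" using \<eta> by (auto simp: language_def)
    then obtain \<zeta> where \<zeta>: "maximal_point G H r D (restrict ?\<eta> D) \<zeta>" using ex[OF D] by blast
    have \<zeta>h: "\<zeta> \<in> homs G H" "restrict \<zeta> D = restrict ?\<eta> D" using \<zeta> by (auto simp: maximal_point_def cylinder_def)
    have \<zeta>D: "\<zeta> y = ?\<eta> y" if "y \<in> D" for y using fun_cong[OF \<zeta>h(2), of y] that by simp
    have \<theta>b: "\<theta> y = \<omega> y" if "y \<in> ?b" for y
    proof -
      have "restrict \<theta> ?b = restrict \<omega> ?b" using \<theta> by (simp add: maximal_point_def cylinder_def)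
      from fun_cong[OF this, of y] show ?thesis using that by simp
    qed
    have le: "(\<alpha> x, \<zeta> x) \<in> r \<or> \<alpha> x = \<zeta> x" if x: "x \<in> A" for x
    proof -
      have "?\<eta> \<in> cylinder G H D (restrict ?\<eta> D)" using \<eta> by (simp add: cylinder_def)
      then have "config_le G r ?\<eta> \<zeta>" using \<zeta> by (simp add: maximal_point_def)
      then show ?thesis using x A(2) unfolding config_le_def by (auto simp: glue_apply dest!: bspec[of _ _ x])
    qed
    have \<alpha>V: "\<alpha> x \<in> verts H" if "x \<in> A" for x using homsD(1)[OF \<eta>, of x] that A(2) by (auto simp: glue_apply)
    have \<zeta>Q: "\<zeta> x = \<theta> x" if x: "x \<in> Q" for x
    proof (rule ccontr)
      assume ne: "\<zeta> x \<noteq> \<theta> x"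
      have m\<theta>: "maximal_point G H r D (restrict \<theta> D) \<theta>" by (rule maximal_point_refine[OF \<theta>]) (simp add: D_def)
      have xG: "x \<in> verts G" using x Q A by blast
      obtain y where y: "y \<in> D" "near G g x y" "restrict ?\<eta> D y \<noteq> restrict \<theta> D y"
        using loc[OF D \<zeta> m\<theta> xG ne] by blast
      show False
      proof (cases "y \<in> ?b")
        case True
        then show False using y \<theta>b[OF True] bA[OF True] by (simp add: glue_apply)
      next
        case False
        then have "y \<notin> nbhd_n G g Q" using y(1) by (simp add: D_def)
        then show False using near_sym[OF y(2)] x by (auto simp: mem_nbhd_n_iff)
      qed
    qed
    show "\<exists>\<alpha>'\<in>compatible G H A \<omega>. (\<forall>x\<in>A - nbhd_n G g Q. \<alpha>' x = \<alpha> x) \<and>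
        (\<forall>x\<in>A. rank (\<alpha> x) \<le> rank (\<alpha>' x)) \<and> (\<forall>x\<in>Q. \<alpha> x \<noteq> \<theta> x \<longrightarrow> rank (\<alpha> x) < rank (\<alpha>' x))"
    proof (intro bexI[of _ "restrict \<zeta> A"] conjI ballI impI)
      show "restrict \<zeta> A \<in> compatible G H A \<omega>"
        by (rule restrict_mem_compatible[OF G A(2) \<zeta>h(1) \<omega>]) (use \<zeta>D bA in \<open>auto simp: D_def glue_apply\<close>)
    next
      fix x assume "x \<in> A - nbhd_n G g Q"
      then show "restrict \<zeta> A x = \<alpha> x" using \<zeta>D[of x] by (simp add: D_def glue_apply)
    next
      fix x assume x: "x \<in> A"
      show "rank (\<alpha> x) \<le> rank (restrict \<zeta> A x)"
        using le[OF x] rank_less[OF _ \<alpha>V[OF x]] x by (auto intro: less_imp_le)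
    next
      fix x assume x: "x \<in> Q" "\<alpha> x \<noteq> \<theta> x"
      then have xA: "x \<in> A" using Q by blast
      then have "(\<alpha> x, \<zeta> x) \<in> r" using le[OF xA] \<zeta>Q[OF x(1)] x(2) by auto
      then show "rank (\<alpha> x) < rank (restrict \<zeta> A x)" using rank_less \<alpha>V[OF xA] xA by simp
    qed
  qed
  obtain c where c: "0 \<le> c" and main: "\<And>A B \<beta> \<omega>1 \<omega>2 Y \<theta>1 \<theta>2. finite A \<and> A \<subseteq> verts G \<and> B \<subseteq> A \<and>
     \<omega>1 \<in> homs G H \<and> \<omega>2 \<in> homs G H \<and>
     (\<forall>x\<in>A - nbhd_n G g Y. \<theta>1 x = \<theta>2 x) \<and> (\<forall>x\<in>boundary G A - nbhd_n G g Y. \<omega>1 x = \<omega>2 x) \<and>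
     raisable G H rank g A (nbhd_n G g Y) \<omega>1 \<theta>1 \<and> raisable G H rank g A (nbhd_n G g Y) \<omega>2 \<theta>2 \<Longrightarrow>
     \<bar>marginal G H (gibbs G H (bias c rank)) A \<omega>1 B \<beta> - marginal G H (gibbs G H (bias c rank)) A \<omega>2 B \<beta>\<bar>
       \<le> real (card B) * exp (\<gamma> * real g) * exp_decay \<gamma> (sdist G B Y)"
    using raisable_imp_decay[OF G deg finH \<gamma>, where rank = rank and g = g]
    apply (elim exE conjE)
    subgoal premises p for c
      by (rule p(1)[of c, OF p(2)]) (rule p(3)[rule_format])
    done
  have "exp_SSM G H (gibbs G H (bias c rank)) \<gamma>"
    unfolding exp_SSM_def
  proof (intro exI[of _ "exp (\<gamma> * real g)"] conjI allI impI ballI)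
    fix A B \<beta> \<omega>1 \<omega>2
    assume A: "A \<subseteq> verts G" "finite A" and B: "B \<subseteq> A" and w: "\<omega>1 \<in> homs G H" "\<omega>2 \<in> homs G H"
    let ?b = "boundary G A" and ?Y = "disagreement (boundary G A) \<omega>1 \<omega>2"
    have b: "?b \<subseteq> verts G" "finite ?b"
      using finite_boundary[OF G _ A(2,1)] deg by (auto simp: boundary_def)
    have l: "restrict \<omega>1 ?b \<in> language G H ?b" "restrict \<omega>2 ?b \<in> language G H ?b" using w by (auto simp: language_def)
    obtain \<theta>1 where \<theta>1: "maximal_point G H r ?b (restrict \<omega>1 ?b) \<theta>1" using ex[OF b l(1)] by blast
    obtain \<theta>2 where \<theta>2: "maximal_point G H r ?b (restrict \<omega>2 ?b) \<theta>2" using ex[OF b l(2)] by blast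
    have "\<theta>1 x = \<theta>2 x" if x: "x \<in> A - nbhd_n G g ?Y" for x
    proof (rule ccontr)
      assume "\<theta>1 x \<noteq> \<theta>2 x"
      then obtain y where "y \<in> ?b" "near G g x y" "restrict \<omega>1 ?b y \<noteq> restrict \<omega>2 ?b y"
        using loc[OF b \<theta>1 \<theta>2, of x] x A by blast
      then show False using x by (auto simp: mem_nbhd_n_iff disagreement_def)
    qed
    moreover have "\<omega>1 x = \<omega>2 x" if x: "x \<in> ?b - nbhd_n G g ?Y" for x
    proof (rule ccontr)
      assume "\<omega>1 x \<noteq> \<omega>2 x"
      then have "x \<in> ?Y" using x by (simp add: disagreement_def)
      moreover have "near G g x x" by (rule near_refl) (use x b in blast)
      ultimately have "x \<in> ?Y" "near G g x x" by blast+
      then show False using x by (auto simp: mem_nbhd_n_iff)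
    qed
    ultimately show "\<bar>marginal G H (gibbs G H (bias c rank)) A \<omega>1 B \<beta> - marginal G H (gibbs G H (bias c rank)) A \<omega>2 B \<beta>\<bar>
       \<le> real (card B) * exp (\<gamma> * real g) * exp_decay \<gamma> (sdist G B ?Y)"
      using raise[OF A(2,1) w(1) \<theta>1] raise[OF A(2,1) w(2) \<theta>2] A B w
      by (intro main[where ?\<theta>1.0 = \<theta>1 and ?\<theta>2.0 = \<theta>2]) blast
  qed simp
  then show "\<exists>\<Phi>. interaction H \<Phi> \<and> exp_SSM G H (gibbs G H \<Phi>) \<gamma>" using interaction_bias[OF c] by blast
qed

text \<open>
  The reference point is the constant \<open>s\<close>. To raise a configuration, apply all folds on \<open>Q\<close> and one fold
  less with each step away from \<open>Q\<close>.
\<close>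

lemma dismantlable_imp_exists_WSM:
  fixes G :: "'x ugraph" and H :: "'v ugraph"
  assumes G: "ugraph G" and bd: "bounded_degree G" and H: "constraint_graph H" and dis: "dismantlable H"
  shows "exists_WSM G H"
  unfolding exists_WSM_def
proof (intro allI impI)
  fix \<gamma> :: real assume \<gamma>: "0 < \<gamma>"
  obtain d where deg: "\<forall>x\<in>verts G. finite (nbhd G x) \<and> card (nbhd G x) \<le> d"
    using bd by (auto simp: bounded_degree_def)
  have finH: "finite (verts H)" "verts H \<noteq> {}" using H by (auto simp: constraint_graph_def)
  obtain n F s rank where FS: "folding_sequence H n F s rank"
    using dismantlable_imp_folding_sequence[OF dis] by blast
  note Fv = folding_sequenceD(2)[OF FS] and F0 = folding_sequenceD(3)[OF FS]
    and Fn = folding_sequenceD(4)[OF FS] and Fkl = folding_sequence_adj[OF FS]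
    and Fr = folding_sequenceD(7)[OF FS] and Fs = folding_sequenceD(8)[OF FS]
  have raise: "raisable G H rank n A (nbhd_n G n (boundary G A)) \<omega> (\<lambda>x. s)"
    if A: "finite A" "A \<subseteq> verts G" and \<omega>: "\<omega> \<in> homs G H" for A \<omega>
    unfolding raisable_def
  proof (intro allI impI ballI)
    fix Q \<alpha> assume Q: "Q \<subseteq> A - nbhd_n G n (boundary G A)" and \<alpha>: "\<alpha> \<in> compatible G H A \<omega>"
    let ?\<eta> = "glue A \<alpha> \<omega>" and ?l = "level G n Q"
    have \<eta>: "?\<eta> \<in> homs G H" using \<alpha> by (simp add: compatible_def)
    define \<zeta> where "\<zeta> = restrict (\<lambda>x. F (n - ?l x) (?\<eta> x)) (verts G)"
    have \<zeta>h: "\<zeta> \<in> homs G H" unfolding \<zeta>_def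
    proof (rule homs_restrictI)
      fix x assume "x \<in> verts G"
      then show "F (n - ?l x) (?\<eta> x) \<in> verts H" using Fv homsD(1)[OF \<eta>] by blast
    next
      fix x y assume xy: "x \<in> verts G" "y \<in> verts G" "adj G x y"
      have "?l x \<le> Suc (?l y)" "?l y \<le> Suc (?l x)"
        using level_adj[OF G xy(3)] level_adj[OF G adj_sym[OF xy(3)]] by auto
      then show "adj H (F (n - ?l x) (?\<eta> x)) (F (n - ?l y) (?\<eta> y))"
        by (intro Fkl[OF homsD(1)[OF \<eta> xy(1)] homsD(1)[OF \<eta> xy(2)] homsD(2)[OF \<eta> xy]]) auto
    qed
    have \<zeta>A: "\<zeta> x = F (n - ?l x) (\<alpha> x)" "\<alpha> x \<in> verts H" if "x \<in> A" for x
      using that A(2) homsD(1)[OF \<eta>, of x] by (auto simp: \<zeta>_def glue_apply)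
    have lev_n: "?l x = n" if "\<And>q. q \<in> Q \<Longrightarrow> \<not> near G n x q" for x
    proof (rule ccontr)
      assume "?l x \<noteq> n"
      then have lt: "?l x < n" using level_le[of G n Q x] by simp
      obtain q where "q \<in> Q" "near G (?l x) x q" using level_lt[OF lt] by blast
      then show False using that near_mono[of G "?l x" x q n] lt by auto
    qed
    show "\<exists>\<alpha>'\<in>compatible G H A \<omega>. (\<forall>x\<in>A - nbhd_n G n Q. \<alpha>' x = \<alpha> x) \<and>
        (\<forall>x\<in>A. rank (\<alpha> x) \<le> rank (\<alpha>' x)) \<and> (\<forall>x\<in>Q. \<alpha> x \<noteq> s \<longrightarrow> rank (\<alpha> x) < rank (\<alpha>' x))"
    proof (intro bexI[of _ "restrict \<zeta> A"] conjI ballI impI)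
      show "restrict \<zeta> A \<in> compatible G H A \<omega>"
      proof (rule restrict_mem_compatible[OF G A(2) \<zeta>h \<omega>])
        fix y assume y: "y \<in> boundary G A"
        have yG: "y \<in> verts G" and yA: "y \<notin> A" using y mem_boundary_iff[OF G A(2)] by (auto simp: boundary_def)
        have "\<not> near G n y q" if "q \<in> Q" for q
        proof
          assume "near G n y q"
          from near_sym[OF this] have "q \<in> nbhd_n G n (boundary G A)" using y unfolding mem_nbhd_n_iff by blast
          then show False using that Q by blast
        qed
        then have "?l y = n" by (rule lev_n)
        then show "\<zeta> y = \<omega> y" using yG yA F0[OF homsD(1)[OF \<omega> yG]] by (simp add: \<zeta>_def glue_apply)
      qed
    next
      fix x assume x: "x \<in> A - nbhd_n G n Q"
      then have "?l x = n" by (intro lev_n) (auto simp: mem_nbhd_n_iff)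
      then show "restrict \<zeta> A x = \<alpha> x" using x \<zeta>A[of x] F0 by simp
    next
      fix x assume "x \<in> A"
      then show "rank (\<alpha> x) \<le> rank (restrict \<zeta> A x)" using \<zeta>A[of x] Fr by simp
    next
      fix x assume x: "x \<in> Q" "\<alpha> x \<noteq> s"
      then have xA: "x \<in> A" using Q by blast
      have "?l x = 0" by (rule level_mem[OF x(1)]) (use xA A in blast)
      then show "rank (\<alpha> x) < rank (restrict \<zeta> A x)" using \<zeta>A[OF xA] Fn[of "\<alpha> x" n] Fs x(2) xA by simp
    qed
  qed
  obtain c where c: "0 \<le> c" and main: "\<And>A B \<beta> \<omega>1 \<omega>2 Y \<theta>1 \<theta>2. finite A \<and> A \<subseteq> verts G \<and> B \<subseteq> A \<and>
     \<omega>1 \<in> homs G H \<and> \<omega>2 \<in> homs G H \<and>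
     (\<forall>x\<in>A - nbhd_n G n Y. \<theta>1 x = \<theta>2 x) \<and> (\<forall>x\<in>boundary G A - nbhd_n G n Y. \<omega>1 x = \<omega>2 x) \<and>
     raisable G H rank n A (nbhd_n G n Y) \<omega>1 \<theta>1 \<and> raisable G H rank n A (nbhd_n G n Y) \<omega>2 \<theta>2 \<Longrightarrow>
     \<bar>marginal G H (gibbs G H (bias c rank)) A \<omega>1 B \<beta> - marginal G H (gibbs G H (bias c rank)) A \<omega>2 B \<beta>\<bar>
       \<le> real (card B) * exp (\<gamma> * real n) * exp_decay \<gamma> (sdist G B Y)"
    using raisable_imp_decay[OF G deg finH \<gamma>, where rank = rank and g = n]
    apply (elim exE conjE)
    subgoal premises p for c
      by (rule p(1)[of c, OF p(2)]) (rule p(3)[rule_format])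
    done
  have "exp_WSM G H (gibbs G H (bias c rank)) \<gamma>"
    unfolding exp_WSM_def
  proof (intro exI[of _ "exp (\<gamma> * real n)"] conjI allI impI ballI)
    fix A B \<beta> \<omega>1 \<omega>2
    assume A: "A \<subseteq> verts G" "finite A" and B: "B \<subseteq> A" and w: "\<omega>1 \<in> homs G H" "\<omega>2 \<in> homs G H"
    have "boundary G A \<subseteq> nbhd_n G n (boundary G A)"
    proof
      fix x assume x: "x \<in> boundary G A"
      then have "near G n x x" by (intro near_refl) (simp add: boundary_def)
      then show "x \<in> nbhd_n G n (boundary G A)" using x unfolding mem_nbhd_n_iff by blast
    qed
    then show "\<bar>marginal G H (gibbs G H (bias c rank)) A \<omega>1 B \<beta> - marginal G H (gibbs G H (bias c rank)) A \<omega>2 B \<beta>\<bar>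
       \<le> real (card B) * exp (\<gamma> * real n) * exp_decay \<gamma> (sdist G B (boundary G A))"
      using raise[OF A(2,1) w(1)] raise[OF A(2,1) w(2)] A B w
      by (intro main[where ?\<theta>1.0 = "\<lambda>x. s" and ?\<theta>2.0 = "\<lambda>x. s"]) blast
  qed simp
  then show "\<exists>\<Phi>. interaction H \<Phi> \<and> exp_WSM G H (gibbs G H \<Phi>) \<gamma>" using interaction_bias[OF c] by blast
qed

lemma exp_decay_antimono:
  assumes "0 < \<gamma>" "d \<le> e"
  shows "exp_decay \<gamma> e \<le> exp_decay \<gamma> d"
  using assms by (cases d; cases e) (auto simp: exp_decay_def)

lemma exp_SSM_imp_exp_WSM:
  assumes \<gamma>: "0 < \<gamma>" and "exp_SSM G H \<pi> \<gamma>"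
  shows "exp_WSM G H \<pi> \<gamma>"
proof -
  obtain K where K: "K > 0" and ssm: "\<forall>A B. A \<subseteq> verts G \<longrightarrow> finite A \<longrightarrow> B \<subseteq> A \<longrightarrow>
        (\<forall>\<beta>\<in>B \<rightarrow>\<^sub>E verts H. \<forall>\<omega>1\<in>homs G H. \<forall>\<omega>2\<in>homs G H.
           \<bar>marginal G H \<pi> A \<omega>1 B \<beta> - marginal G H \<pi> A \<omega>2 B \<beta>\<bar>
             \<le> real (card B) * K * exp_decay \<gamma> (sdist G B (disagreement (boundary G A) \<omega>1 \<omega>2)))"
    using assms(2) unfolding exp_SSM_def by (elim exE conjE) (rule that)
  show ?thesis unfolding exp_WSM_def
  proof (intro exI[of _ K] conjI K allI impI ballI)
    fix A B \<beta> \<omega>1 \<omega>2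
    assume h: "A \<subseteq> verts G" "finite A" "B \<subseteq> A" "\<beta> \<in> B \<rightarrow>\<^sub>E verts H" "\<omega>1 \<in> homs G H" "\<omega>2 \<in> homs G H"
    let ?Y = "disagreement (boundary G A) \<omega>1 \<omega>2"
    have "sdist G B (boundary G A) \<le> sdist G B ?Y"
      unfolding sdist_def by (intro INF_mono' INF_superset_mono) (auto simp: disagreement_def)
    then have "exp_decay \<gamma> (sdist G B ?Y) \<le> exp_decay \<gamma> (sdist G B (boundary G A))"
      by (rule exp_decay_antimono[OF \<gamma>])
    then have "real (card B) * K * exp_decay \<gamma> (sdist G B ?Y) \<le> real (card B) * K * exp_decay \<gamma> (sdist G B (boundary G A))"
      using K by (intro mult_left_mono) auto
    then show "\<bar>marginal G H \<pi> A \<omega>1 B \<beta> - marginal G H \<pi> A \<omega>2 B \<beta>\<bar>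
       \<le> real (card B) * K * exp_decay \<gamma> (sdist G B (boundary G A))"
      using ssm[rule_format, OF h] by linarith
  qed
qed

lemma exists_SSM_imp_exists_WSM: "exists_SSM G H \<Longrightarrow> exists_WSM G H"
  unfolding exists_SSM_def exists_WSM_def using exp_SSM_imp_exp_WSM by blast

section \<open>The implications\<close>

theorem theorem7p1:
  fixes H :: "'v ugraph"
  assumes "constraint_graph H"
  shows
    "(((\<exists>s. safe_symbol H s) \<longleftrightarrow> every_board (\<lambda>G. single_site_fillable G H))
      \<and> (every_board (\<lambda>G. single_site_fillable G H) \<longrightarrow>
           connected_graph H \<and> chordal_tree_decomposable H)
      \<and> (connected_graph H \<and> chordal_tree_decomposable H \<longrightarrow> every_board (\<lambda>G. UMC G H))
      \<and> (every_board (\<lambda>G. UMC G H) \<longrightarrow> every_board (\<lambda>G. TSSM G H))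
      \<and> (every_board (\<lambda>G. TSSM G H) \<longrightarrow> every_board (\<lambda>G. strongly_irreducible G H))
      \<and> (every_board (\<lambda>G. strongly_irreducible G H) \<longleftrightarrow> dismantlable H))
     \<and>
     (\<forall>G :: 'x ugraph. board G \<longrightarrow>
        (UMC G H \<longrightarrow> TSSM G H) \<and> (TSSM G H \<longrightarrow> strongly_irreducible G H))
     \<and>
     (\<forall>G :: 'x ugraph. board G \<and> bounded_degree G \<longrightarrow>
        (UMC G H \<longrightarrow> exists_SSM G H)
        \<and> (exists_SSM G H \<longrightarrow> exists_WSM G H)
        \<and> (dismantlable H \<longrightarrow> exists_WSM G H))"
proof -
  have i: "(\<exists>s. safe_symbol H s) \<longleftrightarrow> every_board (\<lambda>G. single_site_fillable G H)"
  proof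
    show "every_board (\<lambda>G. single_site_fillable G H)" if "\<exists>s. safe_symbol H s"
      using that safe_symbol_imp_SSF unfolding every_board_def by (elim exE) (intro allI impI)
    show "\<exists>s. safe_symbol H s" if "every_board (\<lambda>G. single_site_fillable G H)"
      using SSF_imp_safe_symbol[OF assms that] .
  qed
  have ii: "connected_graph H \<and> chordal_tree_decomposable H" if "safe_symbol H s" for s
    using safe_symbol_imp_connected[OF that] safe_symbol_imp_decomposable[OF that] by blast
  have iii: "every_board (\<lambda>G. UMC G H)" if "connected_graph H" "chordal_tree_decomposable H"
    using chordal_tree_decomposable_imp_UMC[OF board_ugraph assms that] unfolding every_board_def by blast
  have vi: "every_board (\<lambda>G. strongly_irreducible G H) \<longleftrightarrow> dismantlable H"
    using strongly_irreducible_imp_dismantlable[OF assms] dismantlable_imp_strongly_irreducible[OF board_ugraph]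
    unfolding every_board_def by blast
  have "every_board (\<lambda>G. UMC G H) \<longrightarrow> every_board (\<lambda>G. TSSM G H)"
    using UMC_imp_TSSM[OF board_ugraph] unfolding every_board_def by blast
  moreover have "every_board (\<lambda>G. TSSM G H) \<longrightarrow> every_board (\<lambda>G. strongly_irreducible G H)"
    using TSSM_imp_strongly_irreducible unfolding every_board_def by blast
  moreover have "\<forall>G :: 'x ugraph. board G \<longrightarrow>
        (UMC G H \<longrightarrow> TSSM G H) \<and> (TSSM G H \<longrightarrow> strongly_irreducible G H)"
    using UMC_imp_TSSM[OF board_ugraph] TSSM_imp_strongly_irreducible by blast
  moreover have "\<forall>G :: 'x ugraph. board G \<and> bounded_degree G \<longrightarrow>
        (UMC G H \<longrightarrow> exists_SSM G H) \<and> (exists_SSM G H \<longrightarrow> exists_WSM G H) \<and> (dismantlable H \<longrightarrow> exists_WSM G H)"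
    using UMC_imp_exists_SSM[OF board_ugraph _ assms] exists_SSM_imp_exists_WSM
      dismantlable_imp_exists_WSM[OF board_ugraph _ assms] by blast
  ultimately show ?thesis using i ii iii vi by blast
qed

end
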